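(* For all $j=0,1,\dots,n-1$, \begin{equation*} \dim \tilde{H}_{n-2}(I_{j}(B_n(q)))= q^{{n\choose 2} + j} \, a^{\mathrm{maj},\mathrm{exc}}_{n,j}(q^{-1}) .\end{equation*}
   Context: For ranked posets $P,Q$ with rank functions $r_P,r_Q$, the Rees product $P\ast Q$ is the poset on $\{(p,q)\in P\times Q: r_P(p)\ge r_Q(q)\}$ in which $(p_2,q_2)$ covers $(p_1,q_1)$ if and only if $p_2$ covers $p_1$ in $P$ and either $q_2=q_1$ or $q_2$ covers $q_1$ in $Q$. $C_n$ is the chain $\{0<1<\dots<n-1\}$. For a poset $P$ with minimum element $\hat 0$, $P^-=P\setminus\{\hat 0\}$. For a bounded ranked poset $P$ of length $n$ with maximum $\hat 1$, the maximal elements of $P^-\ast C_n$ are $(\hat 1,j)$, $j=0,\dots,n-1$, and $I_j(P)$ denotes the open principal order ideal generated by $(\hat 1,j)$. $B_n(q)$ is the lattice of subspaces of $\mathbb F_q^n$. Homology is reduced homology of the order complex with complex coefficients. For $\sigma\in\mathfrak S_n$, $\mathrm{maj}(\sigma)=\sum_{i:\sigma(i)>\sigma(i+1)} i$ and $\mathrm{exc}(\sigma)=|\{i\in[n-1]:\sigma(i)>i\}|$; $A^{\mathrm{maj},\mathrm{exc}}_n(q,t)=\sum_{\sigma\in\mathfrak S_n}q^{\mathrm{maj}(\sigma)}t^{\mathrm{exc}(\sigma)}$, and $a^{\mathrm{maj},\mathrm{exc}}_{n,j}(q)$ is the coefficient of $t^j$ in $A^{\mathrm{maj},\mathrm{exc}}_n(q,t)$.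 *)

theory Defs
  imports
    "HOL-Analysis.Analysis"
    "HOL-Algebra.AbelCoset"
    "HOL-Algebra.Order"
    "HOL-Library.Poly_Mapping"
    "Jordan_Normal_Form.Missing_VectorSpace"
begin

section \<open>Posets\<close>

text \<open>
  Posets are records of type \<open>'a gorder\<close> whose \<open>eq\<close> component is equality; all of them are finite.
  A subset \<open>A\<close> with the induced order is \<open>P\<lparr>carrier := A\<rparr>\<close>.
\<close>

definition covers :: "'a gorder \<Rightarrow> 'a \<Rightarrow> 'a \<Rightarrow> bool" where
  "covers P y x \<longleftrightarrow> x \<in> carrier P \<and> y \<in> carrier P \<and> x \<sqsubset>\<^bsub>P\<^esub> y \<and>
     \<not> (\<exists>z\<in>carrier P. x \<sqsubset>\<^bsub>P\<^esub> z \<and> z \<sqsubset>\<^bsub>P\<^esub> y)"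

text \<open>The chains $x_0 < \dots < x_k$ of \<open>P\<close>, listed increasingly; the empty chain is included.\<close>

definition poset_chains :: "'a gorder \<Rightarrow> 'a list set" where
  "poset_chains P = {xs. sorted_wrt (\<lambda>x y. x \<sqsubset>\<^bsub>P\<^esub> y) xs \<and> set xs \<subseteq> carrier P}"

definition poset_length :: "'a gorder \<Rightarrow> nat" where
  "poset_length P = Max (length ` poset_chains P) - 1"

text \<open>
  The rank of \<open>x\<close> is the length of its principal order ideal, so minimal elements have rank 0.
\<close>

definition poset_rank :: "'a gorder \<Rightarrow> 'a \<Rightarrow> nat" where
  "poset_rank P x = poset_length (P\<lparr>carrier := {y \<in> carrier P. y \<sqsubseteq>\<^bsub>P\<^esub> x}\<rparr>)"

definition chain_poset :: "nat \<Rightarrow> nat gorder" where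
  "chain_poset n = \<lparr>carrier = {0..<n}, eq = (=), le = (\<le>)\<rparr>"

definition remove_bottom :: "'a gorder \<Rightarrow> 'a gorder" where
  "remove_bottom P = P\<lparr>carrier := carrier P - {\<bottom>\<^bsub>P\<^esub>}\<rparr>"

definition open_principal_ideal :: "'a gorder \<Rightarrow> 'a \<Rightarrow> 'a gorder" where
  "open_principal_ideal P x = P\<lparr>carrier := {y \<in> carrier P. y \<sqsubset>\<^bsub>P\<^esub> x}\<rparr>"

section \<open>Rees products\<close>

definition rees_carrier :: "'a gorder \<Rightarrow> 'b gorder \<Rightarrow> ('a \<times> 'b) set" where
  "rees_carrier P Q = {(p, q). p \<in> carrier P \<and> q \<in> carrier Q \<and> poset_rank P p \<ge> poset_rank Q q}"

definition rees_covers :: "'a gorder \<Rightarrow> 'b gorder \<Rightarrow> 'a \<times> 'b \<Rightarrow> 'a \<times> 'b \<Rightarrow> bool" where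
  "rees_covers P Q y x \<longleftrightarrow> x \<in> rees_carrier P Q \<and> y \<in> rees_carrier P Q \<and>
     covers P (fst y) (fst x) \<and> (snd y = snd x \<or> covers Q (snd y) (snd x))"

text \<open>
  A finite poset is determined by its cover relation: its order is the reflexive transitive closure.
\<close>

definition rees_product :: "'a gorder \<Rightarrow> 'b gorder \<Rightarrow> ('a \<times> 'b) gorder" where
  "rees_product P Q =
     \<lparr>carrier = rees_carrier P Q, eq = (=), le = rtranclp (\<lambda>x y. rees_covers P Q y x)\<rparr>"

text \<open>$I_j(P)$, for a bounded ranked poset \<open>P\<close>.\<close>

definition rees_ideal :: "'a gorder \<Rightarrow> nat \<Rightarrow> ('a \<times> nat) gorder" where
  "rees_ideal P j = open_principal_ideal
     (rees_product (remove_bottom P) (chain_poset (poset_length P))) (\<top>\<^bsub>P\<^esub>, j)"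

text \<open>
  $B_n(q)$, with \<open>CARD('a) = q\<close> and \<open>CARD('n) = n\<close>.
\<close>

definition subspace_lattice :: "('a::field ^ 'n) set gorder" where
  "subspace_lattice = \<lparr>carrier = {U. vec.subspace U}, eq = (=), le = (\<subseteq>)\<rparr>"

section \<open>Reduced homology of the order complex\<close>

definition complex_field :: "complex ring" where
  "complex_field = \<lparr>carrier = UNIV, mult = (*), one = 1, zero = 0, add = (+)\<rparr>"

text \<open>
  The faces of the order complex are the chains of the poset, oriented by the order of the poset. A
  face of dimension \<open>k\<close> has \<open>k + 1\<close> elements; dimension \<open>-1\<close> is the empty face.
\<close>

definition order_complex_faces :: "'a gorder \<Rightarrow> int \<Rightarrow> 'a list set" where
  "order_complex_faces P k = {xs \<in> poset_chains P. int (length xs) = k + 1}"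

text \<open>The components \<open>mult\<close> and \<open>one\<close> of a module record play no role.\<close>

definition simplicial_chains ::
    "'a gorder \<Rightarrow> int \<Rightarrow> (complex, 'a list \<Rightarrow>\<^sub>0 complex) module" where
  "simplicial_chains P k =
     \<lparr>carrier = {c. Poly_Mapping.keys c \<subseteq> order_complex_faces P k},
      mult = undefined, one = undefined, zero = 0, add = (+),
      module.smult = (\<lambda>a. Poly_Mapping.map ((*) a))\<rparr>"

definition boundary :: "('a list \<Rightarrow>\<^sub>0 complex) \<Rightarrow> ('a list \<Rightarrow>\<^sub>0 complex)" where
  "boundary c = (\<Sum>xs\<in>Poly_Mapping.keys c. \<Sum>i<length xs.
     Poly_Mapping.single (take i xs @ drop (Suc i) xs) ((-1) ^ i * Poly_Mapping.lookup c xs))"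

definition simplicial_cycles ::
    "'a gorder \<Rightarrow> int \<Rightarrow> (complex, 'a list \<Rightarrow>\<^sub>0 complex) module" where
  "simplicial_cycles P k =
     (simplicial_chains P k)\<lparr>carrier := {c \<in> carrier (simplicial_chains P k). boundary c = 0}\<rparr>"

definition simplicial_boundaries :: "'a gorder \<Rightarrow> int \<Rightarrow> ('a list \<Rightarrow>\<^sub>0 complex) set" where
  "simplicial_boundaries P k = boundary ` carrier (simplicial_chains P (k + 1))"

text \<open>The quotient of a module \<open>M\<close> by a submodule with carrier \<open>N\<close>, on the cosets of \<open>N\<close>.\<close>

definition quotient_module :: "('r, 'm) module \<Rightarrow> 'm set \<Rightarrow> ('r, 'm set) module" where
  "quotient_module M N =
     \<lparr>carrier = a_rcosets\<^bsub>M\<^esub> N, mult = undefined, one = undefined,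
      zero = N, add = set_add M,
      module.smult = (\<lambda>a X. \<Union>x\<in>X. N +>\<^bsub>M\<^esub> (a \<odot>\<^bsub>M\<^esub> x))\<rparr>"

definition reduced_homology ::
    "'a gorder \<Rightarrow> int \<Rightarrow> (complex, ('a list \<Rightarrow>\<^sub>0 complex) set) module" where
  "reduced_homology P k = quotient_module (simplicial_cycles P k) (simplicial_boundaries P k)"

section \<open>Permutation statistics\<close>

definition maj :: "nat \<Rightarrow> (nat \<Rightarrow> nat) \<Rightarrow> nat" where
  "maj n \<sigma> = (\<Sum>i | i \<in> {1..n - 1} \<and> \<sigma> i > \<sigma> (i + 1). i)"

definition exc :: "nat \<Rightarrow> (nat \<Rightarrow> nat) \<Rightarrow> nat" where
  "exc n \<sigma> = card {i \<in> {1..n - 1}. \<sigma> i > i}"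

text \<open>
  $A_n^{\mathrm{maj},\mathrm{exc}}(q,t)$, as a polynomial in $t$ whose coefficients are polynomials
  in $q$.
\<close>

definition maj_exc_poly :: "nat \<Rightarrow> 'r::comm_semiring_1 poly poly" where
  "maj_exc_poly n =
     (\<Sum>\<sigma> | \<sigma> permutes {1..n}. Polynomial.monom (Polynomial.monom 1 (maj n \<sigma>)) (exc n \<sigma>))"

definition maj_exc_coeff :: "nat \<Rightarrow> nat \<Rightarrow> 'r::comm_semiring_1 poly" where
  "maj_exc_coeff n j = Polynomial.coeff (maj_exc_poly n) j"

end

theory Submission
  imports Defs "HOL-Computational_Algebra.Formal_Power_Series"
begin

text \<open>
  Write $q$ for the order of the field and $p = 1/q$. The ideal $I_j(B_n(q))$ is the proper part of
  a totally semimodular poset, so its homology is concentrated in degree $n - 2$ and its dimension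
  is, up to sign, the alternating number $e_{n,j}$ of chains. Splitting a chain at its largest
  element gives $\sum_k {n \brack k}_q [n-k+1]_t\, e_k(t) = [n]_t$ (sum over $1 \le k \le n$) for
  $e_n(t) = \sum_j e_{n,j} t^j$.

  It remains to see that $(-1)^{n-1} q^{n \choose 2} \sum_\sigma p^{\mathrm{maj}\,\sigma}
  (qt)^{\mathrm{exc}\,\sigma}$ obeys the same recurrence. By MacMahon's method,
  $\sum_\sigma p^{\mathrm{maj}\,\sigma} (t/p)^{\mathrm{exc}\,\sigma} / \prod_{i \le n} (1 - p^i)$ is the
  limit for $N \to \infty$ of a sum over pairs of $\sigma$ and a compatible weakly decreasing
  sequence in $\{0, \dots, N\}$. Barring the sequence at the excedances of $\sigma$ turns such a pair
  into a word $u$ over barred and unbarred letters in which every unbarred letter is at least, and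
  every barred letter at most, the letter at the same place of the sorted word (a barred letter
  never coming from a fixed point of $\sigma$). As in MacMahon's master theorem the generating
  function of these words is found by adding one letter at a time; it is
  $(1 - t) T_N / (U_N - t T_N)$ with $U_N = \prod_{i<N} (1 - p^i z)$ and
  $T_N = \prod_{i<N} (1 - t p^i z)$.
\<close>

section \<open>Generating functions of cyclically constrained words\<close>

text \<open>The evaluation point is \<open>1/q\<close> because subspaces are counted by Gaussian
  binomials at \<open>q > 1\<close>, while MacMahon's geometric series need a ratio below 1.
  Rewriting the products of \<open>1 - p^i\<close> through products of \<open>q^i - 1\<close>
  produces the power \<open>q ^ (n choose 2)\<close>. The power \<open>q ^ j\<close> comes from the
  coding of words. Among equal values, unbarred letters precede barred ones: on a run of equal
  values the permutation has no descent, so an excedance there is followed only by excedances. A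
  barred letter of value \<open>v\<close> is then paired with the unbarred letter of value
  \<open>v - 1\<close>. The two letters of a pair have the same row and share one weight
  \<open>x i\<close>, which makes the linear system telescope; the price is a factor
  \<open>1/p = q\<close> for every excedance. Alphabets are finite at first because letters are
  added one at a time; the number \<open>N\<close> of letter pairs disappears in the limit. The
  functional equation carries a factor \<open>1 - t\<close>, so the recurrence is obtained for
  \<open>t \<noteq> 1\<close> only, and the last step compares two polynomials in \<open>t\<close>
  at all other real points.\<close>

text \<open>
  The coefficient of the monomial \<open>\<mu>\<close> in the product of the linear forms $\sum_l r(l) x_l$, for
  \<open>r\<close> in \<open>rs\<close>.
\<close>

fun assign_sum :: "('a \<Rightarrow> 'r::comm_semiring_1) list \<Rightarrow> 'a multiset \<Rightarrow> 'r" where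
  "assign_sum [] \<mu> = (if \<mu> = {#} then 1 else 0)"
| "assign_sum (r # rs) \<mu> = (\<Sum>l\<in>set_mset \<mu>. r l * assign_sum rs (\<mu> - {#l#}))"

text \<open>Both sides sum over ordered pairs of letters that can be removed together from
  \<open>\<mu>\<close>; exchanging the letters exchanges the rows.\<close>

lemma assign_sum_swap: "assign_sum (r # s # rs) \<mu> = assign_sum (s # r # rs) \<mu>"
proof -
  have *: "assign_sum (r # s # rs) \<mu> =
      (\<Sum>(k, l)\<in>{(k, l). {#k, l#} \<subseteq># \<mu>}. r k * s l * assign_sum rs (\<mu> - {#k, l#}))" for r s
  proof -
    have "assign_sum (r # s # rs) \<mu> = (\<Sum>(k, l)\<in>(SIGMA k:set_mset \<mu>. set_mset (\<mu> - {#k#})).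
        r k * s l * assign_sum rs (\<mu> - {#k, l#}))"
      by (simp add: sum.Sigma[symmetric] sum_distrib_left mult_ac add_mset_commute)
    also have "(SIGMA k:set_mset \<mu>. set_mset (\<mu> - {#k#})) = {(k, l). {#k, l#} \<subseteq># \<mu>}"
      by (auto simp: insert_subset_eq_iff add_mset_commute)
    finally show ?thesis .
  qed
  have "(\<Sum>(k, l)\<in>{(k, l). {#k, l#} \<subseteq># \<mu>}. r k * s l * assign_sum rs (\<mu> - {#k, l#})) =
      (\<Sum>(k, l)\<in>{(k, l). {#k, l#} \<subseteq># \<mu>}. s k * r l * assign_sum rs (\<mu> - {#k, l#}))"
    by (rule sum.reindex_bij_witness[of _ prod.swap prod.swap])
       (auto simp: mult_ac add_mset_commute)
  then show ?thesis
    unfolding * .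
qed

lemma assign_sum_move: "assign_sum (xs @ r # ys) \<mu> = assign_sum (r # xs @ ys) \<mu>"
proof (induction xs arbitrary: \<mu>)
  case (Cons x xs)
  have "assign_sum ((x # xs) @ r # ys) \<mu> = assign_sum (x # r # xs @ ys) \<mu>"
    using Cons.IH by simp
  also have "\<dots> = assign_sum (r # x # xs @ ys) \<mu>"
    by (rule assign_sum_swap)
  finally show ?case by simp
qed simp

text \<open>Linear forms commute, so a row can be pulled to the front without tracking its place in
  a sorted list.\<close>

lemma assign_sum_cong_mset:
  "mset rs = mset rs' \<Longrightarrow> assign_sum rs \<mu> = assign_sum rs' \<mu>"
proof (induction rs arbitrary: rs' \<mu>)
  case (Cons r rs)
  then have "r \<in> set rs'"
    by (metis list.set_intros(1) mset_eq_setD)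
  then obtain xs ys where rs': "rs' = xs @ r # ys"
    by (meson split_list)
  then have "mset rs = mset (xs @ ys)"
    using Cons.prems by simp
  then show ?case
    using Cons.IH[of "xs @ ys"] unfolding rs' assign_sum_move by simp
qed simp

lemma assign_sum_delta:
  assumes "l \<in># \<mu>"
  shows "assign_sum ((\<lambda>k. if k = l then x else 0) # rs) \<mu> = x * assign_sum rs (\<mu> - {#l#})"
proof -
  have "(\<Sum>k\<in>set_mset \<mu>. (if k = l then x else 0) * assign_sum rs (\<mu> - {#k#})) =
      (\<Sum>k\<in>set_mset \<mu>. if k = l then x * assign_sum rs (\<mu> - {#l#}) else 0)"
    by (rule sum.cong) auto
  then show ?thesis
    using assms by simp
qed

lemma assign_sum_words:
  fixes rs :: "('a \<Rightarrow> 'r::comm_semiring_1) list"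
  shows "assign_sum rs \<mu> = (\<Sum>u | mset u = \<mu> \<and> length u = length rs. \<Prod>k<length rs. (rs ! k) (u ! k))"
proof (induction rs arbitrary: \<mu>)
  case Nil
  have "{u. mset u = \<mu> \<and> length u = length []} = (if \<mu> = {#} then {[]} else {})"
    by auto
  then show ?case by simp
next
  case (Cons r rs)
  have fin: "finite {u. mset u = \<nu> \<and> length u = n}" for \<nu> :: "'a multiset" and n
    by (rule finite_subset[OF _ finite_lists_length_eq[of "set_mset \<nu>" n]]) auto
  have "assign_sum (r # rs) \<mu> = (\<Sum>l\<in>set_mset \<mu>. \<Sum>u | mset u = \<mu> - {#l#} \<and> length u = length rs.
      r l * (\<Prod>k<length rs. (rs ! k) (u ! k)))"
    by (simp add: Cons.IH sum_distrib_left)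
  also have "\<dots> = (\<Sum>(l, u)\<in>(SIGMA l:set_mset \<mu>. {u. mset u = \<mu> - {#l#} \<and> length u = length rs}).
      r l * (\<Prod>k<length rs. (rs ! k) (u ! k)))"
    by (subst sum.Sigma) (auto intro: fin)
  also have "\<dots> = (\<Sum>u | mset u = \<mu> \<and> length u = length (r # rs). \<Prod>k<length (r # rs). ((r # rs) ! k) (u ! k))"
    by (rule sum.reindex_bij_witness[of _ "\<lambda>u. (hd u, tl u)" "\<lambda>(l, u). l # u"])
       (auto simp: length_Suc_conv prod.lessThan_Suc_shift simp del: prod.lessThan_Suc)
  finally show ?case .
qed

definition msets :: "'a set \<Rightarrow> nat \<Rightarrow> 'a multiset set" where
  "msets A n = {\<mu>. set_mset \<mu> \<subseteq> A \<and> size \<mu> = n}"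

lemma finite_msets: "finite A \<Longrightarrow> finite (msets A n)"
proof (rule finite_subset)
  show "msets A n \<subseteq> mset ` {xs. set xs \<subseteq> A \<and> length xs = n}"
  proof
    fix \<mu> assume "\<mu> \<in> msets A n"
    moreover obtain xs where "mset xs = \<mu>" using ex_mset by blast
    ultimately show "\<mu> \<in> mset ` {xs. set xs \<subseteq> A \<and> length xs = n}"
      by (auto simp: msets_def intro!: image_eqI[of _ _ xs])
  qed
qed (simp add: finite_lists_length_eq)

lemma msets_0 [simp]: "msets A 0 = {{#}}"
  by (auto simp: msets_def)

text \<open>Double counting: a multiset with a marked letter of its support amounts to a letter and
  the remaining multiset. A letter is marked once, whatever its multiplicity.\<close>

lemma sum_msets_remove:
  fixes g :: "'a \<Rightarrow> 'a multiset \<Rightarrow> 'r::comm_monoid_add"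
  assumes "finite A" "B \<subseteq> A"
  shows "(\<Sum>\<mu>\<in>msets A (Suc n). \<Sum>l\<in>set_mset \<mu> \<inter> B. g l (\<mu> - {#l#})) = (\<Sum>l\<in>B. \<Sum>\<mu>\<in>msets A n. g l \<mu>)"
proof -
  have fB: "finite B" using assms finite_subset by auto
  have "(\<Sum>\<mu>\<in>msets A (Suc n). \<Sum>l\<in>set_mset \<mu> \<inter> B. g l (\<mu> - {#l#})) =
      (\<Sum>(\<mu>, l)\<in>(SIGMA \<mu>:msets A (Suc n). set_mset \<mu> \<inter> B). g l (\<mu> - {#l#}))"
    by (subst sum.Sigma) (auto simp: finite_msets assms)
  also have "\<dots> = (\<Sum>(l, \<mu>)\<in>B \<times> msets A n. g l \<mu>)"
    by (rule sum.reindex_bij_witness[of _ "\<lambda>(l, \<mu>). (add_mset l \<mu>, l)" "\<lambda>(\<mu>, l). (l, \<mu> - {#l#})"])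
       (use assms in \<open>auto simp: msets_def size_Diff_singleton in_diff_count dest: in_diffD\<close>)
  also have "\<dots> = (\<Sum>l\<in>B. \<Sum>\<mu>\<in>msets A n. g l \<mu>)"
    by (subst sum.Sigma) (auto simp: finite_msets assms fB)
  finally show ?thesis .
qed

text \<open>
  One row \<open>R l\<close> for every occurrence of \<open>l\<close> in \<open>\<mu>\<close>: the coefficients of MacMahon's master theorem.
  In \<open>star_fps\<close> one of the rows of the new letter \<open>K\<close> is replaced by an arbitrary row \<open>a\<close>.
\<close>

definition loop_sum :: "(nat \<Rightarrow> nat \<Rightarrow> 'r::comm_semiring_1) \<Rightarrow> nat multiset \<Rightarrow> 'r" where
  "loop_sum R \<mu> = assign_sum (map R (sorted_list_of_multiset \<mu>)) \<mu>"

definition loop_fps :: "(nat \<Rightarrow> nat \<Rightarrow> 'r::comm_ring_1) \<Rightarrow> nat \<Rightarrow> 'r fps" where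
  "loop_fps R K = Abs_fps (\<lambda>n. \<Sum>\<mu>\<in>msets {..<K} n. loop_sum R \<mu>)"

definition star_fps :: "(nat \<Rightarrow> nat \<Rightarrow> 'r::comm_ring_1) \<Rightarrow> nat \<Rightarrow> (nat \<Rightarrow> 'r) \<Rightarrow> 'r fps" where
  "star_fps R K a = Abs_fps (\<lambda>n. \<Sum>\<mu>\<in>msets {..<Suc K} n.
     assign_sum (a # map R (sorted_list_of_multiset \<mu>)) (add_mset K \<mu>))"

lemma loop_sum_add_mset:
  "loop_sum R (add_mset l \<mu>) = assign_sum (R l # map R (sorted_list_of_multiset \<mu>)) (add_mset l \<mu>)"
  unfolding loop_sum_def by (rule assign_sum_cong_mset) simp

lemma loop_fps_0: "loop_fps R 0 = 1"
proof (rule fps_ext)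
  fix n
  have "msets {..<0::nat} n = (if n = 0 then {{#}} else {})"
    by (auto simp: msets_def)
  then show "fps_nth (loop_fps R 0) n = fps_nth 1 n"
    by (simp add: loop_fps_def loop_sum_def)
qed

text \<open>A multiset avoids \<open>K\<close> or contains it; in the second case one of its
  \<open>K\<close>-rows becomes the distinguished row of \<open>star_fps\<close>, and
  \<open>fps_X\<close> accounts for the letter split off.\<close>

lemma loop_fps_Suc: "loop_fps R (Suc K) = loop_fps R K + fps_X * star_fps R K (R K)"
proof (rule fps_ext)
  fix n
  show "fps_nth (loop_fps R (Suc K)) n = fps_nth (loop_fps R K + fps_X * star_fps R K (R K)) n"
  proof (cases n)
    case 0
    then show ?thesis by (simp add: loop_fps_def)
  next
    case (Suc m)
    have split: "msets {..<Suc K} (Suc m) = msets {..<K} (Suc m) \<union> add_mset K ` msets {..<Suc K} m"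
    proof (rule Set.set_eqI)
      fix \<mu> show "\<mu> \<in> msets {..<Suc K} (Suc m) \<longleftrightarrow>
          \<mu> \<in> msets {..<K} (Suc m) \<union> add_mset K ` msets {..<Suc K} m"
      proof (cases "K \<in># \<mu>")
        case True
        then obtain \<nu> where "\<mu> = add_mset K \<nu>" by (meson mset_add)
        then show ?thesis by (auto simp: msets_def)
      next
        case False
        then show ?thesis by (auto simp: msets_def less_Suc_eq)
      qed
    qed
    have "(\<Sum>\<mu>\<in>msets {..<Suc K} (Suc m). loop_sum R \<mu>) =
        (\<Sum>\<mu>\<in>msets {..<K} (Suc m). loop_sum R \<mu>) + (\<Sum>\<mu>\<in>add_mset K ` msets {..<Suc K} m. loop_sum R \<mu>)"
      unfolding split by (rule sum.union_disjoint) (auto simp: finite_msets, auto simp: msets_def)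
    also have "(\<Sum>\<mu>\<in>add_mset K ` msets {..<Suc K} m. loop_sum R \<mu>) =
        (\<Sum>\<mu>\<in>msets {..<Suc K} m. loop_sum R (add_mset K \<mu>))"
      by (subst sum.reindex) (auto simp: inj_on_def)
    finally show ?thesis
      using Suc by (simp add: loop_fps_def star_fps_def loop_sum_add_mset)
  qed
qed

text \<open>
  If the row \<open>a\<close> chooses a letter \<open>l\<close> other than \<open>K\<close>, then deleting this choice leaves one row \<open>R l\<close>
  too many, which takes over the role of \<open>a\<close>: one follows a path until it returns to \<open>K\<close>.
\<close>

lemma star_fps_rec:
  "star_fps R K a = fps_const (a K) * loop_fps R (Suc K) +
     fps_X * (\<Sum>l<K. fps_const (a l) * star_fps R K (R l))"
proof (rule fps_ext)
  fix n
  have expand: "assign_sum (a # rs) (add_mset K \<mu>) =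
      a K * assign_sum rs \<mu> + (\<Sum>l\<in>set_mset \<mu> \<inter> {..<K}. a l * assign_sum rs (add_mset K (\<mu> - {#l#})))"
    if "\<mu> \<in> msets {..<Suc K} n" for \<mu> n rs
  proof -
    have "set_mset (add_mset K \<mu>) = insert K (set_mset \<mu> \<inter> {..<K})"
      using that by (auto simp: msets_def less_Suc_eq)
    moreover have "add_mset K \<mu> - {#l#} = add_mset K (\<mu> - {#l#})" if "l \<in> set_mset \<mu> \<inter> {..<K}" for l
      using that by auto
    ultimately show ?thesis
      by (simp add: sum.insert_remove)
  qed
  have "fps_nth (star_fps R K a) n = (\<Sum>\<mu>\<in>msets {..<Suc K} n. a K * loop_sum R \<mu>) +
      (\<Sum>\<mu>\<in>msets {..<Suc K} n. \<Sum>l\<in>set_mset \<mu> \<inter> {..<K}.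
         a l * assign_sum (map R (sorted_list_of_multiset \<mu>)) (add_mset K (\<mu> - {#l#})))"
    by (simp add: star_fps_def expand sum.distrib loop_sum_def del: assign_sum.simps cong: sum.cong)
  also have "(\<Sum>\<mu>\<in>msets {..<Suc K} n. a K * loop_sum R \<mu>) = fps_nth (fps_const (a K) * loop_fps R (Suc K)) n"
    by (simp add: loop_fps_def sum_distrib_left)
  also have "(\<Sum>\<mu>\<in>msets {..<Suc K} n. \<Sum>l\<in>set_mset \<mu> \<inter> {..<K}.
         a l * assign_sum (map R (sorted_list_of_multiset \<mu>)) (add_mset K (\<mu> - {#l#}))) =
      (\<Sum>\<mu>\<in>msets {..<Suc K} n. \<Sum>l\<in>set_mset \<mu> \<inter> {..<K}.
         a l * assign_sum (R l # map R (sorted_list_of_multiset (\<mu> - {#l#}))) (add_mset K (\<mu> - {#l#})))"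
  proof (intro sum.cong refl arg_cong2[where f = "(*)"] assign_sum_cong_mset)
    fix \<mu> l assume "l \<in> set_mset \<mu> \<inter> {..<K}"
    then have "add_mset l (\<mu> - {#l#}) = \<mu>" by simp
    then show "mset (map R (sorted_list_of_multiset \<mu>)) =
        mset (R l # map R (sorted_list_of_multiset (\<mu> - {#l#})))"
      by (metis image_mset_add_mset mset.simps(2) mset_map mset_sorted_list_of_multiset)
  qed
  also have "\<dots> = fps_nth (fps_X * (\<Sum>l<K. fps_const (a l) * star_fps R K (R l))) n"
  proof (cases n)
    case (Suc m)
    show ?thesis
      unfolding Suc
      by (subst sum_msets_remove[where B = "{..<K}" and
            g = "\<lambda>l \<nu>. a l * assign_sum (R l # map R (sorted_list_of_multiset \<nu>)) (add_mset K \<nu>)"])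
         (auto simp: star_fps_def fps_sum_nth sum_distrib_left simp del: assign_sum.simps)
  qed simp
  finally show "fps_nth (star_fps R K a) n = fps_nth (fps_const (a K) * loop_fps R (Suc K) +
     fps_X * (\<Sum>l<K. fps_const (a l) * star_fps R K (R l))) n"
    by simp
qed

text \<open>
  Any solution of the linear system of the previous lemma determines \<open>star_fps\<close>; the factor \<open>\<Delta>\<close> clears
  the denominators of the solution.
\<close>

lemma star_fps_solution:
  fixes y :: "nat \<Rightarrow> 'r::comm_ring_1 fps"
  assumes y: "\<And>l. l \<le> K \<Longrightarrow>
    y l = \<Delta> * fps_const (R l K) + fps_X * (\<Sum>k<K. fps_const (R l k) * y k)"
  assumes "l \<le> K"
  shows "\<Delta> * star_fps R K (R l) = y l * loop_fps R (Suc K)"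
proof -
  define e where "e l = \<Delta> * star_fps R K (R l) - y l * loop_fps R (Suc K)" for l
  have e: "e l = fps_X * (\<Sum>k<K. fps_const (R l k) * e k)" if "l \<le> K" for l
    unfolding e_def
    by (subst star_fps_rec, subst y[OF that])
       (simp add: algebra_simps sum_distrib_left sum_distrib_right sum_subtractf)
  \<comment> \<open>The factor \<open>fps_X\<close> expresses each coefficient of \<open>e\<close>
    by earlier ones, so the homogeneous system has only the zero solution.\<close>
  have "fps_nth (e l) n = 0" if "l \<le> K" for l n
    using that
  proof (induction n arbitrary: l)
    case 0
    then show ?case by (subst e) auto
  next
    case (Suc n)
    then show ?case by (subst e) (auto simp: fps_sum_nth)
  qed
  then have "e l = 0"
    using assms(2) by (intro fps_ext) simp
  then show ?thesis
    by (simp add: e_def)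
qed

section \<open>The alphabet of barred and unbarred letters\<close>

text \<open>
  The letter \<open>2 * i\<close> is barred and weighted \<open>t * x i\<close>, the letter \<open>2 * i + 1\<close> is unbarred and weighted
  \<open>x i\<close>. The row is that of the letter \<open>l\<close> of the sorted word, \<open>k\<close> the letter of \<open>u\<close> in the same place.
\<close>

definition bar_row :: "(nat \<Rightarrow> 'r) \<Rightarrow> 'r \<Rightarrow> nat \<Rightarrow> nat \<Rightarrow> 'r::comm_ring_1" where
  "bar_row x t l k = (if even k then (if k \<le> l then t * x (k div 2) else 0)
     else (if l \<le> k then x (k div 2) else 0))"

definition lin_prod :: "(nat \<Rightarrow> 'r) \<Rightarrow> nat \<Rightarrow> 'r::comm_ring_1 fps" where
  "lin_prod x N = (\<Prod>i<N. 1 - fps_const (x i) * fps_X)"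

lemma lin_prod_0 [simp]: "lin_prod x 0 = 1"
  and lin_prod_Suc: "lin_prod x (Suc N) = lin_prod x N * (1 - fps_const (x N) * fps_X)"
  by (simp_all add: lin_prod_def)

lemma sum_pairs: "(\<Sum>k<2 * N. f k) = (\<Sum>i<N. f (2 * i) + f (Suc (2 * i)))" for f :: "nat \<Rightarrow> 'a::comm_monoid_add"
  by (induction N) (simp_all add: add.assoc)

text \<open>No row of a smaller letter may choose the barred letter \<open>2 * N\<close>, so a path
  that leaves it never returns. Hence \<open>y\<close> is supported on \<open>2 * N\<close> alone,
  and the new letter contributes a geometric series.\<close>

lemma loop_fps_barred_step:
  fixes x :: "nat \<Rightarrow> 'r::comm_ring_1"
  shows "loop_fps (bar_row x t) (Suc (2 * N)) * (1 - fps_const (t * x N) * fps_X) = loop_fps (bar_row x t) (2 * N)"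
proof -
  define y where "y l = (if l = 2 * N then fps_const (t * x N) else 0)" for l
  have "1 * star_fps (bar_row x t) (2 * N) (bar_row x t (2 * N)) = y (2 * N) * loop_fps (bar_row x t) (Suc (2 * N))"
  proof (rule star_fps_solution)
    fix l assume "l \<le> 2 * N"
    have "(\<Sum>k<2 * N. fps_const (bar_row x t l k) * y k) = 0"
      by (rule sum.neutral) (auto simp: y_def)
    then show "y l = 1 * fps_const (bar_row x t l (2 * N)) + fps_X * (\<Sum>k<2 * N. fps_const (bar_row x t l k) * y k)"
      using \<open>l \<le> 2 * N\<close> by (auto simp: y_def bar_row_def)
  qed simp
  then show ?thesis
    using loop_fps_Suc[of "bar_row x t" "2 * N"] by (simp add: y_def algebra_simps)
qed

text \<open>Every smaller letter may choose the unbarred letter \<open>Suc (2 * N)\<close>, so here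
  the whole linear system has to be solved. The factor \<open>\<Delta>\<close> is the denominator,
  over the numerator \<open>1 - \<tau>\<close>, of the series for the letters below
  \<open>Suc (2 * N)\<close>.\<close>

lemma loop_fps_unbarred_step:
  fixes x :: "nat \<Rightarrow> 'r::comm_ring_1" and t :: 'r and N :: nat
  defines "U \<equiv> lin_prod x" and "T \<equiv> lin_prod (\<lambda>i. t * x i)" and "\<tau> \<equiv> fps_const t"
  defines "\<Delta> \<equiv> (U N - \<tau> * T N) * (1 - fps_const (t * x N) * fps_X)"
  shows "\<Delta> * star_fps (bar_row x t) (Suc (2 * N)) (bar_row x t (Suc (2 * N))) =
    fps_const (x N) * (1 - \<tau>) * U N * loop_fps (bar_row x t) (Suc (Suc (2 * N)))"
proof -
  \<comment> \<open>The entries \<open>y l\<close> telescope, as \<open>(1 - t) x\<^sub>k z U\<^sub>k V\<^sub>k\<^sub>+\<^sub>1 = G\<^sub>k - G\<^sub>k\<^sub>+\<^sub>1\<close>, which makes the system easy to solve.\<close>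
  define V where "V i = (\<Prod>k\<in>{i..<Suc N}. 1 - fps_const (t * x k) * fps_X)" for i
  define G where "G i = U i * V i" for i
  define y where "y l = fps_const (x N) * (1 - \<tau>) * U (l div 2) * V (Suc (l div 2))" for l
  have V: "V i = (1 - fps_const (t * x i) * fps_X) * V (Suc i)" if "i \<le> N" for i
    unfolding V_def using that by (subst prod.atLeast_Suc_lessThan) auto
  have VN: "V (Suc N) = 1"
    by (simp add: V_def)
  have G0: "G 0 = T (Suc N)"
    by (simp add: G_def V_def T_def U_def lin_prod_def atLeast0LessThan)
  have tele: "fps_X * (fps_const (x k) * y (2 * k)) = fps_const (x N) * (G k - G (Suc k))" if "k \<le> N" for k
    unfolding G_def y_def U_def lin_prod_Suc V[OF that]
    by (simp add: algebra_simps \<tau>_def fps_const_mult[symmetric] del: fps_const_mult)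
  have y_odd: "y (Suc (2 * k)) = y (2 * k)" for k
    by (simp add: y_def)
  have sumG: "(\<Sum>k\<in>{a..<b}. G k - G (Suc k)) = G a - G b" if "a \<le> b" for a b
    using that by (induction b rule: dec_induct) auto
  have "\<Delta> * star_fps (bar_row x t) (Suc (2 * N)) (bar_row x t (Suc (2 * N))) =
      y (Suc (2 * N)) * loop_fps (bar_row x t) (Suc (Suc (2 * N)))"
  proof (rule star_fps_solution)
    fix l assume l: "l \<le> Suc (2 * N)"
    \<comment> \<open>A row depends on \<open>l\<close> only through \<open>i\<close>: both letters
      of a pair admit the barred letters up to pair \<open>i\<close> and the unbarred letters from
      pair \<open>i\<close> on.\<close>
    define i where "i = l div 2"
    have i: "i \<le> N" "\<And>k. 2 * k \<le> l \<longleftrightarrow> k \<le> i" "\<And>k. l \<le> Suc (2 * k) \<longleftrightarrow> i \<le> k"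
      using l by (auto simp: i_def)
    have e1: "fps_X * (fps_const (bar_row x t l (2 * k)) * y (2 * k)) =
        (if k \<le> i then \<tau> else 0) * (fps_X * (fps_const (x k) * y (2 * k)))" for k
      using i(2)[of k] by (simp add: bar_row_def \<tau>_def fps_const_mult[symmetric] mult_ac del: fps_const_mult)
    have e2: "fps_X * (fps_const (bar_row x t l (Suc (2 * k))) * y (Suc (2 * k))) =
        (if i \<le> k then 1 else 0) * (fps_X * (fps_const (x k) * y (2 * k)))" for k
      unfolding y_odd using i(3)[of k] by (simp add: bar_row_def mult_ac)
    have "fps_X * (\<Sum>k<Suc (2 * N). fps_const (bar_row x t l k) * y k) =
        (\<Sum>k<Suc N. (if k \<le> i then \<tau> else 0) * (fps_X * (fps_const (x k) * y (2 * k)))) +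
        (\<Sum>k<N. (if i \<le> k then 1 else 0) * (fps_X * (fps_const (x k) * y (2 * k))))"
      by (simp add: sum_pairs distrib_left sum_distrib_left sum.distrib e1 e2)
    also have "(\<Sum>k<Suc N. (if k \<le> i then \<tau> else 0) * (fps_X * (fps_const (x k) * y (2 * k)))) =
        (\<Sum>k<Suc N. if k \<le> i then \<tau> * (fps_const (x N) * (G k - G (Suc k))) else 0)"
      by (rule sum.cong) (auto simp: tele)
    also have "\<dots> = (\<Sum>k\<in>{0..<Suc i}. \<tau> * (fps_const (x N) * (G k - G (Suc k))))"
      using i(1) by (intro sum.mono_neutral_cong_right) auto
    also have "\<dots> = \<tau> * (fps_const (x N) * (G 0 - G (Suc i)))"
      by (simp only: sum_distrib_left[symmetric] sumG)
    also have "(\<Sum>k<N. (if i \<le> k then 1 else 0) * (fps_X * (fps_const (x k) * y (2 * k)))) =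
        (\<Sum>k<N. if i \<le> k then fps_const (x N) * (G k - G (Suc k)) else 0)"
      by (rule sum.cong) (auto simp: tele)
    also have "\<dots> = (\<Sum>k\<in>{i..<N}. fps_const (x N) * (G k - G (Suc k)))"
      using i(1) by (intro sum.mono_neutral_cong_right) auto
    also have "\<dots> = fps_const (x N) * (G i - G N)"
      using i(1) by (simp only: sum_distrib_left[symmetric] sumG)
    finally have sum: "fps_X * (\<Sum>k<Suc (2 * N). fps_const (bar_row x t l k) * y k) =
        \<tau> * (fps_const (x N) * (G 0 - G (Suc i))) + fps_const (x N) * (G i - G N)" .
    have \<Delta>: "\<Delta> = G N - \<tau> * G 0"
      unfolding \<Delta>_def G0 by (simp add: G_def V VN T_def lin_prod_Suc algebra_simps)
    have yl: "y l = fps_const (x N) * (G i - \<tau> * G (Suc i))"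
      unfolding y_def i_def[symmetric] G_def V[OF i(1)] U_def lin_prod_Suc
      by (simp add: algebra_simps \<tau>_def fps_const_mult[symmetric] del: fps_const_mult)
    have "bar_row x t l (Suc (2 * N)) = x N"
      using l by (simp add: bar_row_def)
    then show "y l = \<Delta> * fps_const (bar_row x t l (Suc (2 * N))) +
        fps_X * (\<Sum>k<Suc (2 * N). fps_const (bar_row x t l k) * y k)"
      unfolding sum \<Delta> yl by (simp add: algebra_simps)
  qed simp
  then show ?thesis
    by (simp add: y_def VN)
qed

text \<open>After the unbarred step the unknown series stands on both sides; collecting it turns the
  denominator for the letters below \<open>Suc (2 * N)\<close> into the one for
  \<open>2 * Suc N\<close>.\<close>

lemma loop_fps_bar_row:
  fixes x :: "nat \<Rightarrow> 'r::comm_ring_1" and t :: 'r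
  shows "loop_fps (bar_row x t) (2 * N) * (lin_prod x N - fps_const t * lin_prod (\<lambda>i. t * x i) N) = 1 - fps_const t"
proof (induction N)
  case 0
  then show ?case by (simp add: loop_fps_0)
next
  case (Suc N)
  let ?L = "loop_fps (bar_row x t)" and ?U = "lin_prod x" and ?T = "lin_prod (\<lambda>i. t * x i)"
  let ?b = "1 - fps_const (t * x N) * fps_X"
  have "?L (Suc (Suc (2 * N))) * ((?U N - fps_const t * ?T N) * ?b) =
      (?L (Suc (2 * N)) * ?b) * (?U N - fps_const t * ?T N) +
      fps_X * (((?U N - fps_const t * ?T N) * ?b) * star_fps (bar_row x t) (Suc (2 * N)) (bar_row x t (Suc (2 * N))))"
    by (subst loop_fps_Suc) (simp add: algebra_simps)
  also have "?L (Suc (2 * N)) * ?b * (?U N - fps_const t * ?T N) = 1 - fps_const t"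
    by (simp add: loop_fps_barred_step Suc.IH)
  also note loop_fps_unbarred_step
  finally have "?L (Suc (Suc (2 * N))) *
      ((?U N - fps_const t * ?T N) * ?b - fps_X * (fps_const (x N) * (1 - fps_const t) * ?U N)) = 1 - fps_const t"
    by (simp add: algebra_simps)
  also have "(?U N - fps_const t * ?T N) * ?b - fps_X * (fps_const (x N) * (1 - fps_const t) * ?U N) =
      ?U (Suc N) - fps_const t * ?T (Suc N)"
    by (simp add: lin_prod_Suc algebra_simps fps_const_mult[symmetric] del: fps_const_mult)
  finally show ?case by simp
qed

section \<open>Excluding barred fixed points\<close>

text \<open>
  The first row of a letter of \<open>J\<close> may not choose that letter. For barred letters this excludes
  exactly the words that come from a barred fixed point.
\<close>

fun strict_rows :: "'a set \<Rightarrow> ('a \<Rightarrow> 'a \<Rightarrow> 'r::zero) \<Rightarrow> 'a list \<Rightarrow> ('a \<Rightarrow> 'r) list" where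
  "strict_rows J R [] = []"
| "strict_rows J R (l # xs) = (if l \<in> J then (R l)(l := 0) else R l) # strict_rows (J - {l}) R xs"

lemma length_strict_rows [simp]: "length (strict_rows J R xs) = length xs"
  by (induction xs arbitrary: J) auto

lemma strict_rows_append:
  "strict_rows J R (xs @ ys) = strict_rows J R xs @ strict_rows (J - set xs) R ys"
  by (induction xs arbitrary: J) (simp_all add: Diff_insert2[symmetric])

lemma strict_rows_empty [simp]: "strict_rows {} R xs = map R xs"
  by (induction xs) auto

lemma strict_rows_insert_notin: "l \<notin> set xs \<Longrightarrow> strict_rows (insert l J) R xs = strict_rows J R xs"
  by (induction xs arbitrary: J) (auto simp: insert_Diff_if)

lemma nth_strict_rows:
  "k < length xs \<Longrightarrow> strict_rows J R xs ! k =
     (if xs ! k \<in> J \<and> xs ! k \<notin> set (take k xs) then (R (xs ! k))(xs ! k := 0) else R (xs ! k))"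
proof (induction xs arbitrary: J k)
  case (Cons l xs)
  then show ?case by (cases k) auto
qed simp

lemma strict_rows_cong: "J \<inter> set xs = J' \<inter> set xs \<Longrightarrow> strict_rows J R xs = strict_rows J' R xs"
proof (rule nth_equalityI)
  fix k assume J: "J \<inter> set xs = J' \<inter> set xs" and k: "k < length (strict_rows J R xs)"
  then have "xs ! k \<in> set xs"
    by simp
  with J have "xs ! k \<in> J \<longleftrightarrow> xs ! k \<in> J'"
    by (metis Int_iff)
  then show "strict_rows J R xs ! k = strict_rows J' R xs ! k"
    using k by (simp add: nth_strict_rows)
qed simp

definition strict_fps :: "nat set \<Rightarrow> (nat \<Rightarrow> nat \<Rightarrow> 'r::comm_ring_1) \<Rightarrow> nat \<Rightarrow> 'r fps" where
  "strict_fps J R K = Abs_fps (\<lambda>n. \<Sum>\<mu>\<in>msets {..<K} n.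
     assign_sum (strict_rows J R (sorted_list_of_multiset \<mu>)) \<mu>)"

lemma strict_fps_empty: "strict_fps {} R K = loop_fps R K"
  by (simp add: strict_fps_def loop_fps_def loop_sum_def)

text \<open>Forbidding the first \<open>l\<close>-row to choose \<open>l\<close> subtracts the assignments in which it does;
  deleting that row and that letter leaves an arbitrary assignment.\<close>

lemma strict_fps_insert:
  fixes R :: "nat \<Rightarrow> nat \<Rightarrow> 'r::comm_ring_1"
  assumes "l \<notin> J" "l < K"
  shows "strict_fps (insert l J) R K = strict_fps J R K * (1 - fps_const (R l l) * fps_X)"
proof (rule fps_ext)
  fix n
  define S where "S J \<mu> = assign_sum (strict_rows J R (sorted_list_of_multiset \<mu>)) \<mu>" for J \<mu>
  have S_in: "S (insert l J) \<mu> = S J \<mu> - R l l * S J (\<mu> - {#l#})" if "l \<in># \<mu>" for \<mu>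
  proof -
    have "l \<in> set (sorted_list_of_multiset \<mu>)"
      using that by simp
    from split_list_first[OF this] obtain ys zs
      where yz: "sorted_list_of_multiset \<mu> = ys @ l # zs" "l \<notin> set ys"
      by blast
    have "mset (ys @ zs) = \<mu> - {#l#}"
      using arg_cong[OF yz(1), of mset] by simp
    moreover have "sorted (ys @ zs)"
      using sorted_sorted_list_of_multiset[of \<mu>] unfolding yz by (auto simp: sorted_append)
    ultimately have rem: "sorted_list_of_multiset (\<mu> - {#l#}) = ys @ zs"
      using sorted_list_of_multiset_mset[of "ys @ zs"] by (simp add: sorted_sort_id)
    let ?A = "strict_rows J R ys" and ?B = "strict_rows (J - set ys) R zs"
    have minus: "insert l (J - set ys) - {l} = J - set ys" "J - set ys - {l} = J - set ys"
      using assms by auto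
    have 1: "S (insert l J) \<mu> = assign_sum ((R l)(l := 0) # ?A @ ?B) \<mu>"
      unfolding S_def yz strict_rows_append using yz(2) minus
      by (simp add: strict_rows_insert_notin insert_Diff_if assign_sum_move del: assign_sum.simps)
    have 2: "S J \<mu> = assign_sum (R l # ?A @ ?B) \<mu>"
      unfolding S_def yz strict_rows_append using assms(1) minus(2)
      by (simp add: assign_sum_move del: assign_sum.simps)
    have 3: "S J (\<mu> - {#l#}) = assign_sum (?A @ ?B) (\<mu> - {#l#})"
      unfolding S_def rem strict_rows_append ..
    have "assign_sum (R l # ?A @ ?B) \<mu> = assign_sum ((R l)(l := 0) # ?A @ ?B) \<mu> +
        assign_sum ((\<lambda>k. if k = l then R l l else 0) # ?A @ ?B) \<mu>"
      by (auto simp: sum.distrib[symmetric] intro!: sum.cong)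
    then show ?thesis
      unfolding 1 2 3 using assign_sum_delta[OF that] by simp
  qed
  have S_notin: "S (insert l J) \<mu> = S J \<mu>" if "l \<notin># \<mu>" for \<mu>
    unfolding S_def using that by (simp add: strict_rows_insert_notin)
  have "fps_nth (strict_fps (insert l J) R K) n = (\<Sum>\<mu>\<in>msets {..<K} n. S (insert l J) \<mu>)"
    by (simp add: strict_fps_def S_def)
  also have "\<dots> = (\<Sum>\<mu>\<in>msets {..<K} n. S J \<mu>) -
      (\<Sum>\<mu>\<in>msets {..<K} n. \<Sum>k\<in>set_mset \<mu> \<inter> {l}. R l l * S J (\<mu> - {#k#}))"
    unfolding sum_subtractf[symmetric] using S_in S_notin by (intro sum.cong) (simp_all add: Int_insert_right)
  also have "(\<Sum>\<mu>\<in>msets {..<K} n. \<Sum>k\<in>set_mset \<mu> \<inter> {l}. R l l * S J (\<mu> - {#k#})) =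
      fps_nth (fps_const (R l l) * fps_X * strict_fps J R K) n"
  proof (cases n)
    case (Suc m)
    show ?thesis
      unfolding Suc using assms(2)
      by (subst sum_msets_remove[where B = "{l}" and g = "\<lambda>k \<nu>. R l l * S J \<nu>"])
         (auto simp: strict_fps_def S_def sum_distrib_left mult.assoc)
  qed (auto simp: mult.assoc)
  finally show "fps_nth (strict_fps (insert l J) R K) n =
      fps_nth (strict_fps J R K * (1 - fps_const (R l l) * fps_X)) n"
    by (simp add: strict_fps_def S_def algebra_simps)
qed

text \<open>Imposing strictness on the barred letters one at a time multiplies the series by one
  linear factor each; together these factors form the numerator \<open>E' N\<close>.\<close>

lemma strict_fps_bar_row:
  fixes x :: "nat \<Rightarrow> 'r::comm_ring_1" and t :: 'r
  defines "E \<equiv> lin_prod x" and "E' \<equiv> lin_prod (\<lambda>i. t * x i)"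
  shows "strict_fps (Collect even) (bar_row x t) (2 * N) * (E N - fps_const t * E' N) = (1 - fps_const t) * E' N"
proof -
  have "strict_fps {l. even l \<and> l < 2 * M} (bar_row x t) (2 * N) = loop_fps (bar_row x t) (2 * N) * E' M"
    if "M \<le> N" for M
    using that
  proof (induction M)
    case 0
    then show ?case by (simp add: E'_def strict_fps_empty)
  next
    case (Suc M)
    have "{l. even l \<and> l < 2 * Suc M} = insert (2 * M) {l. even l \<and> l < 2 * M}"
      by (auto elim!: evenE)
    then show ?case
      using Suc by (simp add: strict_fps_insert E'_def lin_prod_Suc bar_row_def mult.assoc)
  qed
  moreover have "strict_fps (Collect even) (bar_row x t) (2 * N) = strict_fps {l. even l \<and> l < 2 * N} (bar_row x t) (2 * N)"
  proof -
    show ?thesis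
      unfolding strict_fps_def
      by (intro arg_cong[where f = Abs_fps] ext sum.cong refl arg_cong2[where f = assign_sum] strict_rows_cong)
         (auto simp: msets_def)
  qed
  ultimately have "strict_fps (Collect even) (bar_row x t) (2 * N) = loop_fps (bar_row x t) (2 * N) * E' N"
    by simp
  then have "strict_fps (Collect even) (bar_row x t) (2 * N) * (E N - fps_const t * E' N) =
      (loop_fps (bar_row x t) (2 * N) * (E N - fps_const t * E' N)) * E' N"
    by (simp only: mult_ac)
  then show ?thesis
    unfolding E_def E'_def loop_fps_bar_row .
qed

lemma strict_fps_nth:
  fixes R :: "nat \<Rightarrow> nat \<Rightarrow> 'r::comm_ring_1"
  shows "fps_nth (strict_fps J R K) n = (\<Sum>u | set u \<subseteq> {..<K} \<and> length u = n.
      \<Prod>k<n. (strict_rows J R (sort u) ! k) (u ! k))"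
proof -
  have "fps_nth (strict_fps J R K) n = (\<Sum>\<mu>\<in>msets {..<K} n.
      \<Sum>u | u \<in> {u. set u \<subseteq> {..<K} \<and> length u = n} \<and> mset u = \<mu>. \<Prod>k<n. (strict_rows J R (sort u) ! k) (u ! k))"
    unfolding strict_fps_def fps_nth_Abs_fps
  proof (intro sum.cong refl)
    fix \<mu> assume \<mu>: "\<mu> \<in> msets {..<K} n"
    then have len: "length (sorted_list_of_multiset \<mu>) = n"
      using size_mset[of "sorted_list_of_multiset \<mu>"] by (simp add: msets_def)
    show "assign_sum (strict_rows J R (sorted_list_of_multiset \<mu>)) \<mu> =
       (\<Sum>u | u \<in> {u. set u \<subseteq> {..<K} \<and> length u = n} \<and> mset u = \<mu>. \<Prod>k<n. (strict_rows J R (sort u) ! k) (u ! k))"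
    proof (subst assign_sum_words, unfold length_strict_rows len, rule sum.cong)
      show "{u. mset u = \<mu> \<and> length u = n} = {u. u \<in> {u. set u \<subseteq> {..<K} \<and> length u = n} \<and> mset u = \<mu>}"
      proof (intro Set.set_eqI iffI)
        fix u assume "u \<in> {u. mset u = \<mu> \<and> length u = n}"
        moreover from this have "set u = set_mset \<mu>"
          using set_mset_mset[of u] by simp
        ultimately show "u \<in> {u. u \<in> {u. set u \<subseteq> {..<K} \<and> length u = n} \<and> mset u = \<mu>}"
          using \<mu> by (simp add: msets_def)
      qed simp
    next
      fix u assume "u \<in> {u. u \<in> {u. set u \<subseteq> {..<K} \<and> length u = n} \<and> mset u = \<mu>}"
      then have "sorted_list_of_multiset \<mu> = sort u"
        using sorted_list_of_multiset_mset[of u] by simp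
      then show "(\<Prod>k<n. (strict_rows J R (sorted_list_of_multiset \<mu>) ! k) (u ! k)) =
          (\<Prod>k<n. (strict_rows J R (sort u) ! k) (u ! k))"
        by simp
    qed
  qed
  also have "\<dots> = (\<Sum>u | set u \<subseteq> {..<K} \<and> length u = n. \<Prod>k<n. (strict_rows J R (sort u) ! k) (u ! k))"
    by (rule sum.group) (auto simp: finite_lists_length_eq finite_msets, auto simp: msets_def)
  finally show ?thesis .
qed

section \<open>Words and permutations\<close>

text \<open>If \<open>xs\<close> is \<open>u\<close> sorted, then \<open>\<pi>\<close> is the
  inverse of the standardization of \<open>u\<close>: it sends a place of the sorted word to the
  place in \<open>u\<close> from which stable sorting takes the entry.\<close>

definition stable_perm :: "'a list \<Rightarrow> 'a list \<Rightarrow> (nat \<Rightarrow> nat) \<Rightarrow> bool" where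
  "stable_perm u xs \<pi> \<longleftrightarrow> \<pi> permutes {..<length u} \<and> (\<forall>i<length u. xs ! i = u ! \<pi> i) \<and>
     (\<forall>i j. i < j \<and> j < length u \<and> xs ! i = xs ! j \<longrightarrow> \<pi> i < \<pi> j)"

lemma stable_perm_exists:
  fixes u :: "nat list"
  shows "\<exists>\<pi>. stable_perm u (sort u) \<pi>"
proof -
  define n where "n = length u"
  \<comment> \<open>As \<open>k < n\<close>, this key compares letters first and places second, so
    sorting by it is stable.\<close>
  define f where "f k = u ! k * n + k" for k
  define ks where "ks = sort_key f [0..<n]"
  define \<pi> where "\<pi> i = (if i < n then ks ! i else i)" for i
  have ks: "length ks = n" "distinct ks" "set ks = {..<n}"
    by (auto simp: ks_def)
  have f_mono: "f (ks ! i) \<le> f (ks ! j)" if "i \<le> j" "j < n" for i j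
    using sorted_nth_mono[of "map f ks" i j] that ks(1) by (simp add: ks_def)
  have ks_lt: "ks ! i < n" if "i < n" for i
    using ks that nth_mem[of i ks] by auto
  have u_mono: "u ! (ks ! i) \<le> u ! (ks ! j)" if "i \<le> j" "j < n" for i j
  proof (rule ccontr)
    assume "\<not> u ! (ks ! i) \<le> u ! (ks ! j)"
    then have "Suc (u ! (ks ! j)) * n \<le> u ! (ks ! i) * n"
      by (intro mult_le_mono1) simp
    then show False
      using f_mono[OF that] ks_lt[OF that(2)] by (simp add: f_def)
  qed
  have "sort u = map (\<lambda>k. u ! k) ks"
  proof (rule properties_for_sort)
    have "mset (map ((!) u) ks) = mset (map ((!) u) [0..<n])"
      by (simp add: ks_def)
    then show "mset (map ((!) u) ks) = mset u"
      by (simp add: n_def map_nth)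
    show "sorted (map ((!) u) ks)"
      using u_mono by (auto simp: sorted_iff_nth_mono ks)
  qed
  moreover have "\<pi> permutes {..<n}"
  proof (rule bij_imp_permutes)
    have "bij_betw ((!) ks) {..<n} {..<n}"
      using ks by (intro bij_betw_nth) auto
    then show "bij_betw \<pi> {..<n} {..<n}"
      by (rule bij_betw_cong[THEN iffD1, rotated]) (simp add: \<pi>_def)
  qed (simp add: \<pi>_def)
  moreover have "\<pi> i < \<pi> j" if "i < j \<and> j < n \<and> sort u ! i = sort u ! j" for i j
  proof -
    have ij: "i < j" "i < n" "j < n"
      using that by auto
    then have "ks ! i \<noteq> ks ! j"
      using ks by (simp add: nth_eq_iff_index_eq)
    moreover have "u ! (ks ! i) = u ! (ks ! j)"
      using that ij ks unfolding \<open>sort u = map ((!) u) ks\<close> by simp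
    ultimately show ?thesis
      using f_mono[of i j] ij by (simp add: f_def \<pi>_def)
  qed
  moreover have "sort u ! i = u ! \<pi> i" if "i < n" for i
    unfolding \<open>sort u = map ((!) u) ks\<close> using that by (simp add: \<pi>_def ks)
  ultimately show ?thesis
    unfolding stable_perm_def n_def[symmetric] by blast
qed

text \<open>The place \<open>\<pi> i\<close> equals \<open>\<rho> j\<close> for some
  \<open>j\<close>. This \<open>j\<close> is not below \<open>i\<close>, where both permutations
  agree, and stability of \<open>\<rho>\<close> gives the bound.\<close>

lemma stable_perm_le:
  assumes "stable_perm u xs \<pi>" "stable_perm u xs \<rho>" "i < length u" "\<And>j. j < i \<Longrightarrow> \<pi> j = \<rho> j"
  shows "\<rho> i \<le> \<pi> i"
proof -
  obtain j where j: "j < length u" "\<rho> j = \<pi> i"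
    using assms(1-3) permutes_in_image[of \<pi> "{..<length u}" i] permutes_image[of \<rho> "{..<length u}"]
    unfolding stable_perm_def by (metis imageE lessThan_iff)
  then have "xs ! j = xs ! i"
    using assms(1-3) unfolding stable_perm_def by auto
  moreover have "\<not> j < i"
    using assms(1,4) j by (metis less_irrefl permutes_inj injD stable_perm_def)
  ultimately show ?thesis
    using assms(2,3) j unfolding stable_perm_def by (metis less_or_eq_imp_le linorder_neqE_nat)
qed

lemma stable_perm_unique:
  assumes "stable_perm u xs \<pi>" "stable_perm u xs \<rho>"
  shows "\<pi> = \<rho>"
proof
  fix i
  show "\<pi> i = \<rho> i"
  proof (induction i rule: less_induct)
    case (less i)
    show ?case
    proof (cases "i < length u")
      case True
      then show ?thesis
        using stable_perm_le[OF assms True] stable_perm_le[OF assms(2,1) True] less by fastforce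
    next
      case False
      then show ?thesis
        using assms by (simp add: stable_perm_def permutes_def)
    qed
  qed
qed

text \<open>
  The label \<open>c\<close> stands for the value \<open>N - (c + 1) div 2\<close> (where \<open>K = 2 * N\<close>), barred if \<open>c\<close> is even. So
  sorted labels encode weakly decreasing values, with the unbarred letters first among equal
  values; labels compatible with \<open>\<pi>\<close> drop strictly at its descents and are barred at its excedances.
\<close>

definition exc_labels :: "nat \<Rightarrow> nat \<Rightarrow> (nat \<Rightarrow> nat) \<Rightarrow> nat list set" where
  "exc_labels n K \<pi> = {xs. length xs = n \<and> set xs \<subseteq> {..<K} \<and> sorted xs \<and>
     (\<forall>i<n. even (xs ! i) \<longleftrightarrow> i < \<pi> i) \<and>
     (\<forall>i. Suc i < n \<and> \<pi> (Suc i) < \<pi> i \<longrightarrow> Suc (xs ! i) div 2 \<noteq> Suc (xs ! Suc i) div 2)}"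

text \<open>The condition that no factor in the product of the rows
  \<open>strict_rows (Collect even) (bar_row x t) (sort u)\<close> is forced to vanish. The clause
  about \<open>take\<close> says that \<open>k\<close> is not the first place of its letter in the
  sorted word.\<close>

definition valid_word :: "nat list \<Rightarrow> bool" where
  "valid_word u \<longleftrightarrow> (\<forall>k<length u. if even (u ! k)
     then u ! k \<le> sort u ! k \<and> (sort u ! k = u ! k \<longrightarrow> u ! k \<in> set (take k (sort u)))
     else sort u ! k \<le> u ! k)"

text \<open>Equal labels have equal values, and a descent of \<open>\<pi>\<close> forces the value
  to drop; so \<open>\<pi>\<close> has no descent inside a run of equal labels.\<close>

lemma exc_labels_stable:
  assumes "xs \<in> exc_labels n K \<pi>" "i < j" "j < n" "xs ! i = xs ! j" and inj: "inj \<pi>"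
  shows "\<pi> i < \<pi> j"
  using assms(2-4)
proof (induction j)
  case (Suc j)
  have xs: "sorted xs" "length xs = n"
    using assms(1) by (auto simp: exc_labels_def)
  have "xs ! i \<le> xs ! j" "xs ! j \<le> xs ! Suc j"
    using Suc.prems xs sorted_nth_mono[of xs i j] sorted_nth_mono[of xs j "Suc j"] by simp_all
  then have eq: "xs ! j = xs ! Suc j" "xs ! i = xs ! j"
    using Suc.prems by auto
  then have "\<not> \<pi> (Suc j) < \<pi> j"
    using assms(1) Suc.prems(2) by (auto simp: exc_labels_def)
  moreover have "\<pi> (Suc j) \<noteq> \<pi> j"
    using injD[OF inj, of "Suc j" j] by auto
  ultimately have less: "\<pi> j < \<pi> (Suc j)" by simp
  show ?case
  proof (cases "i = j")
    case False
    then have "\<pi> i < \<pi> j"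
      using Suc.IH Suc.prems(1,2) eq(2) by simp
    then show ?thesis using less by simp
  qed (use less in simp)
qed simp

text \<open>On a run of equal letters \<open>\<pi>\<close> increases strictly, so
  \<open>\<pi> i - i\<close> increases weakly there. Whether the whole run consists of excedances,
  or of none, can thus be tested at one of its ends.\<close>

lemma stable_perm_gap:
  assumes "stable_perm u xs \<pi>" "sorted xs" "length xs = length u" "a \<le> b" "b < length u" "xs ! a = xs ! b"
  shows "\<pi> a + (b - a) \<le> \<pi> b"
  using assms(4-6)
proof (induction b rule: dec_induct)
  case (step c)
  have "xs ! a \<le> xs ! c" "xs ! c \<le> xs ! Suc c"
    using step assms(2,3) sorted_nth_mono[of xs a c] sorted_nth_mono[of xs c "Suc c"] by simp_all
  then have eq: "xs ! a = xs ! c" "xs ! c = xs ! Suc c"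
    using step.prems by auto
  then have "\<pi> c < \<pi> (Suc c)"
    using assms(1) step.prems(1) unfolding stable_perm_def by simp
  moreover have "\<pi> a + (c - a) \<le> \<pi> c"
    using step.IH step.prems(1) eq(1) by simp
  ultimately show ?case
    using step.hyps by simp
qed simp

text \<open>By \<open>stable_perm_gap\<close> it suffices to look at the first place of the run of
  an even letter and at the last place of the run of an odd letter.\<close>

lemma valid_word_exc:
  assumes st: "stable_perm u (sort u) \<pi>" and v: "valid_word u" and i: "i < length u"
  shows "even (sort u ! i) \<longleftrightarrow> i < \<pi> i"
proof -
  define xs where "xs = sort u"
  define n where "n = length u"
  have xs: "sorted xs" "length xs = n"
    by (auto simp: xs_def n_def)
  have lt: "\<pi> j < n" if "j < n" for j
    using st that permutes_in_image[of \<pi> "{..<n}" j] unfolding stable_perm_def n_def by auto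
  have u\<pi>: "u ! \<pi> j = xs ! j" if "j < n" for j
    using st that by (simp add: stable_perm_def xs_def n_def)
  have i': "i < n"
    using i by (simp add: n_def)
  show ?thesis
  proof (cases "even (xs ! i)")
    case True
    define a where "a = (LEAST j. xs ! j = xs ! i)"
    have a: "xs ! a = xs ! i" "a \<le> i"
      unfolding a_def by (rule LeastI, rule refl) (rule Least_le, rule refl)
    have less_a: "xs ! j \<noteq> xs ! a" if "j < a" for j
      using not_less_Least[of j "\<lambda>j. xs ! j = xs ! i"] that unfolding a_def[symmetric] a(1) by simp
    have "a < n" using a i' by simp
    have "xs ! a \<le> xs ! \<pi> a" and strict: "xs ! \<pi> a = xs ! a \<longrightarrow> xs ! a \<in> set (take (\<pi> a) xs)"
      using v lt[OF \<open>a < n\<close>] True unfolding valid_word_def xs_def[symmetric] n_def[symmetric]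
      by (auto simp: u\<pi>[OF \<open>a < n\<close>] a(1) dest!: spec[of _ "\<pi> a"])
    \<comment> \<open>Otherwise sortedness makes the letters at \<open>\<pi> a\<close> and
      \<open>a\<close> equal, and validity asks for an earlier occurrence, against the choice of
      \<open>a\<close>. This is where a barred fixed point is ruled out.\<close>
    have "a < \<pi> a"
    proof (rule ccontr)
      assume "\<not> a < \<pi> a"
      then have "xs ! \<pi> a \<le> xs ! a"
        using xs \<open>a < n\<close> by (intro sorted_nth_mono) auto
      then have "xs ! \<pi> a = xs ! a"
        using \<open>xs ! a \<le> xs ! \<pi> a\<close> by simp
      then have "xs ! a \<in> set (take (\<pi> a) xs)"
        using strict by simp
      then obtain j where "j < \<pi> a" "xs ! j = xs ! a"
        by (auto simp: in_set_conv_nth)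
      then show False
        using less_a[of j] \<open>\<not> a < \<pi> a\<close> by simp
    qed
    moreover have "\<pi> a + (i - a) \<le> \<pi> i"
      using stable_perm_gap[of u xs \<pi> a i] st xs a i' by (simp add: xs_def n_def)
    ultimately show ?thesis
      using True a by (simp add: xs_def)
  next
    case False
    define Z where "Z = {j. j < n \<and> xs ! j = xs ! i}"
    define z where "z = Max Z"
    have "finite Z" "i \<in> Z"
      using i' by (auto simp: Z_def)
    then have "z \<in> Z" "i \<le> z"
      unfolding z_def by (auto intro: Max_in)
    then have z: "z < n" "xs ! z = xs ! i"
      by (auto simp: Z_def)
    have "xs ! \<pi> z \<le> xs ! z"
      using v lt[OF z(1)] False unfolding valid_word_def xs_def[symmetric] n_def[symmetric]
      by (auto simp: u\<pi>[OF z(1)] z(2) dest!: spec[of _ "\<pi> z"])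
    have "\<pi> z \<le> z"
    proof (rule ccontr)
      assume "\<not> \<pi> z \<le> z"
      then have "xs ! z \<le> xs ! \<pi> z"
        using xs lt[OF z(1)] by (intro sorted_nth_mono) auto
      then have "\<pi> z \<in> Z"
        using \<open>xs ! \<pi> z \<le> xs ! z\<close> z lt[OF z(1)] by (simp add: Z_def)
      then show False
        using Max_ge[OF \<open>finite Z\<close>, of "\<pi> z"] \<open>\<not> \<pi> z \<le> z\<close> by (simp add: z_def)
    qed
    moreover have "\<pi> i + (z - i) \<le> \<pi> z"
      using stable_perm_gap[of u xs \<pi> i z] st xs z \<open>i \<le> z\<close> by (simp add: xs_def n_def)
    ultimately show ?thesis
      using False \<open>i \<le> z\<close> by (simp add: xs_def)
  qed
qed

lemma valid_word_iff_exc_labels: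
  assumes st: "stable_perm u (sort u) \<pi>" and K: "set u \<subseteq> {..<K}"
  shows "valid_word u \<longleftrightarrow> sort u \<in> exc_labels (length u) K \<pi>"
proof -
  define xs where "xs = sort u"
  define n where "n = length u"
  have xs: "sorted xs" "length xs = n" "set xs \<subseteq> {..<K}"
    using K by (auto simp: xs_def n_def)
  have perm: "\<pi> permutes {..<n}"
    using st by (simp add: stable_perm_def n_def)
  show ?thesis
  proof
    assume v: "valid_word u"
    have exc: "even (xs ! i) \<longleftrightarrow> i < \<pi> i" if "i < n" for i
      using valid_word_exc[OF st v] that by (simp add: xs_def n_def)
    have "Suc (xs ! i) div 2 \<noteq> Suc (xs ! Suc i) div 2" if "Suc i < n" "\<pi> (Suc i) < \<pi> i" for i
    proof
      assume eq: "Suc (xs ! i) div 2 = Suc (xs ! Suc i) div 2"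
      have le: "xs ! i \<le> xs ! Suc i"
        using that xs by (auto intro!: sorted_nth_mono)
      show False
      proof (cases "xs ! i = xs ! Suc i")
        case True
        then have "\<pi> i < \<pi> (Suc i)"
          using st that(1) unfolding stable_perm_def xs_def n_def by simp
        then show False
          using that(2) by simp
      next
        case False
        \<comment> \<open>Different labels of equal value are an unbarred one followed by a barred
          one: a non-excedance followed by an excedance, which cannot be a descent.\<close>
        then have "odd (xs ! i)" "even (xs ! Suc i)"
          using eq le by presburger+
        then show False
          using exc[of i] exc[of "Suc i"] that by simp
      qed
    qed
    then show "sort u \<in> exc_labels (length u) K \<pi>"
      using xs exc unfolding exc_labels_def xs_def[symmetric] n_def[symmetric] by blast
  next
    assume L: "sort u \<in> exc_labels (length u) K \<pi>"
    show "valid_word u"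
      unfolding valid_word_def xs_def[symmetric] n_def[symmetric]
    proof (intro allI impI)
      fix k assume k: "k < n"
      define i where "i = inv_into UNIV \<pi> k"
      have i: "\<pi> i = k" "i < n"
        using perm k permutes_in_image[OF permutes_inv[OF perm], of k]
        by (auto simp: i_def permutes_inverses)
      have u: "u ! k = xs ! i"
        using st i unfolding stable_perm_def xs_def n_def by simp
      have exc: "even (xs ! i) \<longleftrightarrow> i < k"
        using L i unfolding exc_labels_def xs_def n_def by simp
      show "if even (u ! k) then u ! k \<le> xs ! k \<and> (xs ! k = u ! k \<longrightarrow> u ! k \<in> set (take k xs))
          else xs ! k \<le> u ! k"
      proof (cases "even (xs ! i)")
        case True
        then have "i < k" using exc by simp
        then have "xs ! i \<le> xs ! k" "xs ! i \<in> set (take k xs)"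
          using xs k by (auto intro!: sorted_nth_mono simp: in_set_conv_nth)
        then show ?thesis using True u by simp
      next
        case False
        then have "xs ! k \<le> xs ! i"
          using exc xs i(2) by (intro sorted_nth_mono) auto
        then show ?thesis using False u by simp
      qed
    qed
  qed
qed

text \<open>A word can be rebuilt from its sorted form and its stable permutation, and the latter is
  unique; so \<open>u\<close> corresponds bijectively to the pair of \<open>\<pi>\<close> and
  \<open>sort u\<close>.\<close>

lemma sum_valid_words:
  fixes g :: "nat list \<Rightarrow> 'r::comm_monoid_add"
  shows "(\<Sum>u | set u \<subseteq> {..<K} \<and> length u = n \<and> valid_word u. g (sort u)) =
    (\<Sum>\<pi> | \<pi> permutes {..<n}. \<Sum>xs\<in>exc_labels n K \<pi>. g xs)"
proof -
  define sp where "sp u = (SOME \<pi>. stable_perm u (sort u) \<pi>)" for u :: "nat list"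
  have sp: "stable_perm u (sort u) (sp u)" for u
    unfolding sp_def using stable_perm_exists by (rule someI_ex)
  define w where "w \<pi> xs = map (\<lambda>k. xs ! inv_into UNIV \<pi> k) [0..<n]" for \<pi> :: "nat \<Rightarrow> nat" and xs :: "nat list"
  have w: "stable_perm (w \<pi> xs) (sort (w \<pi> xs)) \<pi> \<and> sort (w \<pi> xs) = xs \<and> set (w \<pi> xs) \<subseteq> {..<K} \<and>
      length (w \<pi> xs) = n" if "\<pi> permutes {..<n}" "xs \<in> exc_labels n K \<pi>" for \<pi> xs
  proof -
    have xs: "length xs = n" "sorted xs" "set xs \<subseteq> {..<K}"
      using that(2) by (auto simp: exc_labels_def)
    have w_perm: "w \<pi> xs = permute_list (inv_into UNIV \<pi>) xs"
      by (simp add: w_def permute_list_def xs)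
    have perm: "inv_into UNIV \<pi> permutes {..<length xs}"
      using that(1) xs by (simp add: permutes_inv)
    have "mset (w \<pi> xs) = mset xs"
      unfolding w_perm by (rule mset_permute_list[OF perm])
    then have srt: "sort (w \<pi> xs) = xs"
      using xs by (metis properties_for_sort)
    have nth: "w \<pi> xs ! \<pi> i = xs ! i" if "i < n" for i
      using \<open>\<pi> permutes {..<n}\<close> that permutes_in_image[of \<pi> "{..<n}" i]
      by (simp add: w_def permutes_inverses)
    have "stable_perm (w \<pi> xs) xs \<pi>"
      unfolding stable_perm_def
      using that(1) nth exc_labels_stable[OF that(2) _ _ _ permutes_inj[OF that(1)]]
      by (simp add: w_def)
    moreover have "set (w \<pi> xs) \<subseteq> {..<K}"
      using set_permute_list[OF perm] xs(3) w_perm by simp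
    ultimately show ?thesis
      using srt by (simp add: w_def)
  qed
  have w_sp: "w (sp u) (sort u) = u" if "length u = n" for u
  proof (rule nth_equalityI)
    fix k assume "k < length (w (sp u) (sort u))"
    then have k: "k < n" by (simp add: w_def)
    have p: "sp u permutes {..<n}"
      using sp[of u] that by (simp add: stable_perm_def)
    then have "inv_into UNIV (sp u) k < n" "sp u (inv_into UNIV (sp u) k) = k"
      using k permutes_in_image[OF permutes_inv[OF p], of k] by (auto simp: permutes_inverses)
    then have "sort u ! inv_into UNIV (sp u) k = u ! k"
      using sp[of u] that by (simp add: stable_perm_def)
    then show "w (sp u) (sort u) ! k = u ! k"
      using k by (simp add: w_def)
  qed (simp add: w_def that)
  have fin: "finite (exc_labels n K \<pi>)" for \<pi>
    by (rule finite_subset[OF _ finite_lists_length_eq[of "{..<K}" n]]) (auto simp: exc_labels_def)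
  have "(\<Sum>\<pi> | \<pi> permutes {..<n}. \<Sum>xs\<in>exc_labels n K \<pi>. g xs) =
      (\<Sum>(\<pi>, xs)\<in>(SIGMA \<pi>:{\<pi>. \<pi> permutes {..<n}}. exc_labels n K \<pi>). g xs)"
    by (rule sum.Sigma) (auto simp: finite_permutations fin)
  also have "\<dots> = (\<Sum>u | set u \<subseteq> {..<K} \<and> length u = n \<and> valid_word u. g (sort u))"
  proof (rule sum.reindex_bij_witness[of _ "\<lambda>u. (sp u, sort u)" "\<lambda>(\<pi>, xs). w \<pi> xs"])
    fix a assume "a \<in> (SIGMA \<pi>:{\<pi>. \<pi> permutes {..<n}}. exc_labels n K \<pi>)"
    then obtain \<pi> xs where a: "a = (\<pi>, xs)" "\<pi> permutes {..<n}" "xs \<in> exc_labels n K \<pi>"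
      by auto
    note w = w[OF a(2,3)]
    have "sp (w \<pi> xs) = \<pi>"
      using sp w stable_perm_unique by blast
    have "valid_word (w \<pi> xs)"
      using valid_word_iff_exc_labels[OF w[THEN conjunct1], of K] w a(3) by metis
    then show "(case a of (\<pi>, xs) \<Rightarrow> w \<pi> xs) \<in> {u. set u \<subseteq> {..<K} \<and> length u = n \<and> valid_word u}"
      and "(sp (case a of (\<pi>, xs) \<Rightarrow> w \<pi> xs), sort (case a of (\<pi>, xs) \<Rightarrow> w \<pi> xs)) = a"
      and "g (sort (case a of (\<pi>, xs) \<Rightarrow> w \<pi> xs)) = (case a of (\<pi>, xs) \<Rightarrow> g xs)"
      using w a \<open>valid_word (w \<pi> xs)\<close> \<open>sp (w \<pi> xs) = \<pi>\<close> by simp_all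
  next
    fix u assume "u \<in> {u. set u \<subseteq> {..<K} \<and> length u = n \<and> valid_word u}"
    then show "(case (sp u, sort u) of (\<pi>, xs) \<Rightarrow> w \<pi> xs) = u"
      and "(sp u, sort u) \<in> (SIGMA \<pi>:{\<pi>. \<pi> permutes {..<n}}. exc_labels n K \<pi>)"
      using w_sp[of u] valid_word_iff_exc_labels[OF sp, of u K] sp[of u]
      by (simp_all add: stable_perm_def)
  qed
  finally show ?thesis ..
qed

text \<open>Only valid words contribute, and their weight is a product over letters, hence depends
  on the sorted word alone.\<close>

lemma strict_fps_bar_row_nth:
  fixes x :: "nat \<Rightarrow> 'r::comm_ring_1" and t :: 'r
  shows "fps_nth (strict_fps (Collect even) (bar_row x t) K) n =
    (\<Sum>\<pi> | \<pi> permutes {..<n}. \<Sum>xs\<in>exc_labels n K \<pi>.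
       \<Prod>k<n. if even (xs ! k) then t * x (xs ! k div 2) else x (xs ! k div 2))"
proof -
  define wt where "wt c = (if even c then t * x (c div 2) else x (c div 2))" for c :: nat
  let ?r = "\<lambda>u. strict_rows (Collect even) (bar_row x t) (sort u)"
  have entry: "(?r u ! k) (u ! k) = (if (if even (u ! k)
     then u ! k \<le> sort u ! k \<and> (sort u ! k = u ! k \<longrightarrow> u ! k \<in> set (take k (sort u)))
     else sort u ! k \<le> u ! k) then wt (u ! k) else 0)" if "k < length u" for u k
    using that by (auto simp: nth_strict_rows bar_row_def wt_def)
  have 1: "(\<Prod>k<n. (?r u ! k) (u ! k)) = (if valid_word u then \<Prod>k<n. wt (sort u ! k) else 0)"
    if "length u = n" for u
  proof (cases "valid_word u")
    case True
    have "(\<Prod>k<n. (?r u ! k) (u ! k)) = (\<Prod>k<n. wt (u ! k))"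
    proof (rule prod.cong)
      fix k assume "k \<in> {..<n}"
      then show "(?r u ! k) (u ! k) = wt (u ! k)"
        using True that unfolding valid_word_def by (subst entry) simp_all
    qed simp
    also have "\<dots> = prod_mset (image_mset wt (mset u))"
      using that by (simp add: prod_mset_prod_list prod.list_conv_set_nth atLeast0LessThan flip: mset_map)
    also have "mset u = mset (sort u)" by simp
    also have "prod_mset (image_mset wt (mset (sort u))) = (\<Prod>k<n. wt (sort u ! k))"
      using that by (simp add: prod_mset_prod_list prod.list_conv_set_nth atLeast0LessThan del: mset_sort flip: mset_map)
    finally show ?thesis using True by simp
  next
    case False
    then obtain k where k: "k < length u" "\<not> (if even (u ! k)
     then u ! k \<le> sort u ! k \<and> (sort u ! k = u ! k \<longrightarrow> u ! k \<in> set (take k (sort u)))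
     else sort u ! k \<le> u ! k)"
      unfolding valid_word_def by blast
    then have "(?r u ! k) (u ! k) = 0"
      by (simp only: entry if_False)
    then show ?thesis
      using k(1) that False by (auto intro!: prod_zero)
  qed
  have "fps_nth (strict_fps (Collect even) (bar_row x t) K) n =
      (\<Sum>u | set u \<subseteq> {..<K} \<and> length u = n. if valid_word u then \<Prod>k<n. wt (sort u ! k) else 0)"
    unfolding strict_fps_nth using 1 by (intro sum.cong) auto
  also have "\<dots> = (\<Sum>u | set u \<subseteq> {..<K} \<and> length u = n \<and> valid_word u. \<Prod>k<n. wt (sort u ! k))"
    by (subst sum.inter_filter[symmetric]) (auto simp: finite_lists_length_eq conj_assoc intro!: sum.cong)
  also note sum_valid_words
  finally show ?thesis
    by (simp add: wt_def)
qed

section \<open>The limit of an infinite alphabet\<close>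

lemma sum_tails:
  fixes d :: "nat \<Rightarrow> nat"
  shows "(\<Sum>k<n. \<Sum>j\<in>{k..<n}. d j) = (\<Sum>j<n. Suc j * d j)"
proof (induction n)
  case (Suc n)
  have "(\<Sum>k<n. \<Sum>j\<in>{k..<Suc n}. d j) = (\<Sum>k<n. (\<Sum>j\<in>{k..<n}. d j) + d n)"
    by (intro sum.cong) auto
  then show ?case
    using Suc by (simp add: sum.distrib)
qed simp

text \<open>A telescoping sum of truncated differences. The induction shortens the interval at its
  right end and carries \<open>b k \<le> b (n - i - 1)\<close> along, which keeps the subtractions
  exact.\<close>

lemma increments_tail:
  fixes b :: "nat \<Rightarrow> nat"
  assumes mono: "\<And>k. Suc k < n \<Longrightarrow> b k \<le> b (Suc k)" and le: "\<And>k. k < n \<Longrightarrow> b k \<le> N" and "k < n"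
  shows "(\<Sum>j\<in>{k..<n}. (if Suc j < n then b (Suc j) else N) - b j) = N - b k"
proof -
  have "k \<le> n - 1" "n > 0" using assms(3) by auto
  have "(\<Sum>j\<in>{k..<n - i}. (if Suc j < n then b (Suc j) else N) - b j) =
      (if n - i < n then b (n - i) else N) - b k \<and> b k \<le> b (n - i - 1)"
    if "k < n - i" for i
    using that
  proof (induction "n - i - Suc k" arbitrary: i)
    case 0
    then have "n - i = Suc k" by simp
    then show ?case by simp
  next
    case (Suc m)
    then have "k < n - Suc i" "m = n - Suc i - Suc k" by auto
    note IH = Suc.hyps(1)[OF this(2,1)]
    define a where "a = n - Suc i"
    have a: "n - i = Suc a" "k < a" "a < n"
      using Suc \<open>k < n - Suc i\<close> by (auto simp: a_def)
    have "b (a - 1) \<le> b a"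
      using mono[of "a - 1"] a by simp
    moreover have "b a \<le> (if Suc a < n then b (Suc a) else N)"
      using mono[of a] le[of a] a by simp
    ultimately show ?case
      using IH a by (simp add: a_def[symmetric])
  qed
  from this[of 0] show ?thesis
    using assms(3) by simp
qed

section \<open>Compatible labels of a fixed permutation\<close>

locale label_limit =
  fixes n :: nat and \<pi> :: "nat \<Rightarrow> nat"
  assumes perm: "\<pi> permutes {..<n}"
begin

definition desc :: "nat set" where
  "desc = {k. Suc k < n \<and> \<pi> (Suc k) < \<pi> k}"

text \<open>
  A compatible sequence of values is determined by its successive differences. Sequences bounded by
  \<open>N\<close> have differences in \<open>box N\<close>, and all differences in \<open>box M\<close> occur once \<open>N > n * M\<close>; the
  limit of the sum over compatible sequences is thus that of the product over \<open>box M\<close>.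
\<close>

definition box :: "nat \<Rightarrow> (nat \<Rightarrow> nat) set" where
  "box M = PiE {..<n} (\<lambda>k. {(if k \<in> desc then 1 else 0)..M})"

text \<open>With values \<open>N - Suc (xs ! k) div 2\<close>, the entries are the drops between
  neighbouring values, and the last entry is the last value itself.\<close>

definition incr :: "nat \<Rightarrow> nat list \<Rightarrow> nat \<Rightarrow> nat" where
  "incr N xs = (\<lambda>k\<in>{..<n}. (if Suc k < n then Suc (xs ! Suc k) div 2 else N) - Suc (xs ! k) div 2)"

definition labels :: "nat \<Rightarrow> (nat \<Rightarrow> nat) \<Rightarrow> nat list" where
  "labels N d = map (\<lambda>k. let b = N - (\<Sum>j\<in>{k..<n}. d j) in if k < \<pi> k then 2 * b else 2 * b - 1) [0..<n]"

lemma \<pi>_less: "k < n \<Longrightarrow> \<pi> k < n"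
  using permutes_in_image[OF perm, of k] by simp

lemma exc_labels_tail:
  assumes "xs \<in> exc_labels n (2 * N) \<pi>" "k < n"
  shows "(\<Sum>j\<in>{k..<n}. incr N xs j) = N - Suc (xs ! k) div 2" "Suc (xs ! k) div 2 \<le> N"
proof -
  have xs: "length xs = n" "sorted xs" "set xs \<subseteq> {..<2 * N}"
    using assms by (auto simp: exc_labels_def)
  have le: "Suc (xs ! k) div 2 \<le> N" if "k < n" for k
  proof -
    have "xs ! k \<in> {..<2 * N}"
      using nth_mem[of k xs] that xs by blast
    then show ?thesis by simp
  qed
  then show "Suc (xs ! k) div 2 \<le> N"
    using assms(2) .
  have "Suc (xs ! k) div 2 \<le> Suc (xs ! Suc k) div 2" if "Suc k < n" for k
    using that xs sorted_nth_mono[of xs k "Suc k"] by (simp add: div_le_mono)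
  note tail = increments_tail[where b = "\<lambda>k. Suc (xs ! k) div 2", OF this le assms(2)]
  have "(\<Sum>j\<in>{k..<n}. incr N xs j) =
      (\<Sum>j\<in>{k..<n}. (if Suc j < n then Suc (xs ! Suc j) div 2 else N) - Suc (xs ! j) div 2)"
    by (rule sum.cong) (simp_all add: incr_def)
  then show "(\<Sum>j\<in>{k..<n}. incr N xs j) = N - Suc (xs ! k) div 2"
    using tail by simp
qed

lemma labels_incr:
  assumes "xs \<in> exc_labels n (2 * N) \<pi>"
  shows "labels N (incr N xs) = xs"
proof (rule nth_equalityI)
  show "length (labels N (incr N xs)) = length xs"
    using assms by (simp add: labels_def exc_labels_def)
  fix k assume "k < length (labels N (incr N xs))"
  then have k: "k < n" by (simp add: labels_def)
  have "even (xs ! k) \<longleftrightarrow> k < \<pi> k"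
    using assms k by (simp add: exc_labels_def)
  moreover have "N - (\<Sum>j\<in>{k..<n}. incr N xs j) = Suc (xs ! k) div 2"
    using exc_labels_tail[OF assms k] by simp
  ultimately show "labels N (incr N xs) ! k = xs ! k"
    using k by (auto simp: labels_def elim!: evenE oddE)
qed

lemma incr_in_box:
  assumes "xs \<in> exc_labels n (2 * N) \<pi>"
  shows "incr N xs \<in> box N"
  unfolding box_def
proof (rule PiE_I)
  fix k assume "k \<in> {..<n}"
  then have k: "k < n" by simp
  show "incr N xs k \<in> {(if k \<in> desc then 1 else 0)..N}"
  proof (cases "Suc k < n")
    case True
    have "Suc (xs ! k) div 2 \<le> Suc (xs ! Suc k) div 2"
      using assms True sorted_nth_mono[of xs k "Suc k"] by (simp add: div_le_mono exc_labels_def)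
    moreover have "k \<in> desc \<longrightarrow> Suc (xs ! k) div 2 \<noteq> Suc (xs ! Suc k) div 2"
      using assms by (simp add: exc_labels_def desc_def)
    ultimately show ?thesis
      using exc_labels_tail(2)[OF assms True] True k by (auto simp: incr_def)
  next
    case False
    then show ?thesis
      using k by (auto simp: incr_def desc_def)
  qed
qed (simp add: incr_def)

lemma tail_bounds:
  assumes "d \<in> box M" "k < n"
  shows "(\<Sum>j\<in>{k..<n}. d j) \<le> n * M"
proof -
  have "(\<Sum>j\<in>{k..<n}. d j) \<le> (\<Sum>j\<in>{k..<n}. M)"
    using assms by (intro sum_mono) (auto simp: box_def PiE_iff)
  also have "\<dots> \<le> n * M"
    by simp
  finally show ?thesis .
qed

text \<open>Without a drop from \<open>k\<close> on there is no descent from \<open>k\<close> on, so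
  the excedance at \<open>k\<close> propagates to the last place, which cannot be one. Hence barred
  values are positive, and their labels stay below \<open>2 * N\<close>.\<close>

lemma tail_pos:
  assumes "d \<in> box M" "k < n" "k < \<pi> k"
  shows "(\<Sum>j\<in>{k..<n}. d j) > 0"
proof (rule ccontr)
  assume "\<not> ?thesis"
  then have zero: "d j = 0" if "k \<le> j" "j < n" for j
    using that by auto
  have "j < \<pi> j" if "k \<le> j" "j < n" for j
    using that
  proof (induction j rule: dec_induct)
    case (step j)
    have "d j = 0"
      using zero step by simp
    then have "j \<notin> desc"
      using assms(1) step.prems by (auto simp: box_def PiE_iff dest!: bspec[of _ _ j])
    then have "\<not> \<pi> (Suc j) < \<pi> j"
      using step.prems by (simp add: desc_def)
    moreover have "\<pi> (Suc j) \<noteq> \<pi> j"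
      using injD[OF permutes_inj[OF perm], of "Suc j" j] by auto
    moreover have "j < \<pi> j"
      using step by simp
    ultimately show ?case by simp
  qed (use assms in simp)
  from this[of "n - 1"] have "n - 1 < \<pi> (n - 1)"
    using assms(2) by linarith
  then show False
    using assms(2) \<pi>_less[of "n - 1"] by simp
qed

lemma nth_labels:
  assumes "k < n"
  shows "labels N d ! k = (let b = N - (\<Sum>j\<in>{k..<n}. d j) in if k < \<pi> k then 2 * b else 2 * b - 1)"
  using assms by (simp add: labels_def)

text \<open>The bound \<open>n * M < N\<close> keeps \<open>b\<close> positive, so that the
  subtraction in \<open>2 * b - 1\<close> is not truncated.\<close>

lemma Suc_labels_div:
  assumes "d \<in> box M" "n * M < N" "k < n"
  shows "Suc (labels N d ! k) div 2 = N - (\<Sum>j\<in>{k..<n}. d j)" "N - (\<Sum>j\<in>{k..<n}. d j) > 0"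
    "even (labels N d ! k) \<longleftrightarrow> k < \<pi> k"
proof -
  show pos: "N - (\<Sum>j\<in>{k..<n}. d j) > 0"
    using tail_bounds[OF assms(1,3)] assms(2) by simp
  show "Suc (labels N d ! k) div 2 = N - (\<Sum>j\<in>{k..<n}. d j)" "even (labels N d ! k) \<longleftrightarrow> k < \<pi> k"
    using pos unfolding nth_labels[OF assms(3)] Let_def by (cases "k < \<pi> k"; simp)+
qed

lemma labels_in_exc_labels:
  assumes d: "d \<in> box M" and N: "n * M < N"
  shows "labels N d \<in> exc_labels n (2 * N) \<pi>"
proof -
  define s where "s k = (\<Sum>j\<in>{k..<n}. d j)" for k
  note L = Suc_labels_div[OF d N, folded s_def]
  have s_Suc: "s k = d k + s (Suc k)" if "k < n" for k
    using that by (simp add: s_def sum.atLeast_Suc_lessThan)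
  have s_le: "s k < N" if "k < n" for k
    using tail_bounds[OF d that] N by (simp add: s_def)
  have len: "length (labels N d) = n"
    by (simp add: labels_def)
  have "labels N d ! k < 2 * N" if "k < n" for k
    using tail_pos[OF d that, folded s_def] s_le[OF that] unfolding nth_labels[OF that] Let_def s_def[symmetric]
    by auto
  then have "set (labels N d) \<subseteq> {..<2 * N}"
    by (auto simp: in_set_conv_nth len)
  moreover have "labels N d ! k \<le> labels N d ! Suc k" if k: "Suc k < n" for k
  proof (cases "d k = 0")
    case True
    \<comment> \<open>The two values are equal. Without a descent an excedance at \<open>k\<close>
      passes on to \<open>Suc k\<close>, so a barred label is never followed by an unbarred one of
      the same value.\<close>
    then have "k \<notin> desc"
      using d k by (auto simp: box_def PiE_iff dest!: bspec[of _ _ k])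
    then have "\<not> \<pi> (Suc k) < \<pi> k"
      using k by (simp add: desc_def)
    moreover have "\<pi> (Suc k) \<noteq> \<pi> k"
      using injD[OF permutes_inj[OF perm], of "Suc k" k] by auto
    moreover have "s k = s (Suc k)"
      using s_Suc[of k] True k by simp
    ultimately show ?thesis
      using k by (auto simp: nth_labels s_def[symmetric] Let_def)
  next
    case False
    then have "N - s (Suc k) \<ge> Suc (N - s k)"
      using s_Suc[of k] s_le[of k] k by simp
    then show ?thesis
      using k by (auto simp: nth_labels s_def[symmetric] Let_def)
  qed
  then have "sorted (labels N d)"
    by (simp add: sorted_iff_nth_Suc len)
  moreover have "Suc (labels N d ! k) div 2 \<noteq> Suc (labels N d ! Suc k) div 2"
    if "Suc k < n" "\<pi> (Suc k) < \<pi> k" for k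
  proof -
    have "k \<in> desc" using that by (simp add: desc_def)
    then have "d k \<noteq> 0"
      using d that(1) by (auto simp: box_def PiE_iff dest!: bspec[of _ _ k])
    then show ?thesis
      using s_Suc[of k] s_le[of k] that L(1)[of k] L(1)[of "Suc k"] by simp
  qed
  ultimately show ?thesis
    using L(3) len by (auto simp: exc_labels_def)
qed

lemma inj_on_labels:
  assumes "n * M < N"
  shows "inj_on (labels N) (box M)"
proof (rule inj_onI)
  fix d e assume de: "d \<in> box M" "e \<in> box M" "labels N d = labels N e"
  have tail: "(\<Sum>j\<in>{k..<n}. d j) = (\<Sum>j\<in>{k..<n}. e j)" for k
  proof (cases "k < n")
    case True
    then have "N - (\<Sum>j\<in>{k..<n}. d j) = N - (\<Sum>j\<in>{k..<n}. e j)"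
      using Suc_labels_div(1)[OF de(1) assms True] Suc_labels_div(1)[OF de(2) assms True] de(3) by simp
    then show ?thesis
      using tail_bounds[OF de(1) True] tail_bounds[OF de(2) True] assms by simp
  qed simp
  have "d k = e k" if "k < n" for k
    using tail[of k] tail[of "Suc k"] that by (simp add: sum.atLeast_Suc_lessThan)
  then show "d = e"
    using de(1,2) unfolding box_def by (intro PiE_ext[of d]) auto
qed

definition major :: nat where "major = (\<Sum>k\<in>desc. Suc k)"

lemma finite_box: "finite (box M)"
  unfolding box_def by (intro finite_PiE) auto

lemma finite_exc_labels: "finite (exc_labels n K \<pi>)"
  by (rule finite_subset[OF _ finite_lists_length_eq[of "{..<K}" n]]) (auto simp: exc_labels_def)

text \<open>A squeeze: \<open>F N \<le> G N\<close>, while each single \<open>G M\<close> is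
  eventually a lower bound for \<open>F N\<close>. The sums \<open>G M\<close> over boxes factor
  into truncated geometric series.\<close>

lemma label_sum_tendsto:
  fixes p :: real
  assumes p: "0 < p" "p < 1"
  shows "(\<lambda>N. \<Sum>xs\<in>exc_labels n (2 * N) \<pi>. \<Prod>k<n. p ^ (N - Suc (xs ! k) div 2)) \<longlonglongrightarrow>
    p ^ major / (\<Prod>k<n. 1 - p ^ Suc k)"
proof -
  define F where "F N = (\<Sum>xs\<in>exc_labels n (2 * N) \<pi>. \<Prod>k<n. p ^ (N - Suc (xs ! k) div 2))" for N
  define G where "G M = (\<Sum>d\<in>box M. \<Prod>k<n. (p ^ Suc k) ^ d k)" for M
  define L where "L = p ^ major / (\<Prod>k<n. 1 - p ^ Suc k)"
  \<comment> \<open>The drop at \<open>k\<close> is counted in the \<open>Suc k\<close> values up to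
    place \<open>k\<close>. This makes the weight a product over places, and the forced drops at
    descents contribute the major index.\<close>
  have weight: "(\<Prod>k<n. p ^ (\<Sum>j\<in>{k..<n}. d j)) = (\<Prod>k<n. (p ^ Suc k) ^ d k)" for d
    by (simp add: power_sum[symmetric] sum_tails power_mult[symmetric] del: power_Suc)
  have nonneg: "(\<Prod>k<n. (p ^ Suc k) ^ d k) \<ge> 0" for d
    using p by (intro prod_nonneg) auto
  have upper: "F N \<le> G N" for N
  proof -
    have "F N = (\<Sum>xs\<in>exc_labels n (2 * N) \<pi>. \<Prod>k<n. (p ^ Suc k) ^ incr N xs k)"
      unfolding F_def weight[symmetric] by (intro sum.cong prod.cong) (simp_all add: exc_labels_tail)
    also have "\<dots> = (\<Sum>d\<in>incr N ` exc_labels n (2 * N) \<pi>. \<Prod>k<n. (p ^ Suc k) ^ d k)"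
      by (subst sum.reindex) (auto intro!: inj_on_inverseI[of _ "labels N"] labels_incr)
    also have "\<dots> \<le> G N"
      unfolding G_def using incr_in_box nonneg by (intro sum_mono2 finite_box) auto
    finally show ?thesis .
  qed
  have lower: "G M \<le> F N" if "n * M < N" for M N
  proof -
    have "G M = (\<Sum>d\<in>box M. \<Prod>k<n. p ^ (N - Suc (labels N d ! k) div 2))"
      unfolding G_def weight[symmetric]
    proof (intro sum.cong prod.cong refl)
      fix d k assume "d \<in> box M" "k \<in> {..<n}"
      then show "p ^ (\<Sum>j\<in>{k..<n}. d j) = p ^ (N - Suc (labels N d ! k) div 2)"
        using Suc_labels_div[of d M N k] that by simp
    qed
    also have "\<dots> = (\<Sum>xs\<in>labels N ` box M. \<Prod>k<n. p ^ (N - Suc (xs ! k) div 2))"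
      by (subst sum.reindex[OF inj_on_labels[OF that]]) simp
    also have "\<dots> \<le> F N"
      unfolding F_def using labels_in_exc_labels that p
      by (intro sum_mono2 finite_exc_labels) (auto intro!: prod_nonneg)
    finally show ?thesis .
  qed
  have "G \<longlonglongrightarrow> L"
  proof -
    define a where "a k = (if k \<in> desc then 1 else 0 :: nat)" for k
    have G: "G M = (\<Prod>k<n. \<Sum>e\<in>{a k..M}. (p ^ Suc k) ^ e)" for M
      unfolding G_def box_def a_def by (subst prod_sum_PiE) auto
    have "(\<lambda>M. \<Sum>e\<in>{a k..M}. (p ^ Suc k) ^ e) \<longlonglongrightarrow> (p ^ Suc k) ^ a k / (1 - p ^ Suc k)" for k
    proof -
      define r where "r = p ^ Suc k"
      have r: "0 < r" "r < 1"
        using p power_Suc_less_one[of p k] by (auto simp: r_def)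
      have "eventually (\<lambda>M. (r ^ a k - r ^ Suc M) / (1 - r) = (\<Sum>e\<in>{a k..M}. r ^ e)) sequentially"
        using eventually_ge_at_top[of 1]
      proof eventually_elim
        case (elim M)
        then have "\<not> M < a k" by (simp add: a_def)
        then show ?case
          using r by (subst sum_gp) auto
      qed
      moreover have "(\<lambda>M. (r ^ a k - r ^ Suc M) / (1 - r)) \<longlonglongrightarrow> (r ^ a k - 0) / (1 - r)"
        using r by (intro tendsto_intros LIMSEQ_Suc LIMSEQ_realpow_zero) auto
      ultimately have "(\<lambda>M. \<Sum>e\<in>{a k..M}. r ^ e) \<longlonglongrightarrow> (r ^ a k - 0) / (1 - r)"
        by (rule Lim_transform_eventually[rotated])
      then show ?thesis
        by (simp add: r_def)
    qed
    then have "G \<longlonglongrightarrow> (\<Prod>k<n. (p ^ Suc k) ^ a k / (1 - p ^ Suc k))"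
      unfolding G by (intro tendsto_prod) auto
    also have "(\<Prod>k<n. (p ^ Suc k) ^ a k / (1 - p ^ Suc k)) = (\<Prod>k<n. (p ^ Suc k) ^ a k) / (\<Prod>k<n. 1 - p ^ Suc k)"
      by (rule prod_dividef)
    also have "(\<Prod>k<n. (p ^ Suc k) ^ a k) = p ^ (\<Sum>k<n. Suc k * a k)"
      by (simp only: power_sum power_mult)
    also have "(\<Sum>k<n. Suc k * a k) = major"
      unfolding major_def a_def by (rule sum.mono_neutral_cong_right) (auto simp: desc_def)
    finally show ?thesis by (simp add: L_def)
  qed
  have "F \<longlonglongrightarrow> L"
  proof (rule order_tendstoI)
    fix y assume "y > L"
    then have "eventually (\<lambda>N. G N < y) sequentially"
      using \<open>G \<longlonglongrightarrow> L\<close> by (simp add: order_tendsto_iff)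
    then show "eventually (\<lambda>N. F N < y) sequentially"
      by eventually_elim (use upper in \<open>auto intro: le_less_trans\<close>)
  next
    fix y assume "y < L"
    then have "eventually (\<lambda>N. y < G N) sequentially"
      using \<open>G \<longlonglongrightarrow> L\<close> by (simp add: order_tendsto_iff)
    then obtain M where M: "y < G M"
      by (auto simp: eventually_sequentially)
    show "eventually (\<lambda>N. y < F N) sequentially"
      using eventually_gt_at_top[of "n * M"]
    proof eventually_elim
      case (elim N)
      then show ?case
        using lower[of M N] M by simp
    qed
  qed
  then show ?thesis
    unfolding F_def[abs_def] L_def .
qed

text \<open>A barred label \<open>2 * b\<close> has value \<open>N - b\<close> but carries
  \<open>p ^ (N - 1 - b)\<close>, one power less; so every excedance contributes
  \<open>t / p\<close>. For unbarred labels value and exponent agree.\<close>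

lemma weighted_label_sum:
  fixes p t :: real
  assumes p: "0 < p" "p < 1"
  shows "(\<lambda>N. \<Sum>xs\<in>exc_labels n (2 * N) \<pi>. \<Prod>k<n. if even (xs ! k) then t * p ^ (N - 1 - xs ! k div 2)
      else p ^ (N - 1 - xs ! k div 2)) \<longlonglongrightarrow>
    (t / p) ^ card {k. k < n \<and> k < \<pi> k} * (p ^ major / (\<Prod>k<n. 1 - p ^ Suc k))"
proof -
  define wt where "wt N c = (if even c then t * p ^ (N - 1 - c div 2) else p ^ (N - 1 - c div 2))" for N c
  have "(\<Sum>xs\<in>exc_labels n (2 * N) \<pi>. \<Prod>k<n. wt N (xs ! k)) =
      (t / p) ^ card {k. k < n \<and> k < \<pi> k} * (\<Sum>xs\<in>exc_labels n (2 * N) \<pi>. \<Prod>k<n. p ^ (N - Suc (xs ! k) div 2))" for N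
    unfolding sum_distrib_left
  proof (intro sum.cong refl)
    fix xs assume xs: "xs \<in> exc_labels n (2 * N) \<pi>"
    have "wt N (xs ! k) = (if k < \<pi> k then t / p else 1) * p ^ (N - Suc (xs ! k) div 2)" if "k < n" for k
    proof -
      have "even (xs ! k) \<longleftrightarrow> k < \<pi> k"
        using xs that by (simp add: exc_labels_def)
      have "xs ! k \<in> {..<2 * N}"
        using xs that nth_mem[of k xs] unfolding exc_labels_def by blast
      then have "xs ! k < 2 * N"
        by simp
      then show ?thesis
      proof (cases "even (xs ! k)")
        case True
        then obtain b where b: "xs ! k = 2 * b" by (elim evenE)
        then have "N - b = Suc (N - Suc b)"
          using \<open>xs ! k < 2 * N\<close> by simp
        then show ?thesis
          using True \<open>even (xs ! k) \<longleftrightarrow> k < \<pi> k\<close> b p by (simp add: wt_def)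
      next
        case False
        then show ?thesis
          using \<open>even (xs ! k) \<longleftrightarrow> k < \<pi> k\<close> by (auto simp: wt_def elim!: oddE)
      qed
    qed
    then have "(\<Prod>k<n. wt N (xs ! k)) =
        (\<Prod>k<n. if k < \<pi> k then t / p else 1) * (\<Prod>k<n. p ^ (N - Suc (xs ! k) div 2))"
      by (simp add: prod.distrib)
    also have "(\<Prod>k<n. if k < \<pi> k then t / p else 1) = (\<Prod>k\<in>{k. k < n \<and> k < \<pi> k}. t / p)"
      by (rule prod.mono_neutral_cong_right) auto
    finally show "(\<Prod>k<n. wt N (xs ! k)) =
        (t / p) ^ card {k. k < n \<and> k < \<pi> k} * (\<Prod>k<n. p ^ (N - Suc (xs ! k) div 2))"
      by simp
  qed
  then show ?thesis
    unfolding wt_def using tendsto_mult_left[OF label_sum_tendsto[OF p]] by simp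
qed

end

section \<open>Coefficients of the linear products\<close>

lemma lin_prod_scale:
  fixes x :: "nat \<Rightarrow> 'r::comm_ring_1"
  shows "fps_nth (lin_prod (\<lambda>i. t * x i) N) n = t ^ n * fps_nth (lin_prod x N) n"
proof (induction N arbitrary: n)
  case 0
  then show ?case by simp
next
  case (Suc N)
  have step: "fps_nth (lin_prod x (Suc N)) n = fps_nth (lin_prod x N) n - (if n = 0 then 0 else x N * fps_nth (lin_prod x N) (n - 1))"
    for x :: "nat \<Rightarrow> 'r" and n
    by (simp add: lin_prod_Suc algebra_simps)
  show ?case
    unfolding step Suc.IH by (cases n) (simp_all add: algebra_simps)
qed

lemma lin_prod_nth_0 [simp]: "fps_nth (lin_prod x N) 0 = 1"
  by (induction N) (simp_all add: lin_prod_Suc)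

lemma lin_prod_rev: "lin_prod (\<lambda>i. x (N - 1 - i)) N = lin_prod x N"
  unfolding lin_prod_def
  by (rule prod.reindex_bij_witness[of _ "\<lambda>i. N - 1 - i" "\<lambda>i. N - 1 - i"]) auto

text \<open>The finite q-binomial theorem, cleared of denominators. For \<open>n > N\<close> the
  right side vanishes through its factor at \<open>k = N\<close>, as it should.\<close>

lemma lin_prod_geometric:
  fixes p :: "'r::comm_ring_1"
  shows "fps_nth (lin_prod (\<lambda>i. p ^ i) N) n * (\<Prod>k<n. 1 - p ^ Suc k) =
    (-1) ^ n * p ^ (n choose 2) * (\<Prod>k<n. 1 - p ^ (N - k))"
proof (induction N arbitrary: n)
  case 0
  then show ?case by (cases n) (simp_all add: binomial_eq_0)
next
  case (Suc N)
  show ?case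
  proof (cases n)
    case (Suc m)
    define A where "A = (\<Prod>k<m. 1 - p ^ (N - k))"
    have choose: "Suc m choose 2 = m + (m choose 2)"
      by (simp add: numeral_2_eq_2)
    have "fps_nth (lin_prod (\<lambda>i. p ^ i) (Suc N)) n * (\<Prod>k<n. 1 - p ^ Suc k) =
        fps_nth (lin_prod (\<lambda>i. p ^ i) N) (Suc m) * (\<Prod>k<Suc m. 1 - p ^ Suc k) -
        p ^ N * (1 - p ^ Suc m) * (fps_nth (lin_prod (\<lambda>i. p ^ i) N) m * (\<Prod>k<m. 1 - p ^ Suc k))"
      unfolding Suc lin_prod_Suc by (simp add: algebra_simps)
    also have "\<dots> = (-1) ^ Suc m * p ^ (m choose 2) * (p ^ m * (A * (1 - p ^ (N - m))) + p ^ N * (1 - p ^ Suc m) * A)"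
      unfolding Suc.IH choose A_def by (simp add: algebra_simps power_add)
    also have "p ^ m * (A * (1 - p ^ (N - m))) + p ^ N * (1 - p ^ Suc m) * A = p ^ m * ((1 - p ^ Suc N) * A)"
    proof (cases "m \<le> N")
      case True
      then have "p ^ m * p ^ (N - m) = p ^ N"
        by (simp flip: power_add)
      then show ?thesis
        by (simp add: algebra_simps)
    next
      case False
      then have "A = 0"
        unfolding A_def by (intro prod_zero bexI[of _ N]) auto
      then show ?thesis by simp
    qed
    also have "(1 - p ^ Suc N) * A = (\<Prod>k<n. 1 - p ^ (Suc N - k))"
      unfolding Suc A_def by (simp add: prod.lessThan_Suc_shift del: prod.lessThan_Suc)
    finally show ?thesis
      unfolding Suc choose by (simp add: power_add mult.assoc)
  qed (simp add: binomial_eq_0)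
qed

text \<open>The limits are the coefficients in Euler's expansion of the infinite product of the
  factors \<open>1 - p ^ i * X\<close>; reversing the exponents does not change the finite
  products.\<close>

lemma lin_prod_tendsto:
  fixes p :: real
  assumes p: "0 < p" "p < 1"
  shows "(\<lambda>N. fps_nth (lin_prod (\<lambda>i. p ^ (N - 1 - i)) N) n) \<longlonglongrightarrow> (-1) ^ n * p ^ (n choose 2) / (\<Prod>k<n. 1 - p ^ Suc k)"
proof -
  have nz: "(\<Prod>k<n. 1 - p ^ Suc k) \<noteq> 0"
    using p power_Suc_less_one[of p] by (auto simp: less_le simp del: power_Suc)
  have eq: "fps_nth (lin_prod (\<lambda>i. p ^ (N - 1 - i)) N) n =
      (-1) ^ n * p ^ (n choose 2) * (\<Prod>k<n. 1 - p ^ (N - k)) / (\<Prod>k<n. 1 - p ^ Suc k)" for N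
    unfolding lin_prod_rev[of "\<lambda>i. p ^ i"]
    using nz lin_prod_geometric[of p N n] by (simp add: eq_divide_eq)
  have "(\<lambda>N. p ^ (N - k)) \<longlonglongrightarrow> 0" for k
    by (rule LIMSEQ_offset[of _ k]) (use p in \<open>simp add: LIMSEQ_realpow_zero\<close>)
  then have "(\<lambda>N. (-1) ^ n * p ^ (n choose 2) * (\<Prod>k<n. 1 - p ^ (N - k)) / (\<Prod>k<n. 1 - p ^ Suc k)) \<longlonglongrightarrow>
      (-1) ^ n * p ^ (n choose 2) * (\<Prod>k<n. 1 - 0) / (\<Prod>k<n. 1 - p ^ Suc k)"
    using nz by (intro tendsto_intros) auto
  then show ?thesis
    unfolding eq by simp
qed

section \<open>The recurrence of the excedance polynomials\<close>

definition exc_weight :: "real \<Rightarrow> real \<Rightarrow> nat \<Rightarrow> real" where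
  "exc_weight p t n = (\<Sum>\<pi> | \<pi> permutes {..<n}. t ^ card {k. k < n \<and> k < \<pi> k} * p ^ label_limit.major n \<pi>)"

text \<open>The coefficient of degree \<open>n\<close> in \<open>strict_fps_bar_row\<close>, taken
  to the limit. Scaling the weights by \<open>t\<close> multiplies the coefficient of degree
  \<open>m\<close> by \<open>t ^ m\<close>, so the denominator has the coefficients
  \<open>(1 - t ^ Suc m) * c m\<close>.\<close>

lemma exc_weight_limit_recurrence:
  fixes p t :: real and n :: nat
  assumes p: "0 < p" "p < 1"
  defines "P \<equiv> \<lambda>n. \<Prod>k<n. 1 - p ^ Suc k"
  defines "c \<equiv> \<lambda>n. (-1) ^ n * p ^ (n choose 2) / P n"
  shows "(\<Sum>k=0..n. exc_weight p (t / p) k / P k * ((1 - t ^ Suc (n - k)) * c (n - k))) = (1 - t) * (t ^ n * c n)"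
proof -
  define x where "x N i = p ^ (N - 1 - i)" for N i
  define S where "S N = strict_fps (Collect even) (bar_row (x N) t) (2 * N)" for N
  have S: "(\<lambda>N. fps_nth (S N) k) \<longlonglongrightarrow> exc_weight p (t / p) k / P k" for k
  proof -
    have "(\<lambda>N. \<Sum>\<pi> | \<pi> permutes {..<k}. \<Sum>xs\<in>exc_labels k (2 * N) \<pi>.
        \<Prod>i<k. if even (xs ! i) then t * p ^ (N - 1 - xs ! i div 2) else p ^ (N - 1 - xs ! i div 2)) \<longlonglongrightarrow>
      (\<Sum>\<pi> | \<pi> permutes {..<k}. (t / p) ^ card {i. i < k \<and> i < \<pi> i} * (p ^ label_limit.major k \<pi> / P k))"
      unfolding P_def by (intro tendsto_sum label_limit.weighted_label_sum p) (auto simp: label_limit_def)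
    then show ?thesis
      unfolding S_def strict_fps_bar_row_nth x_def exc_weight_def sum_divide_distrib by simp
  qed
  have E: "(\<lambda>N. fps_nth (lin_prod (x N) N) k) \<longlonglongrightarrow> c k" for k
    using lin_prod_tendsto[OF p] unfolding x_def c_def P_def .
  have coeff: "(\<Sum>k=0..n. fps_nth (S N) k * ((1 - t ^ Suc (n - k)) * fps_nth (lin_prod (x N) N) (n - k))) =
      (1 - t) * (t ^ n * fps_nth (lin_prod (x N) N) n)" for N
  proof -
    have "fps_nth (S N * (lin_prod (x N) N - fps_const t * lin_prod (\<lambda>i. t * x N i) N)) n =
        fps_nth ((1 - fps_const t) * lin_prod (\<lambda>i. t * x N i) N) n"
      unfolding S_def strict_fps_bar_row ..
    also have "1 - fps_const t = fps_const (1 - t)"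
      by simp
    finally show ?thesis
      unfolding fps_mult_nth[of "S N"] by (simp add: lin_prod_scale algebra_simps)
  qed
  have "(\<lambda>N. \<Sum>k=0..n. fps_nth (S N) k * ((1 - t ^ Suc (n - k)) * fps_nth (lin_prod (x N) N) (n - k))) \<longlonglongrightarrow>
      (\<Sum>k=0..n. exc_weight p (t / p) k / P k * ((1 - t ^ Suc (n - k)) * c (n - k)))"
    by (intro tendsto_intros S E)
  moreover have "(\<lambda>N. (1 - t) * (t ^ n * fps_nth (lin_prod (x N) N) n)) \<longlonglongrightarrow> (1 - t) * (t ^ n * c n)"
    by (intro tendsto_intros E)
  ultimately show ?thesis
    unfolding coeff by (rule LIMSEQ_unique)
qed

definition q_prod :: "real \<Rightarrow> nat \<Rightarrow> real" where
  "q_prod q n = (\<Prod>k<n. q ^ Suc k - 1)"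

lemma q_prod_nonzero: "q > 1 \<Longrightarrow> q_prod q n \<noteq> 0"
proof -
  assume "q > 1"
  then have "q ^ Suc k - 1 \<noteq> 0" for k
    using one_less_power[of q "Suc k"] by linarith
  then show ?thesis
    unfolding q_prod_def by (simp add: prod_zero_iff del: power_Suc)
qed

text \<open>The identity \<open>P n * q ^ (n choose 2) * q ^ n = q_prod q n\<close> translates
  everything from \<open>p\<close> to \<open>q\<close>. The powers \<open>q ^ k\<close> and
  \<open>q ^ (n - k)\<close> combine to a common factor, which cancels, as does
  \<open>1 - t\<close>; multiplying by \<open>(-1) ^ n\<close> leaves the sign
  \<open>(-1) ^ k\<close>.\<close>

theorem exc_weight_recurrence:
  fixes q t :: real
  assumes q: "q > 1" and t: "t \<noteq> 1"
  defines "D \<equiv> \<lambda>k. q ^ (k choose 2) * exc_weight (1 / q) (q * t) k"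
  shows "(\<Sum>k\<le>n. (-1) ^ k * D k * (\<Sum>i<Suc (n - k). t ^ i) * (q_prod q n / (q_prod q k * q_prod q (n - k)))) = t ^ n"
proof -
  define p where "p = 1 / q"
  define P where "P n = (\<Prod>k<n. 1 - p ^ Suc k)" for n
  have p: "0 < p" "p < 1"
    using q by (auto simp: p_def)
  have P: "P n * q ^ (n choose 2) * q ^ n = q_prod q n" for n
  proof (induction n)
    case (Suc n)
    have "P (Suc n) * q ^ (Suc n choose 2) * q ^ Suc n = (P n * q ^ (n choose 2) * q ^ n) * ((1 - p ^ Suc n) * q ^ Suc n)"
      by (simp add: P_def numeral_2_eq_2 power_add)
    also have "(1 - p ^ Suc n) * q ^ Suc n = q ^ Suc n - 1"
      using q by (simp add: p_def left_diff_distrib power_mult_distrib[symmetric] del: power_Suc)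
    finally show ?case
      unfolding Suc.IH by (simp add: q_prod_def)
  qed (simp add: P_def q_prod_def binomial_eq_0)
  have Q: "q_prod q k \<noteq> 0" for k
    using q by (rule q_prod_nonzero)
  have Pnz: "P k \<noteq> 0" for k
    using P[of k] Q[of k] by auto
  have W: "exc_weight p (t / p) k / P k = D k * q ^ k / q_prod q k" for k
    using q Pnz[of k] unfolding P[of k, symmetric] D_def by (simp add: p_def mult_ac)
  have c: "(-1) ^ k * p ^ (k choose 2) / P k = (-1) ^ k * q ^ k / q_prod q k" for k
    using q Pnz[of k] unfolding P[of k, symmetric] by (simp add: p_def power_divide)
  have geo: "1 - t ^ Suc m = (1 - t) * (\<Sum>i<Suc m. t ^ i)" for m
    using t by (subst sum_gp_strict) (simp_all del: power_Suc)
  have scaled: "(1 - t) * (\<Sum>k=0..n. D k * (\<Sum>i<Suc (n - k). t ^ i) * ((-1) ^ (n - k) * q ^ n / (q_prod q k * q_prod q (n - k)))) =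
      (1 - t) * (t ^ n * ((-1) ^ n * q ^ n / q_prod q n))"
  proof -
    have "(1 - t) * (\<Sum>k=0..n. D k * (\<Sum>i<Suc (n - k). t ^ i) * ((-1) ^ (n - k) * q ^ n / (q_prod q k * q_prod q (n - k)))) =
        (\<Sum>k=0..n. exc_weight p (t / p) k / P k * ((1 - t ^ Suc (n - k)) * ((-1) ^ (n - k) * p ^ ((n - k) choose 2) / P (n - k))))"
    proof (subst sum_distrib_left, rule sum.cong)
      fix k assume "k \<in> {0..n}"
      then have "q ^ n = q ^ k * q ^ (n - k)"
        by (simp flip: power_add)
      then show "(1 - t) * (D k * (\<Sum>i<Suc (n - k). t ^ i) * ((-1) ^ (n - k) * q ^ n / (q_prod q k * q_prod q (n - k)))) =
          exc_weight p (t / p) k / P k * ((1 - t ^ Suc (n - k)) * ((-1) ^ (n - k) * p ^ ((n - k) choose 2) / P (n - k)))"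
        unfolding W c geo by simp
    qed simp
    also have "\<dots> = (1 - t) * (t ^ n * ((-1) ^ n * p ^ (n choose 2) / P n))"
      using exc_weight_limit_recurrence[OF p, where t = t and n = n] unfolding P_def .
    finally show ?thesis
      unfolding c .
  qed
  have eq: "(\<Sum>k=0..n. D k * (\<Sum>i<Suc (n - k). t ^ i) * ((-1) ^ (n - k) * q ^ n / (q_prod q k * q_prod q (n - k)))) =
      t ^ n * ((-1) ^ n * q ^ n / q_prod q n)"
    by (rule mult_left_cancel[THEN iffD1, OF _ scaled]) (use t in simp)
  have "(\<Sum>k\<le>n. (-1) ^ k * D k * (\<Sum>i<Suc (n - k). t ^ i) * (q_prod q n / (q_prod q k * q_prod q (n - k)))) =
      (-1) ^ n * q_prod q n / q ^ n *
        (\<Sum>k=0..n. D k * (\<Sum>i<Suc (n - k). t ^ i) * ((-1) ^ (n - k) * q ^ n / (q_prod q k * q_prod q (n - k))))"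
    unfolding atMost_atLeast0
  proof (subst sum_distrib_left, rule sum.cong)
    fix k assume "k \<in> {0..n}"
    then have "(-1 :: real) ^ n = (-1) ^ k * (-1) ^ (n - k)"
      by (simp flip: power_add)
    then have "(-1 :: real) ^ n * (-1) ^ (n - k) = (-1) ^ k"
      by (simp add: mult.assoc flip: power_mult_distrib)
    then show "(-1) ^ k * D k * (\<Sum>i<Suc (n - k). t ^ i) * (q_prod q n / (q_prod q k * q_prod q (n - k))) =
      (-1) ^ n * q_prod q n / q ^ n * (D k * (\<Sum>i<Suc (n - k). t ^ i) * ((-1) ^ (n - k) * q ^ n / (q_prod q k * q_prod q (n - k))))"
      using q by (simp add: mult_ac del: sum.lessThan_Suc)
  qed simp
  also have "\<dots> = t ^ n"
  proof -
    have "a * Q / r * (T * (a * r / Q)) = (a * a) * T" if "Q \<noteq> 0" "r \<noteq> 0" for a Q r T :: real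
      using that by (simp add: field_simps)
    from this[OF Q[of n], of "q ^ n" "(-1) ^ n" "t ^ n"] show ?thesis
      unfolding eq using q by (simp flip: power_mult_distrib)
  qed
  finally show ?thesis .
qed

text \<open>A shift of indices by one: the descent \<open>k\<close> of the shifted permutation
  counts \<open>Suc k\<close>, and the place \<open>n\<close> left out by \<open>exc\<close> is
  never an excedance.\<close>

lemma exc_weight_eq_maj_exc:
  "exc_weight p t n = (\<Sum>\<sigma> | \<sigma> permutes {1..n}. t ^ exc n \<sigma> * p ^ maj n \<sigma>)"
proof -
  define f where "f \<sigma> k = (if k < n then \<sigma> (Suc k) - 1 else k)" for \<sigma> :: "nat \<Rightarrow> nat" and k
  define g where "g \<pi> i = (if i \<in> {1..n} then Suc (\<pi> (i - 1)) else i)" for \<pi> :: "nat \<Rightarrow> nat" and i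
  have range: "\<sigma> i \<in> {1..n}" if "\<sigma> permutes {1..n}" "i \<in> {1..n}" for \<sigma> i
    using permutes_in_image[OF that(1), of i] that(2) by simp
  have range': "\<pi> i < n" if "\<pi> permutes {..<n}" "i < n" for \<pi> i
    using permutes_in_image[OF that(1), of i] that(2) by simp
  have f_perm: "f \<sigma> permutes {..<n}" if s: "\<sigma> permutes {1..n}" for \<sigma>
  proof (rule bij_imp_permutes)
    have "inj_on (f \<sigma>) {..<n}"
    proof (rule inj_onI)
      fix k l assume "k \<in> {..<n}" "l \<in> {..<n}" "f \<sigma> k = f \<sigma> l"
      then have "\<sigma> (Suc k) = \<sigma> (Suc l)"
        using range[OF s, of "Suc k"] range[OF s, of "Suc l"] by (auto simp: f_def)
      then show "k = l"
        using permutes_inj[OF s] by (auto dest: injD)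
    qed
    moreover have "f \<sigma> ` {..<n} \<subseteq> {..<n}"
    proof
      fix y assume "y \<in> f \<sigma> ` {..<n}"
      then obtain k where "k < n" "y = \<sigma> (Suc k) - 1"
        by (auto simp: f_def)
      then show "y \<in> {..<n}"
        using range[OF s, of "Suc k"] by auto
    qed
    ultimately show "bij_betw (f \<sigma>) {..<n} {..<n}"
      by (simp add: bij_betw_def endo_inj_surj)
  qed (simp add: f_def)
  have g_perm: "g \<pi> permutes {1..n}" if s: "\<pi> permutes {..<n}" for \<pi>
  proof (rule bij_imp_permutes)
    have "inj_on (g \<pi>) {1..n}"
    proof (rule inj_onI)
      fix k l assume *: "k \<in> {1..n}" "l \<in> {1..n}" "g \<pi> k = g \<pi> l"
      then have "\<pi> (k - 1) = \<pi> (l - 1)"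
        by (simp add: g_def)
      then have "k - 1 = l - 1"
        using injD[OF permutes_inj[OF s], of "k - 1" "l - 1"] by simp
      then show "k = l"
        using * by auto
    qed
    moreover have "g \<pi> ` {1..n} \<subseteq> {1..n}"
    proof
      fix y assume "y \<in> g \<pi> ` {1..n}"
      then obtain i where i: "i \<in> {1..n}" "y = Suc (\<pi> (i - 1))"
        by (auto simp: g_def)
      moreover from i have "i - 1 < n"
        by auto
      ultimately show "y \<in> {1..n}"
        using range'[OF s, of "i - 1"] by simp
    qed
    ultimately show "bij_betw (g \<pi>) {1..n} {1..n}"
      by (simp add: bij_betw_def endo_inj_surj)
  qed (auto simp: g_def)
  show ?thesis
    unfolding exc_weight_def
  proof (rule sum.reindex_bij_witness[of _ f g])
    fix \<pi> assume "\<pi> \<in> {\<pi>. \<pi> permutes {..<n}}"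
    then have s: "\<pi> permutes {..<n}" by simp
    show "f (g \<pi>) = \<pi>"
      using permutes_not_in[OF s] by (auto simp: f_def g_def fun_eq_iff)
    show "g \<pi> \<in> {\<sigma>. \<sigma> permutes {1..n}}"
      using g_perm[OF s] by simp
    have "exc n (g \<pi>) = card (Suc ` {k. k < n \<and> k < \<pi> k})"
      unfolding exc_def
    proof (rule arg_cong[where f = card], intro Set.set_eqI iffI)
      fix i assume "i \<in> {i \<in> {1..n - 1}. g \<pi> i > i}"
      then show "i \<in> Suc ` {k. k < n \<and> k < \<pi> k}"
        by (intro image_eqI[of _ _ "i - 1"]) (auto simp: g_def split: if_splits)
    next
      fix i assume "i \<in> Suc ` {k. k < n \<and> k < \<pi> k}"
      then obtain k where k: "i = Suc k" "k < n" "k < \<pi> k" by auto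
      then show "i \<in> {i \<in> {1..n - 1}. g \<pi> i > i}"
        using range'[OF s, of k] by (auto simp: g_def)
    qed
    moreover have "maj n (g \<pi>) = label_limit.major n \<pi>"
    proof -
      interpret label_limit n \<pi>
        by unfold_locales (rule s)
      show ?thesis
        unfolding maj_def major_def
        by (rule sum.reindex_bij_witness[of _ Suc "\<lambda>i. i - 1"]) (auto simp: desc_def g_def split: if_splits)
    qed
    ultimately show "t ^ exc n (g \<pi>) * p ^ maj n (g \<pi>) =
        t ^ card {k. k < n \<and> k < \<pi> k} * p ^ label_limit.major n \<pi>"
      by (simp add: card_image)
  next
    fix \<sigma> assume "\<sigma> \<in> {\<sigma>. \<sigma> permutes {1..n}}"
    then have s: "\<sigma> permutes {1..n}" by simp
    show "f \<sigma> \<in> {\<pi>. \<pi> permutes {..<n}}"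
      using f_perm[OF s] by simp
    show "g (f \<sigma>) = \<sigma>"
    proof
      fix i show "g (f \<sigma>) i = \<sigma> i"
        using permutes_not_in[OF s, of i] range[OF s, of i] by (auto simp: f_def g_def)
    qed
  qed
qed

lemma exc_weight_coeff:
  "exc_weight p t n = (\<Sum>j\<le>n. t ^ j * poly (maj_exc_coeff n j) p)"
proof -
  have coeff: "poly (maj_exc_coeff n j) p = (\<Sum>\<sigma> | \<sigma> permutes {1..n}. if exc n \<sigma> = j then p ^ maj n \<sigma> else 0)" for j
    unfolding maj_exc_coeff_def maj_exc_poly_def coeff_sum poly_sum
    by (intro sum.cong) (auto simp: poly_monom)
  have le: "exc n \<sigma> \<le> n" for \<sigma>
  proof -
    have "exc n \<sigma> \<le> card {1..n - 1}"
      unfolding exc_def by (rule card_mono) auto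
    then show ?thesis by simp
  qed
  have "(\<Sum>j\<le>n. t ^ j * poly (maj_exc_coeff n j) p) =
      (\<Sum>\<sigma> | \<sigma> permutes {1..n}. \<Sum>j\<le>n. if exc n \<sigma> = j then t ^ j * p ^ maj n \<sigma> else 0)"
    unfolding coeff sum_distrib_left by (subst sum.swap) (auto intro!: sum.cong)
  also have "\<dots> = (\<Sum>\<sigma> | \<sigma> permutes {1..n}. t ^ exc n \<sigma> * p ^ maj n \<sigma>)"
    using le by (intro sum.cong) auto
  finally show ?thesis
    unfolding exc_weight_eq_maj_exc ..
qed

section \<open>Acyclicity of order complexes\<close>

lemma poly_mapping_sum_monomials:
  "(\<Sum>k\<in>Poly_Mapping.keys f. Poly_Mapping.single k (Poly_Mapping.lookup f k)) = f"
proof (rule poly_mapping_eqI)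
  fix k
  have "Poly_Mapping.lookup (\<Sum>k\<in>Poly_Mapping.keys f. Poly_Mapping.single k (Poly_Mapping.lookup f k)) k =
      (\<Sum>l\<in>Poly_Mapping.keys f. if l = k then Poly_Mapping.lookup f k else 0)"
    unfolding lookup_sum by (intro sum.cong) (auto simp: lookup_single when_def)
  also have "\<dots> = Poly_Mapping.lookup f k"
    by (auto simp: in_keys_iff)
  finally show "Poly_Mapping.lookup (\<Sum>k\<in>Poly_Mapping.keys f. Poly_Mapping.single k (Poly_Mapping.lookup f k)) k =
      Poly_Mapping.lookup f k" .
qed

lemma chain_induct [case_names single sum]:
  fixes f :: "'a \<Rightarrow>\<^sub>0 'b::ab_group_add"
  assumes single: "\<And>k v. P (Poly_Mapping.single k v)" and sum: "\<And>f g. P f \<Longrightarrow> P g \<Longrightarrow> P (f + g)"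
  shows "P f"
proof -
  have "P (\<Sum>k\<in>A. Poly_Mapping.single k (Poly_Mapping.lookup f k))" if "finite A" for A
    using that
  proof (induction A rule: finite_induct)
    case empty
    then show ?case
      using single[of undefined 0] by simp
  qed (simp add: single sum)
  from this[of "Poly_Mapping.keys f"] show ?thesis
    by (simp add: poly_mapping_sum_monomials)
qed

lemma boundary_single:
  "boundary (Poly_Mapping.single xs v) =
    (\<Sum>i<length xs. Poly_Mapping.single (take i xs @ drop (Suc i) xs) ((-1) ^ i * v))"
  by (cases "v = 0") (simp_all add: boundary_def)

lemma boundary_0 [simp]: "boundary 0 = 0"
  by (simp add: boundary_def)

lemma boundary_plus: "boundary (f + g) = boundary f + boundary g"
  unfolding boundary_def
  by (rule Poly_Mapping.setsum_keys_plus_distrib)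
     (simp_all add: distrib_left single_add sum.distrib)

lemma boundary_uminus: "boundary (- f) = - boundary f"
  using boundary_plus[of f "- f"] by (simp add: eq_neg_iff_add_eq_0 add.commute)

lemma boundary_minus: "boundary (f - g) = boundary f - boundary g"
  using boundary_plus[of f "- g"] by (simp add: boundary_uminus)

definition cons_chain :: "'a \<Rightarrow> ('a list \<Rightarrow>\<^sub>0 complex) \<Rightarrow> ('a list \<Rightarrow>\<^sub>0 complex)" where
  "cons_chain x c = (\<Sum>xs\<in>Poly_Mapping.keys c. Poly_Mapping.single (x # xs) (Poly_Mapping.lookup c xs))"

lemma cons_chain_single [simp]: "cons_chain x (Poly_Mapping.single xs v) = Poly_Mapping.single (x # xs) v"
  by (cases "v = 0") (simp_all add: cons_chain_def)

lemma cons_chain_plus: "cons_chain x (f + g) = cons_chain x f + cons_chain x g"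
  unfolding cons_chain_def
  by (rule Poly_Mapping.setsum_keys_plus_distrib) (simp_all add: single_add)

lemma cons_chain_0 [simp]: "cons_chain x 0 = 0"
  by (simp add: cons_chain_def)

lemma cons_chain_uminus: "cons_chain x (- f) = - cons_chain x f"
  using cons_chain_plus[of x f "- f"] by (simp add: eq_neg_iff_add_eq_0 add.commute)

lemma cons_chain_sum: "cons_chain x (sum f A) = (\<Sum>a\<in>A. cons_chain x (f a))"
  by (induction A rule: infinite_finite_induct) (simp_all add: cons_chain_plus)

lemma keys_cons_chain: "Poly_Mapping.keys (cons_chain x c) \<subseteq> (#) x ` Poly_Mapping.keys c"
  unfolding cons_chain_def
  by (rule order_trans[OF Poly_Mapping.keys_sum]) (auto split: if_splits)

text \<open>Deleting \<open>x\<close> gives back \<open>c\<close>; every other face is shifted by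
  one place and changes sign. So coning is a contracting homotopy, here for arbitrary lists, whether
  or not they are chains.\<close>

lemma boundary_cons_chain: "boundary (cons_chain x c) = c - cons_chain x (boundary c)"
proof (induction c rule: chain_induct)
  case (single xs v)
  have "boundary (cons_chain x (Poly_Mapping.single xs v)) = Poly_Mapping.single xs v +
      (\<Sum>i<length xs. Poly_Mapping.single (x # take i xs @ drop (Suc i) xs) (- ((-1) ^ i * v)))"
    by (simp add: boundary_single sum.lessThan_Suc_shift del: sum.lessThan_Suc)
  also have "(\<Sum>i<length xs. Poly_Mapping.single (x # take i xs @ drop (Suc i) xs) (- ((-1) ^ i * v))) =
      - cons_chain x (boundary (Poly_Mapping.single xs v))"
    by (simp add: boundary_single cons_chain_sum single_uminus sum_negf)
  finally show ?case by simp
next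
  case (sum f g)
  then show ?case
    by (simp add: cons_chain_plus boundary_plus)
qed

text \<open>A list is the cone over its tail, so two uses of the cone formula reduce the claim to
  the tail; no cancellation in a double sum is needed.\<close>

lemma boundary_boundary: "boundary (boundary c) = 0"
proof (induction c rule: chain_induct)
  case (single xs v)
  show ?case
  proof (induction xs)
    case Nil
    then show ?case by (simp add: boundary_single)
  next
    case (Cons x xs)
    then show ?case
      using boundary_cons_chain[of x "Poly_Mapping.single xs v"]
        boundary_cons_chain[of x "boundary (Poly_Mapping.single xs v)"]
      by (simp add: boundary_minus)
  qed
qed (simp add: boundary_plus)

lemma keys_boundary:
  "Poly_Mapping.keys (boundary c) \<subseteq> (\<Union>xs\<in>Poly_Mapping.keys c. (\<lambda>i. take i xs @ drop (Suc i) xs) ` {..<length xs})"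
  unfolding boundary_def
proof (rule order_trans[OF Poly_Mapping.keys_sum], rule UN_mono[OF subset_refl])
  fix xs assume "xs \<in> Poly_Mapping.keys c"
  show "Poly_Mapping.keys (\<Sum>i<length xs. Poly_Mapping.single (take i xs @ drop (Suc i) xs)
      ((-1) ^ i * Poly_Mapping.lookup c xs)) \<subseteq> (\<lambda>i. take i xs @ drop (Suc i) xs) ` {..<length xs}"
    by (rule order_trans[OF Poly_Mapping.keys_sum]) (auto split: if_splits)
qed

definition list_chains :: "('a \<Rightarrow> 'a \<Rightarrow> bool) \<Rightarrow> 'a set \<Rightarrow> nat \<Rightarrow> 'a list set" where
  "list_chains lt A m = {xs. sorted_wrt lt xs \<and> set xs \<subseteq> A \<and> length xs = m}"

definition chain_group :: "('a \<Rightarrow> 'a \<Rightarrow> bool) \<Rightarrow> 'a set \<Rightarrow> nat \<Rightarrow> ('a list \<Rightarrow>\<^sub>0 complex) set" where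
  "chain_group lt A m = {c. Poly_Mapping.keys c \<subseteq> list_chains lt A m}"

lemma chain_group_plus: "f \<in> chain_group lt A m \<Longrightarrow> g \<in> chain_group lt A m \<Longrightarrow> f + g \<in> chain_group lt A m"
  unfolding chain_group_def using Poly_Mapping.keys_add[of f g] by blast

lemma chain_group_uminus: "f \<in> chain_group lt A m \<Longrightarrow> - f \<in> chain_group lt A m"
  unfolding chain_group_def by simp

lemma chain_group_minus: "f \<in> chain_group lt A m \<Longrightarrow> g \<in> chain_group lt A m \<Longrightarrow> f - g \<in> chain_group lt A m"
  using chain_group_plus[of f lt A m "- g"] chain_group_uminus[of g] by simp

lemma chain_group_mono: "A \<subseteq> B \<Longrightarrow> chain_group lt A m \<subseteq> chain_group lt B m"
  unfolding chain_group_def list_chains_def by blast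

lemma sorted_wrt_remove_nth: "sorted_wrt lt xs \<Longrightarrow> sorted_wrt lt (take i xs @ drop (Suc i) xs)"
proof -
  assume "sorted_wrt lt xs"
  then have "sorted_wrt lt (take i xs @ drop i xs)"
    by simp
  then show ?thesis
    unfolding sorted_wrt_append using sorted_wrt_drop[of lt "drop i xs" 1]
    by (auto dest: in_set_dropD[of _ 1 "drop i xs", simplified])
qed

lemma set_remove_nth: "set (take i xs @ drop (Suc i) xs) \<subseteq> set xs"
  using set_take_subset[of i xs] set_drop_subset[of "Suc i" xs] by auto

lemma boundary_chain_group: "c \<in> chain_group lt A (Suc m) \<Longrightarrow> boundary c \<in> chain_group lt A m"
  unfolding chain_group_def
proof safe
  fix ys assume c: "Poly_Mapping.keys c \<subseteq> list_chains lt A (Suc m)" and "ys \<in> Poly_Mapping.keys (boundary c)"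
  then obtain xs i where "xs \<in> Poly_Mapping.keys c" "i < length xs" and ys: "ys = take i xs @ drop (Suc i) xs"
    using keys_boundary[of c] by blast
  then have xs: "xs \<in> list_chains lt A (Suc m)" "i < length xs"
    using c by auto
  have "set ys \<subseteq> A"
    using set_remove_nth[of i xs] xs unfolding ys list_chains_def by blast
  then show "ys \<in> list_chains lt A m"
    using xs sorted_wrt_remove_nth[of lt xs i] unfolding ys list_chains_def by auto
qed

lemma boundary_chain_group_0: "c \<in> chain_group lt A 0 \<Longrightarrow> boundary c = 0"
  unfolding chain_group_def list_chains_def boundary_def by (auto intro!: sum.neutral)

text \<open>Lengths of chains are used instead of dimensions, so \<open>m\<close> belongs to homological degree \<open>m - 1\<close>.\<close>

definition acyclic_below :: "('a \<Rightarrow> 'a \<Rightarrow> bool) \<Rightarrow> 'a set \<Rightarrow> nat \<Rightarrow> bool" where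
  "acyclic_below lt A e \<longleftrightarrow>
    (\<forall>m<e. \<forall>c\<in>chain_group lt A m. boundary c = 0 \<longrightarrow> (\<exists>b\<in>chain_group lt A (Suc m). boundary b = c))"

lemma chain_split:
  fixes c :: "'a \<Rightarrow>\<^sub>0 'b::comm_monoid_add"
  obtains c1 c2 where "c = c1 + c2" "Poly_Mapping.keys c1 = {k \<in> Poly_Mapping.keys c. P k}"
    "Poly_Mapping.keys c2 = {k \<in> Poly_Mapping.keys c. \<not> P k}"
proof -
  define r where "r P = (\<Sum>k\<in>{k \<in> Poly_Mapping.keys c. P k}. Poly_Mapping.single k (Poly_Mapping.lookup c k))" for P
  have lookup: "Poly_Mapping.lookup (r P) k = (if P k then Poly_Mapping.lookup c k else 0)" for P k
  proof -
    have "Poly_Mapping.lookup (r P) k = (\<Sum>l\<in>{k \<in> Poly_Mapping.keys c. P k}. if l = k then Poly_Mapping.lookup c k else 0)"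
      unfolding r_def lookup_sum by (intro sum.cong) (auto simp: lookup_single when_def)
    also have "\<dots> = (if P k then Poly_Mapping.lookup c k else 0)"
      by (auto simp: in_keys_iff)
    finally show ?thesis .
  qed
  show ?thesis
  proof (rule that[of "r P" "r (\<lambda>k. \<not> P k)"])
    show "c = r P + r (\<lambda>k. \<not> P k)"
      by (rule poly_mapping_eqI) (simp add: lookup lookup_add)
  qed (auto simp: in_keys_iff lookup split: if_splits)
qed

text \<open>Coning all of \<open>c\<close> would repeat \<open>x\<close>, so \<open>c\<close> is
  split into \<open>c1\<close>, avoiding \<open>x\<close>, and the cone over \<open>c2\<close>. The
  cycle condition equates \<open>boundary c1 + c2\<close>, free of \<open>x\<close>, with a cone
  over \<open>x\<close>; both vanish, and the cone over \<open>c1\<close> has boundary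
  \<open>c\<close>.\<close>

lemma acyclic_below_cone:
  assumes lt: "transp lt" "irreflp lt" and x: "x \<in> A" "\<And>y. y \<in> A \<Longrightarrow> y = x \<or> lt x y"
  shows "acyclic_below lt A e"
  unfolding acyclic_below_def
proof (intro allI ballI impI)
  fix m c assume c: "c \<in> chain_group lt A m" and cyc: "boundary c = 0"
  obtain c1 d where cd: "c = c1 + d" "Poly_Mapping.keys c1 = {k \<in> Poly_Mapping.keys c. x \<notin> set k}"
    "Poly_Mapping.keys d = {k \<in> Poly_Mapping.keys c. \<not> x \<notin> set k}"
    by (rule chain_split)
  define c2 where "c2 = (\<Sum>k\<in>Poly_Mapping.keys d. Poly_Mapping.single (tl k) (Poly_Mapping.lookup d k))"
  have lt_asym: "\<not> lt y x" if "y \<in> A" for y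
    using x(2)[OF that] lt by (metis irreflpD transpD)
  have key_d: "\<exists>ys. k = x # ys \<and> x \<notin> set ys" if "k \<in> Poly_Mapping.keys d" for k
  proof -
    have k: "x \<in> set k" "sorted_wrt lt k" "set k \<subseteq> A"
      using that c cd(3) unfolding chain_group_def list_chains_def by auto
    then obtain y ys where ys: "k = y # ys" by (cases k) auto
    then have "y = x"
      using k lt_asym[of y] by auto
    moreover have "x \<notin> set ys"
      using k lt(2) ys \<open>y = x\<close> by (auto dest: irreflpD)
    ultimately show ?thesis using ys by simp
  qed
  have d: "d = cons_chain x c2"
  proof -
    have "cons_chain x c2 = (\<Sum>k\<in>Poly_Mapping.keys d. Poly_Mapping.single (x # tl k) (Poly_Mapping.lookup d k))"
      unfolding c2_def cons_chain_sum by simp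
    also have "\<dots> = (\<Sum>k\<in>Poly_Mapping.keys d. Poly_Mapping.single k (Poly_Mapping.lookup d k))"
      by (rule sum.cong) (auto dest: key_d)
    also have "\<dots> = d"
      by (simp add: poly_mapping_sum_monomials)
    finally show ?thesis ..
  qed
  have x_c2: "x \<notin> set k" if "k \<in> Poly_Mapping.keys c2" for k
  proof -
    have "Poly_Mapping.keys c2 \<subseteq> tl ` Poly_Mapping.keys d"
      unfolding c2_def by (rule order_trans[OF Poly_Mapping.keys_sum]) (auto split: if_splits)
    then show ?thesis
      using that key_d by fastforce
  qed
  have x_c1: "x \<notin> set k" if "k \<in> Poly_Mapping.keys (boundary c1)" for k
    using that keys_boundary[of c1] cd(2) set_remove_nth by fastforce
  have "boundary c1 + c2 = cons_chain x (boundary c2)"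
    using cyc unfolding cd(1) boundary_plus d boundary_cons_chain by (simp add: algebra_simps)
  moreover have "Poly_Mapping.keys (boundary c1 + c2) \<inter> Poly_Mapping.keys (cons_chain x (boundary c2)) = {}"
    using Poly_Mapping.keys_add[of "boundary c1" c2] x_c1 x_c2 keys_cons_chain[of x "boundary c2"] by fastforce
  ultimately have "Poly_Mapping.keys (boundary c1 + c2) = {}"
    by simp
  then have "boundary c1 = - c2"
    by (simp add: eq_neg_iff_add_eq_0)
  then have "boundary (cons_chain x c1) = c"
    unfolding boundary_cons_chain cd(1) d by (simp add: cons_chain_uminus)
  moreover have "cons_chain x c1 \<in> chain_group lt A (Suc m)"
    unfolding chain_group_def
  proof safe
    fix k assume "k \<in> Poly_Mapping.keys (cons_chain x c1)"
    then obtain ys where ys: "k = x # ys" "ys \<in> Poly_Mapping.keys c1"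
      using keys_cons_chain[of x c1] by blast
    then have "x \<notin> set ys" "ys \<in> list_chains lt A m"
      using cd(2) c unfolding chain_group_def by auto
    then show "k \<in> list_chains lt A (Suc m)"
      using x unfolding list_chains_def ys by auto
  qed
  ultimately show "\<exists>b\<in>chain_group lt A (Suc m). boundary b = c" ..
qed

text \<open>Mayer-Vietoris on the level of chains: \<open>split\<close> says that the order complex
  of the union is the union of the order complexes. The common boundary of the two parts of a cycle
  lies in the intersection, one degree lower, which is why \<open>e\<close> suffices there.\<close>

lemma acyclic_below_Un:
  assumes split: "\<And>xs. sorted_wrt lt xs \<Longrightarrow> set xs \<subseteq> A \<union> B \<Longrightarrow> set xs \<subseteq> A \<or> set xs \<subseteq> B"
  assumes A: "acyclic_below lt A (Suc e)" and B: "acyclic_below lt B (Suc e)" and AB: "acyclic_below lt (A \<inter> B) e"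
  shows "acyclic_below lt (A \<union> B) (Suc e)"
  unfolding acyclic_below_def
proof (intro allI ballI impI)
  fix m c assume m: "m < Suc e" and c: "c \<in> chain_group lt (A \<union> B) m" and cyc: "boundary c = 0"
  obtain cA cB where cs: "c = cA + cB" "Poly_Mapping.keys cA = {k \<in> Poly_Mapping.keys c. set k \<subseteq> A}"
    "Poly_Mapping.keys cB = {k \<in> Poly_Mapping.keys c. \<not> set k \<subseteq> A}"
    by (rule chain_split)
  have cA: "cA \<in> chain_group lt A m"
    using c cs(2) unfolding chain_group_def list_chains_def by auto
  have cB: "cB \<in> chain_group lt B m"
    using c cs(3) split unfolding chain_group_def list_chains_def by blast
  have z: "boundary cA = - boundary cB"
    using cyc unfolding cs(1) boundary_plus by (simp add: eq_neg_iff_add_eq_0)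
  have "\<exists>d\<in>chain_group lt (A \<inter> B) m. boundary d = boundary cA"
  proof (cases m)
    case 0
    then have "boundary cA = 0"
      using cA boundary_chain_group_0 by blast
    then show ?thesis
      by (intro bexI[of _ 0]) (auto simp: chain_group_def)
  next
    case (Suc k)
    have "boundary cA \<in> chain_group lt A k" "boundary cA \<in> chain_group lt B k"
      using boundary_chain_group cA cB chain_group_uminus unfolding Suc z by (metis z)+
    then have "boundary cA \<in> chain_group lt (A \<inter> B) k"
      unfolding chain_group_def list_chains_def by blast
    moreover have "k < e"
      using m Suc by simp
    ultimately show ?thesis
      using AB boundary_boundary unfolding acyclic_below_def Suc by blast
  qed
  then obtain d where d: "d \<in> chain_group lt (A \<inter> B) m" "boundary d = boundary cA"
    by blast
  have dA: "d \<in> chain_group lt A m" and dB: "d \<in> chain_group lt B m"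
    using d(1) chain_group_mono[of "A \<inter> B" A lt m] chain_group_mono[of "A \<inter> B" B lt m] by auto
  have "boundary (cA - d) = 0" "boundary (cB + d) = 0"
    using d(2) z by (simp_all add: boundary_minus boundary_plus)
  then obtain a b where a: "a \<in> chain_group lt A (Suc m)" "boundary a = cA - d"
    and b: "b \<in> chain_group lt B (Suc m)" "boundary b = cB + d"
    using A B m chain_group_minus[OF cA dA] chain_group_plus[OF cB dB] unfolding acyclic_below_def by meson
  have "a + b \<in> chain_group lt (A \<union> B) (Suc m)"
    using a(1) b(1) chain_group_mono[of A "A \<union> B" lt "Suc m"] chain_group_mono[of B "A \<union> B" lt "Suc m"]
    by (intro chain_group_plus) auto
  moreover have "boundary (a + b) = c"
    unfolding boundary_plus a(2) b(2) cs(1) by simp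
  ultimately show "\<exists>b\<in>chain_group lt (A \<union> B) (Suc m). boundary b = c"
    by blast
qed

section \<open>Totally semimodular posets\<close>

text \<open>Finding \<open>w\<close> below an arbitrary common bound \<open>z\<close>, and not just
  below \<open>top\<close>, is what makes the semimodularity total. It ensures that two filters
  generated by covers of \<open>x\<close> intersect in a filter generated by elements two ranks
  above \<open>x\<close>.\<close>

locale semimodular_poset =
  fixes lt :: "'a \<Rightarrow> 'a \<Rightarrow> bool" and Q :: "'a set" and top :: 'a and rank :: "'a \<Rightarrow> nat"
  assumes lt_trans: "transp lt" and lt_irrefl: "irreflp lt" and finite_Q: "finite Q"
    and top: "top \<in> Q" "\<And>x. x \<in> Q \<Longrightarrow> x = top \<or> lt x top"
    and rank: "\<And>x y. x \<in> Q \<Longrightarrow> y \<in> Q \<Longrightarrow> lt x y \<Longrightarrow> rank x < rank y"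
    and semimodular: "\<And>x s y z. \<lbrakk>x \<in> Q; s \<in> Q; y \<in> Q; z \<in> Q; lt x s; lt x y; rank s = Suc (rank x);
      rank y = Suc (rank x); s \<noteq> y; s = z \<or> lt s z; y = z \<or> lt y z\<rbrakk> \<Longrightarrow>
      \<exists>w\<in>Q. lt s w \<and> lt y w \<and> rank w = Suc (rank y) \<and> (w = z \<or> lt w z)"
begin

definition cov :: "'a \<Rightarrow> 'a \<Rightarrow> bool" where
  "cov x y \<longleftrightarrow> x \<in> Q \<and> y \<in> Q \<and> lt x y \<and> rank y = Suc (rank x)"

definition up :: "'a set \<Rightarrow> 'a set" where
  "up S = {z \<in> Q. z \<noteq> top \<and> (\<exists>s\<in>S. s = z \<or> lt s z)}"

text \<open>If \<open>s = top\<close>, the bound is 0 and nothing is claimed; otherwise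
  \<open>s\<close> is the least element of \<open>up {s}\<close>, a cone.\<close>

lemma acyclic_up_single:
  assumes "cov x s"
  shows "acyclic_below lt (up {s}) (rank top - rank x - 1)"
proof (cases "s = top")
  case True
  then show ?thesis
    using assms by (simp add: acyclic_below_def cov_def)
next
  case False
  then show ?thesis
    using assms by (intro acyclic_below_cone[where x = s] lt_trans lt_irrefl) (auto simp: up_def cov_def)
qed

text \<open>
  By Mayer-Vietoris, adding the covers of \<open>x\<close> one by one: by semimodularity the filter of the new
  cover \<open>y\<close> meets the union of the previous filters in a filter generated by covers of \<open>y\<close>.
\<close>

theorem acyclic_up:
  assumes "finite S" "S \<noteq> {}" "\<And>s. s \<in> S \<Longrightarrow> cov x s"
  shows "acyclic_below lt (up S) (rank top - rank x - 1)"
  using assms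
proof (induction "rank top - rank x" arbitrary: x S rule: less_induct)
  case less
  show ?case
    using less.prems
  proof (induction S rule: finite_ne_induct)
    case (singleton s)
    then show ?case
      using acyclic_up_single by simp
  next
    case (insert y S)
    define T where "T = {w. cov y w \<and> (\<exists>s\<in>S. cov s w)}"
    have y: "cov x y" and S: "\<And>s. s \<in> S \<Longrightarrow> cov x s"
      using insert.prems by auto
    have cover: "\<exists>w\<in>T. w = z \<or> lt w z" if sz: "z \<in> Q" "s \<in> S" "s = z \<or> lt s z" "y = z \<or> lt y z" for s z
    proof -
      have "s \<noteq> y" using sz insert.hyps by auto
      then obtain w where w: "w \<in> Q" "lt s w" "lt y w" "rank w = Suc (rank y)" and wz: "w = z \<or> lt w z"
        using semimodular[of x s y z] sz y S[OF sz(2)] unfolding cov_def by metis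
      have "cov y w" "cov s w"
        using w y S[OF sz(2)] by (simp_all add: cov_def)
      then have "w \<in> T"
        using sz(2) unfolding T_def by blast
      then show ?thesis
        using wz by blast
    qed
    have "finite T"
      by (rule finite_subset[OF _ finite_Q]) (auto simp: T_def cov_def)
    obtain s where s: "s \<in> S" using insert.hyps by auto
    have "s \<in> Q" "y \<in> Q" using S[OF s] y by (auto simp: cov_def)
    then have "T \<noteq> {}"
      using cover[OF top(1) s] top(2) by blast
    then obtain w where "cov y w" by (auto simp: T_def)
    \<comment> \<open>The element \<open>w\<close> above \<open>y\<close> shows that
      \<open>y\<close> is not the top; therefore the differences of natural numbers below are
      exact.\<close>
    then have "rank y < rank top"
      using rank[of y top] top(1) top(2)[OF \<open>y \<in> Q\<close>] rank[of y w] rank[of w top] top(2)[of w] by (auto simp: cov_def)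
    moreover have "rank y = Suc (rank x)"
      using y by (simp add: cov_def)
    moreover define e where "e = rank top - rank y - 1"
    ultimately have e: "rank top - rank x - 1 = Suc e" "rank top - rank y - 1 = e"
      "rank top - rank y < rank top - rank x"
      by linarith+
    have inter: "up S \<inter> up {y} = up T"
    proof (intro Set.set_eqI iffI)
      fix z assume "z \<in> up S \<inter> up {y}"
      then show "z \<in> up T"
        using cover by (auto simp: up_def)
    next
      fix z assume "z \<in> up T"
      then obtain w s where "z \<in> Q" "z \<noteq> top" "w = z \<or> lt w z" "lt y w" "lt s w" "s \<in> S"
        by (auto simp: up_def T_def cov_def)
      then have "lt y z" "lt s z"
        using lt_trans by (auto dest: transpD)
      then show "z \<in> up S \<inter> up {y}"
        using \<open>z \<in> Q\<close> \<open>z \<noteq> top\<close> \<open>s \<in> S\<close> by (auto simp: up_def)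
    qed
    have "acyclic_below lt (up S \<union> up {y}) (Suc e)"
    proof (rule acyclic_below_Un)
      show "acyclic_below lt (up S) (Suc e)"
        using insert.IH S e(1) by simp
      show "acyclic_below lt (up {y}) (Suc e)"
        using acyclic_up_single[OF y] e(1) by simp
      show "acyclic_below lt (up S \<inter> up {y}) e"
        unfolding inter using less.hyps[OF e(3) \<open>finite T\<close> \<open>T \<noteq> {}\<close>] e(2) by (simp add: T_def)
      show "set xs \<subseteq> up S \<or> set xs \<subseteq> up {y}" if xs: "sorted_wrt lt xs" "set xs \<subseteq> up S \<union> up {y}" for xs
      proof (cases xs)
        case (Cons a ys)
        \<comment> \<open>Filters are closed upwards, so a chain lies in each filter that contains
          its least element \<open>a\<close>.\<close>
        have "b \<in> up R" if "a \<in> up R" "b \<in> set xs" for R b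
        proof -
          have "b = a \<or> lt a b" "b \<in> Q" "b \<noteq> top"
            using xs that(2) unfolding Cons by (auto simp: up_def)
          then show ?thesis
            using that(1) lt_trans by (auto simp: up_def dest: transpD)
        qed
        then show ?thesis
          using xs Cons by auto
      qed simp
    qed
    moreover have "up (insert y S) = up S \<union> up {y}"
      by (auto simp: up_def)
    ultimately show ?case
      using e(1) by simp
  qed
qed

end

section \<open>Dimension of the top homology\<close>

lemma field_complex_field: "field complex_field"
proof -
  interpret cring complex_field
    by (rule cringI, rule abelian_groupI, auto simp: complex_field_def algebra_simps comm_monoid_def
        comm_monoid_axioms_def monoid_def intro!: exI[of _ "- _"] intro: add.left_inverse)
  show ?thesis
    by (rule cring_fieldI2) (auto simp: complex_field_def intro: exI[of _ "inverse _"] right_inverse)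
qed

definition chain_space :: "'a list set \<Rightarrow> (complex, 'a list \<Rightarrow>\<^sub>0 complex) module" where
  "chain_space F = \<lparr>carrier = {c. Poly_Mapping.keys c \<subseteq> F}, mult = undefined, one = undefined, zero = 0,
     add = (+), module.smult = (\<lambda>a. Poly_Mapping.map ((*) a))\<rparr>"

lemma lookup_smult: "Poly_Mapping.lookup (Poly_Mapping.map ((*) a) c) k = a * Poly_Mapping.lookup c k" for a :: complex
  by (simp add: Poly_Mapping.map.rep_eq when_def)

lemma smult_single: "Poly_Mapping.map ((*) a) (Poly_Mapping.single k v) = Poly_Mapping.single k (a * v)" for a :: complex
  by (rule poly_mapping_eqI) (simp add: lookup_smult lookup_single when_def)

lemma smult_add: "Poly_Mapping.map ((*) a) (f + g) = Poly_Mapping.map ((*) a) f + Poly_Mapping.map ((*) a) g" for a :: complex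
  by (rule poly_mapping_eqI) (simp add: lookup_smult lookup_add distrib_left)

lemma vectorspace_chain_space: "vectorspace complex_field (chain_space F)"
proof -
  interpret K: field complex_field by (rule field_complex_field)
  have keys_smult: "Poly_Mapping.keys (Poly_Mapping.map ((*) a) c) \<subseteq> Poly_Mapping.keys c" for a :: complex and c :: "'a list \<Rightarrow>\<^sub>0 complex"
    by (auto simp: in_keys_iff lookup_smult)
  have "abelian_group (chain_space F)"
  proof (rule abelian_groupI)
    fix x y assume "x \<in> carrier (chain_space F)" "y \<in> carrier (chain_space F)"
    then show "x \<oplus>\<^bsub>chain_space F\<^esub> y \<in> carrier (chain_space F)"
      using Poly_Mapping.keys_add[of x y] by (auto simp: chain_space_def)
  next
    fix x assume "x \<in> carrier (chain_space F)"
    then show "\<exists>y\<in>carrier (chain_space F). y \<oplus>\<^bsub>chain_space F\<^esub> x = \<zero>\<^bsub>chain_space F\<^esub>"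
      by (intro bexI[of _ "- x"]) (auto simp: chain_space_def)
  qed (auto simp: chain_space_def add_ac)
  then have "module complex_field (chain_space F)"
  proof (intro moduleI K.is_cring)
    fix a x assume "x \<in> carrier (chain_space F)"
    then show "a \<odot>\<^bsub>chain_space F\<^esub> x \<in> carrier (chain_space F)"
      using keys_smult[of a x] by (auto simp: chain_space_def)
  qed (auto simp: chain_space_def complex_field_def smult_add intro!: poly_mapping_eqI simp: lookup_smult lookup_add algebra_simps)
  then show ?thesis
    by (simp add: vectorspace_def K.field_axioms)
qed

lemma finsum_chain_space:
  assumes "finite A" "f \<in> A \<rightarrow> carrier (chain_space F)"
  shows "finsum (chain_space F) f A = sum f A"
proof -
  interpret V: vectorspace complex_field "chain_space F" by (rule vectorspace_chain_space)
  show ?thesis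
    using assms
  proof (induction A rule: finite_induct)
    case empty
    then show ?case by (simp add: V.finsum_empty) (simp add: chain_space_def)
  next
    case (insert a A)
    then show ?case
      by (simp add: V.finsum_insert Pi_def) (simp add: chain_space_def)
  qed
qed

lemma dim_chain_space:
  assumes "finite F"
  shows "vectorspace.fin_dim complex_field (chain_space F)" "vectorspace.dim complex_field (chain_space F) = card F"
proof -
  interpret V: vectorspace complex_field "chain_space F" by (rule vectorspace_chain_space)
  define \<delta> where "\<delta> k = Poly_Mapping.single k (1 :: complex)" for k :: "'a list"
  have inj: "inj_on \<delta> F"
    by (auto simp: inj_on_def \<delta>_def dest!: arg_cong[where f = Poly_Mapping.keys])
  have car: "\<delta> ` F \<subseteq> carrier (chain_space F)"
    by (auto simp: chain_space_def \<delta>_def)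
  have lincomb: "V.lincomb a (\<delta> ` G) = (\<Sum>k\<in>G. Poly_Mapping.single k (a (\<delta> k)))" if "G \<subseteq> F" for a G
  proof -
    have "finite G" using that assms finite_subset by blast
    have "V.lincomb a (\<delta> ` G) = (\<Sum>v\<in>\<delta> ` G. a v \<odot>\<^bsub>chain_space F\<^esub> v)"
      unfolding V.lincomb_def
      by (rule finsum_chain_space) (use \<open>finite G\<close> that in \<open>auto simp: chain_space_def \<delta>_def smult_single split: if_splits\<close>)
    also have "\<dots> = (\<Sum>k\<in>G. a (\<delta> k) \<odot>\<^bsub>chain_space F\<^esub> \<delta> k)"
      using inj_on_subset[OF inj that] by (subst sum.reindex) auto
    finally show ?thesis
      by (simp add: chain_space_def \<delta>_def smult_single)
  qed
  have gen: "V.gen_set (\<delta> ` F)"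
  proof
    show "V.span (\<delta> ` F) \<subseteq> carrier (chain_space F)"
      using car by (rule V.span_is_subset2)
    show "carrier (chain_space F) \<subseteq> V.span (\<delta> ` F)"
    proof
      fix c assume c: "c \<in> carrier (chain_space F)"
      \<comment> \<open>Coefficients in \<open>lincomb\<close> are indexed by vectors; on
        \<open>\<delta> k\<close>, whose only key is \<open>k\<close>, this gives the coefficient of
        \<open>c\<close> at \<open>k\<close>.\<close>
      define a where "a v = (\<Sum>k\<in>Poly_Mapping.keys v. Poly_Mapping.lookup c k)" for v :: "'a list \<Rightarrow>\<^sub>0 complex"
      have "V.lincomb a (\<delta> ` F) = (\<Sum>k\<in>F. Poly_Mapping.single k (Poly_Mapping.lookup c k))"
        unfolding lincomb[OF subset_refl] by (simp add: a_def \<delta>_def)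
      also have "\<dots> = (\<Sum>k\<in>Poly_Mapping.keys c. Poly_Mapping.single k (Poly_Mapping.lookup c k))"
        by (rule sum.mono_neutral_right) (use c assms in \<open>auto simp: chain_space_def in_keys_iff\<close>)
      also have "\<dots> = c"
        by (rule poly_mapping_sum_monomials)
      finally show "c \<in> V.span (\<delta> ` F)"
        using assms car by (subst V.finite_span) (auto simp: complex_field_def intro!: exI[of _ a])
    qed
  qed
  have li: "V.lin_indpt (\<delta> ` F)"
  proof
    assume "V.lin_dep (\<delta> ` F)"
    then obtain A a v where A: "A \<subseteq> \<delta> ` F" "V.lincomb a A = \<zero>\<^bsub>chain_space F\<^esub>" "v \<in> A" "a v \<noteq> \<zero>\<^bsub>complex_field\<^esub>"
      unfolding V.lin_dep_def by blast
    then obtain G where G: "A = \<delta> ` G" "G \<subseteq> F"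
      by (meson subset_image_iff)
    then obtain k where k: "k \<in> G" "v = \<delta> k"
      using A(3) by auto
    have "finite G" using G assms finite_subset by blast
    have "0 = Poly_Mapping.lookup (\<Sum>k\<in>G. Poly_Mapping.single k (a (\<delta> k))) k"
      using A(2) unfolding G(1) lincomb[OF G(2)] by (simp add: chain_space_def)
    also have "\<dots> = (\<Sum>l\<in>G. if l = k then a (\<delta> k) else 0)"
      unfolding lookup_sum by (intro sum.cong) (auto simp: lookup_single when_def)
    also have "\<dots> = a v"
      using \<open>finite G\<close> k by simp
    finally show False
      using A(4) by (simp add: complex_field_def)
  qed
  have basis: "V.basis (\<delta> ` F)"
    unfolding V.basis_def using gen li car by blast
  show "V.fin_dim"
    unfolding V.fin_dim_def using gen car assms by blast
  show "V.dim = card F"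
    using V.dim_basis[OF _ basis] assms card_image[OF inj] by simp
qed

text \<open>Independent subsets of \<open>W\<close> stay independent in the whole space, which
  bounds their size; a maximal one is a basis of \<open>W\<close>.\<close>

lemma (in vectorspace) subspace_fin_dim:
  assumes "subspace K W V" "fin_dim"
  shows "vectorspace.fin_dim K (vs W)"
proof -
  interpret W: vectorspace K "vs W"
    using assms(1) by (rule subspace_is_vs)
  have WV: "W \<subseteq> carrier V"
    using assms(1) unfolding subspace_def submodule_def by auto
  have small: "finite A \<and> card A \<le> dim" if "A \<subseteq> W" "W.lin_indpt A" for A
  proof -
    have "lin_indpt A"
      using span_li_not_depend(2)[OF that(1) is_module[OF assms(1)]] that(2) by simp
    then show ?thesis
      using li_le_dim[of A] that WV assms(2) by auto
  qed
  obtain A where A: "finite A" "maximal A (\<lambda>S. S \<subseteq> carrier (vs W) \<and> W.lin_indpt S)"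
  proof -
    have "\<exists>A. finite A \<and> maximal A (\<lambda>S. S \<subseteq> carrier (vs W) \<and> W.lin_indpt S)"
      by (rule maximal_exists[where N = dim and B = "{}"]) (use small in \<open>auto simp: W.lin_dep_def\<close>)
    then show ?thesis using that by blast
  qed
  then have "W.basis A"
    by (intro W.max_li_is_basis) auto
  then show ?thesis
    using A(1) unfolding W.fin_dim_def W.basis_def by blast
qed

lemma dim_zero_space:
  assumes "vectorspace K V" "carrier V = {\<zero>\<^bsub>V\<^esub>}"
  shows "vectorspace.dim K V = 0"
proof -
  interpret vectorspace K V by fact
  have "span {} = carrier V"
    using assms(2) by (subst finite_span) auto
  then show ?thesis
    using gen_ge_dim[of "{}"] by simp
qed

lemma boundary_smult: "boundary (Poly_Mapping.map ((*) a) c) = Poly_Mapping.map ((*) a) (boundary c)"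
proof (induction c rule: chain_induct)
  case (single xs v)
  have smult_sum: "Poly_Mapping.map ((*) a) (sum f A) = (\<Sum>i\<in>A. Poly_Mapping.map ((*) a) (f i))"
    for f :: "nat \<Rightarrow> 'a list \<Rightarrow>\<^sub>0 complex" and A
    by (rule poly_mapping_eqI) (simp add: lookup_smult lookup_sum sum_distrib_left)
  show ?case
    unfolding smult_single boundary_single smult_sum by (simp add: mult.left_commute)
qed (simp add: smult_add boundary_plus)

lemma linear_map_boundary:
  assumes "\<And>c. Poly_Mapping.keys c \<subseteq> F \<Longrightarrow> Poly_Mapping.keys (boundary c) \<subseteq> G"
  shows "linear_map complex_field (chain_space F) (chain_space G) boundary"
proof -
  interpret V: vectorspace complex_field "chain_space F" by (rule vectorspace_chain_space)
  interpret W: vectorspace complex_field "chain_space G" by (rule vectorspace_chain_space)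
  show ?thesis
    using assms
    by unfold_locales (auto simp: module_hom_def chain_space_def boundary_plus boundary_smult)
qed

lemma finite_list_chains: "finite A \<Longrightarrow> finite (list_chains lt A m)"
  by (rule finite_subset[OF _ finite_lists_length_eq[of A m]]) (auto simp: list_chains_def)

lemma list_chains_0: "list_chains lt A 0 = {[]}"
  by (auto simp: list_chains_def)

lemma chain_group_eq: "chain_group lt A m = carrier (chain_space (list_chains lt A m))"
  by (simp add: chain_group_def chain_space_def)

definition cycle_space :: "('a \<Rightarrow> 'a \<Rightarrow> bool) \<Rightarrow> 'a set \<Rightarrow> nat \<Rightarrow> (complex, 'a list \<Rightarrow>\<^sub>0 complex) module" where
  "cycle_space lt A m = (chain_space (list_chains lt A m))
     \<lparr>carrier := {c \<in> carrier (chain_space (list_chains lt A m)). boundary c = 0}\<rparr>"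

lemma linear_map_boundary_chains:
  fixes A :: "'a set"
  shows "linear_map complex_field (chain_space (list_chains lt A (Suc m))) (chain_space (list_chains lt A m)) boundary"
proof (rule linear_map_boundary)
  fix c :: "'a list \<Rightarrow>\<^sub>0 complex" assume "Poly_Mapping.keys c \<subseteq> list_chains lt A (Suc m)"
  then show "Poly_Mapping.keys (boundary c) \<subseteq> list_chains lt A m"
    using boundary_chain_group[of c lt A m] by (simp add: chain_group_def)
qed

text \<open>The empty chain has boundary 0, but there is no lower chain space to map to, so length 0
  stands apart from the description by kernels.\<close>

lemma cycle_space_0: "cycle_space lt A 0 = chain_space (list_chains lt A 0)"
proof -
  have "{c \<in> carrier (chain_space (list_chains lt A 0)). boundary c = 0} = carrier (chain_space (list_chains lt A 0))"
    using boundary_chain_group_0[of _ lt A] by (auto simp: chain_group_eq)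
  then show ?thesis
    unfolding cycle_space_def by simp
qed

lemma cycle_space_Suc:
  "cycle_space lt A (Suc m) = (chain_space (list_chains lt A (Suc m)))\<lparr>carrier :=
     mod_hom.ker (chain_space (list_chains lt A (Suc m))) (chain_space (list_chains lt A m)) boundary\<rparr>"
proof -
  interpret linear_map complex_field "chain_space (list_chains lt A (Suc m))" "chain_space (list_chains lt A m)" boundary
    by (rule linear_map_boundary_chains)
  show ?thesis
    unfolding ker_def cycle_space_def by (simp add: chain_space_def)
qed

lemma cycle_space_fin_dim:
  assumes "finite A"
  shows "vectorspace complex_field (cycle_space lt A m)" "vectorspace.fin_dim complex_field (cycle_space lt A m)"
proof -
  have "vectorspace complex_field (cycle_space lt A m) \<and> vectorspace.fin_dim complex_field (cycle_space lt A m)"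
  proof (cases m)
    case 0
    then show ?thesis
      unfolding 0 cycle_space_0 using vectorspace_chain_space dim_chain_space(1) finite_list_chains[OF assms] by blast
  next
    case (Suc k)
    interpret linear_map complex_field "chain_space (list_chains lt A (Suc k))" "chain_space (list_chains lt A k)" boundary
      by (rule linear_map_boundary_chains)
    show ?thesis
      unfolding Suc cycle_space_Suc
      using V.subspace_is_vs[OF kerT_is_subspace] V.subspace_fin_dim[OF kerT_is_subspace]
        dim_chain_space(1)[OF finite_list_chains[OF assms]] by blast
  qed
  then show "vectorspace complex_field (cycle_space lt A m)" "vectorspace.fin_dim complex_field (cycle_space lt A m)"
    by auto
qed

text \<open>Rank-nullity for the boundary map: acyclicity makes its image the full space of
  cycles.\<close>

lemma dim_cycle_space_Suc:
  assumes "finite A" "acyclic_below lt A e" "m < e"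
  shows "vectorspace.dim complex_field (cycle_space lt A m) + vectorspace.dim complex_field (cycle_space lt A (Suc m)) =
    card (list_chains lt A (Suc m))"
proof -
  interpret linear_map complex_field "chain_space (list_chains lt A (Suc m))" "chain_space (list_chains lt A m)" boundary
    by (rule linear_map_boundary_chains)
  have "boundary ` chain_group lt A (Suc m) = {c \<in> chain_group lt A m. boundary c = 0}"
    using assms(2,3) boundary_chain_group[of _ lt A m] boundary_boundary unfolding acyclic_below_def by blast
  then have "cycle_space lt A m = (chain_space (list_chains lt A m))\<lparr>carrier := imT\<rparr>"
    unfolding im_def cycle_space_def chain_group_eq by simp
  then show ?thesis
    unfolding cycle_space_Suc
    using rank_nullity dim_chain_space[OF finite_list_chains[OF assms(1)], of lt "Suc m"] by simp
qed

lemma dim_cycle_space: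
  assumes "finite A" "acyclic_below lt A e" "m \<le> e"
  shows "(-1) ^ m * real (vectorspace.dim complex_field (cycle_space lt A m)) =
    (\<Sum>k\<le>m. (-1) ^ k * real (card (list_chains lt A k)))"
  using assms(3)
proof (induction m)
  case 0
  show ?case
    unfolding cycle_space_0 using dim_chain_space[OF finite_list_chains[OF assms(1)], of lt 0]
    by (simp add: list_chains_0)
next
  case (Suc m)
  then have "real (vectorspace.dim complex_field (cycle_space lt A (Suc m))) =
      real (card (list_chains lt A (Suc m))) - real (vectorspace.dim complex_field (cycle_space lt A m))"
    using dim_cycle_space_Suc[OF assms(1,2), of m] by simp
  then show ?case
    using Suc.IH Suc.prems by (simp add: right_diff_distrib)
qed

lemma dim_linear_iso:
  assumes V: "vectorspace K V" and V_fin: "vectorspace.fin_dim K V" and W: "vectorspace K W"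
    and img: "f ` carrier V = carrier W"
    and add: "\<And>x y. x \<in> carrier V \<Longrightarrow> y \<in> carrier V \<Longrightarrow> f (x \<oplus>\<^bsub>V\<^esub> y) = f x \<oplus>\<^bsub>W\<^esub> f y"
    and smult: "\<And>a x. a \<in> carrier K \<Longrightarrow> x \<in> carrier V \<Longrightarrow> f (a \<odot>\<^bsub>V\<^esub> x) = a \<odot>\<^bsub>W\<^esub> f x"
    and inj: "\<And>x. x \<in> carrier V \<Longrightarrow> f x = \<zero>\<^bsub>W\<^esub> \<Longrightarrow> x = \<zero>\<^bsub>V\<^esub>"
  shows "vectorspace.dim K W = vectorspace.dim K V"
proof -
  have "f \<in> module_hom K V W"
    using img add smult by (auto simp: module_hom_def)
  then interpret linear_map K V W f
    using V W by (auto simp: linear_map_def mod_hom_def mod_hom_axioms_def vectorspace_def)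
  have im: "W\<lparr>carrier := imT\<rparr> = W"
    unfolding im_def img by simp
  have "f \<zero>\<^bsub>V\<^esub> = \<zero>\<^bsub>W\<^esub>"
    by (rule f0_is_0)
  then have "kerT = {\<zero>\<^bsub>V\<^esub>}"
    using inj by (auto simp: ker_def)
  then have "vectorspace.dim K (V\<lparr>carrier := kerT\<rparr>) = 0"
    by (intro dim_zero_space V.subspace_is_vs kerT_is_subspace) simp
  then show ?thesis
    using rank_nullity[OF V_fin] unfolding im by simp
qed

text \<open>The cosets of the zero subspace are singletons, so \<open>x\<close> maps isomorphically
  to \<open>{x}\<close>.\<close>

lemma dim_quotient_zero:
  assumes "vectorspace K V" "vectorspace.fin_dim K V"
  shows "vectorspace.dim K (quotient_module V {\<zero>\<^bsub>V\<^esub>}) = vectorspace.dim K V"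
proof -
  interpret V: vectorspace K V by fact
  let ?Q = "quotient_module V {\<zero>\<^bsub>V\<^esub>}"
  have coset: "{\<zero>\<^bsub>V\<^esub>} +>\<^bsub>V\<^esub> x = {x}" if "x \<in> carrier V" for x
    using that by (simp add: a_r_coset_def')
  have car: "carrier ?Q = (\<lambda>x. {x}) ` carrier V"
    using coset by (auto simp: quotient_module_def A_RCOSETS_def')
  have add: "{x} \<oplus>\<^bsub>?Q\<^esub> {y} = {x \<oplus>\<^bsub>V\<^esub> y}" for x y
    by (simp add: quotient_module_def set_add_def')
  have zero: "\<zero>\<^bsub>?Q\<^esub> = {\<zero>\<^bsub>V\<^esub>}"
    by (simp add: quotient_module_def)
  have smult: "a \<odot>\<^bsub>?Q\<^esub> {x} = {a \<odot>\<^bsub>V\<^esub> x}" if "a \<in> carrier K" "x \<in> carrier V" for a x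
    using that by (simp add: quotient_module_def coset)
  have "abelian_group ?Q"
  proof (rule abelian_groupI)
    fix X assume "X \<in> carrier ?Q"
    then obtain x where "X = {x}" "x \<in> carrier V" by (auto simp: car)
    then show "\<exists>Y\<in>carrier ?Q. Y \<oplus>\<^bsub>?Q\<^esub> X = \<zero>\<^bsub>?Q\<^esub>"
      by (intro bexI[of _ "{\<ominus>\<^bsub>V\<^esub> x}"]) (auto simp: car add zero V.M.l_neg)
  qed (auto simp: car add zero V.M.a_ac)
  then have "module K ?Q"
    by (intro moduleI V.R.is_cring)
       (auto simp: car add zero smult V.smult_l_distr V.smult_r_distr V.smult_assoc1)
  then have Q: "vectorspace K ?Q"
    by (simp add: vectorspace_def V.field_axioms)
  show ?thesis
    by (rule dim_linear_iso[OF assms Q, of "\<lambda>x. {x}"]) (simp_all add: car add smult zero)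
qed

text \<open>Without chains of length \<open>Suc e\<close> the only boundary in degree
  \<open>e - 1\<close> is 0, so the homology there is the cycle space, and its dimension is an
  alternating sum of face numbers.\<close>

theorem dim_reduced_homology:
  fixes P :: "'a gorder" and e :: nat
  defines "F \<equiv> list_chains (\<lambda>x y. x \<sqsubset>\<^bsub>P\<^esub> y) (carrier P)"
  assumes fin: "finite (carrier P)" and acyc: "acyclic_below (\<lambda>x y. x \<sqsubset>\<^bsub>P\<^esub> y) (carrier P) e" and "F (Suc e) = {}"
  shows "(-1) ^ e * real (vectorspace.dim complex_field (reduced_homology P (int e - 1))) = (\<Sum>m\<le>e. (-1) ^ m * real (card (F m)))"
proof -
  have faces: "order_complex_faces P (int m - 1) = F m" for m
    by (auto simp: order_complex_faces_def poset_chains_def F_def list_chains_def)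
  have chains: "simplicial_chains P (int m - 1) = chain_space (F m)" for m
    by (simp add: simplicial_chains_def chain_space_def faces)
  have cycles: "simplicial_cycles P (int e - 1) = cycle_space (\<lambda>x y. x \<sqsubset>\<^bsub>P\<^esub> y) (carrier P) e"
    by (simp add: simplicial_cycles_def chains cycle_space_def F_def)
  have "simplicial_boundaries P (int e - 1) = {0}"
    using chains[of "Suc e"] \<open>F (Suc e) = {}\<close> by (simp add: simplicial_boundaries_def chain_space_def)
  also have "{0} = {\<zero>\<^bsub>cycle_space (\<lambda>x y. x \<sqsubset>\<^bsub>P\<^esub> y) (carrier P) e\<^esub>}"
    by (simp add: cycle_space_def chain_space_def)
  finally show ?thesis
    using dim_cycle_space[OF fin acyc order_refl] cycle_space_fin_dim[OF fin, of "\<lambda>x y. x \<sqsubset>\<^bsub>P\<^esub> y" e]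
    unfolding reduced_homology_def cycles F_def by (simp add: dim_quotient_zero)
qed

section \<open>The Rees product of the subspace lattice with a chain\<close>

lemma dim_insert_vec:
  fixes U :: "('a::field ^ 'n) set"
  assumes "vec.subspace U" "v \<notin> U"
  shows "vec.dim (vec.span (insert v U)) = Suc (vec.dim U)"
  using assms by (simp add: vec.dim_span vec.dim_insert vec.span_eq_iff[THEN iffD2])

lemma subspace_psubset_dim:
  fixes U V :: "('a::field ^ 'n) set"
  assumes "vec.subspace U" "vec.subspace V" "U \<subset> V"
  shows "vec.dim U < vec.dim V"
  using assms vec.subspace_dim_equal[of U V] vec.dim_subset[of U V] by fastforce

lemma subspace_dim_eq:
  fixes U V :: "('a::field ^ 'n) set"
  assumes "vec.subspace U" "vec.subspace V" "U \<subseteq> V" "vec.dim V \<le> vec.dim U"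
  shows "U = V"
  using assms subspace_psubset_dim[of U V] by auto

lemma subspace_between:
  fixes U V :: "('a::field ^ 'n) set"
  assumes "vec.subspace U" "vec.subspace V" "U \<subset> V"
  obtains W where "vec.subspace W" "U \<subseteq> W" "W \<subseteq> V" "vec.dim W = Suc (vec.dim U)"
proof -
  obtain v where v: "v \<in> V" "v \<notin> U" using assms by auto
  show ?thesis
  proof (rule that[of "vec.span (insert v U)"])
    show "vec.span (insert v U) \<subseteq> V"
      using v assms by (intro vec.span_minimal) auto
    show "U \<subseteq> vec.span (insert v U)"
      using vec.span_superset[of "insert v U"] by auto
  qed (use dim_insert_vec[OF assms(1) v(2)] in auto)
qed

text \<open>The sum of \<open>S\<close> and \<open>Y\<close> is spanned by \<open>S\<close> and one
  vector of \<open>Y\<close> outside \<open>S\<close>, because \<open>X\<close> and that vector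
  already span \<open>Y\<close> for reasons of dimension.\<close>

lemma subspace_join:
  fixes X S Y :: "('a::field ^ 'n) set"
  assumes "vec.subspace X" "vec.subspace S" "vec.subspace Y" "X \<subseteq> S" "X \<subseteq> Y"
    "vec.dim S = Suc (vec.dim X)" "vec.dim Y = Suc (vec.dim X)" "S \<noteq> Y"
  obtains W where "vec.subspace W" "S \<subseteq> W" "Y \<subseteq> W" "vec.dim W = Suc (Suc (vec.dim X))"
    "\<And>Z. vec.subspace Z \<Longrightarrow> S \<subseteq> Z \<Longrightarrow> Y \<subseteq> Z \<Longrightarrow> W \<subseteq> Z"
proof -
  have "\<not> Y \<subseteq> S"
    using subspace_dim_eq[of Y S] assms by auto
  then obtain y where y: "y \<in> Y" "y \<notin> S" by auto
  have "vec.span (insert y X) \<subseteq> Y"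
    using y assms by (intro vec.span_minimal) auto
  moreover have "vec.dim (vec.span (insert y X)) = Suc (vec.dim X)"
    using dim_insert_vec[of X y] y assms by auto
  ultimately have Y: "vec.span (insert y X) = Y"
    using subspace_dim_eq[of "vec.span (insert y X)" Y] assms by simp
  show ?thesis
  proof (rule that[of "vec.span (insert y S)"])
    show "S \<subseteq> vec.span (insert y S)"
      using vec.span_superset[of "insert y S"] by auto
    show "Y \<subseteq> vec.span (insert y S)"
      unfolding Y[symmetric] using assms by (intro vec.span_mono) auto
    show "vec.dim (vec.span (insert y S)) = Suc (Suc (vec.dim X))"
      using dim_insert_vec[OF assms(2) y(2)] assms by simp
    show "vec.span (insert y S) \<subseteq> Z" if "vec.subspace Z" "S \<subseteq> Z" "Y \<subseteq> Z" for Z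
      using that y by (intro vec.span_minimal) auto
  qed simp
qed

lemma dim_0_iff:
  fixes U :: "('a::field ^ 'n) set"
  assumes "vec.subspace U"
  shows "vec.dim U = 0 \<longleftrightarrow> U = {0}"
proof
  assume "vec.dim U = 0"
  then show "U = {0}"
    using subspace_dim_eq[of "{0}" U] assms vec.subspace_0[of U] by (auto simp: vec.subspace_single_0)
qed simp

text \<open>
  The order of the Rees product: $(U, i) \le (V, k)$ iff $U \subseteq V$ and
  $0 \le k - i \le \dim V - \dim U$.
\<close>

definition pair_le :: "('a::field ^ 'n) set \<times> nat \<Rightarrow> ('a ^ 'n) set \<times> nat \<Rightarrow> bool" where
  "pair_le x y \<longleftrightarrow> fst x \<subseteq> fst y \<and> snd x \<le> snd y \<and> snd y + vec.dim (fst x) \<le> snd x + vec.dim (fst y)"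

definition pair_lt :: "('a::field ^ 'n) set \<times> nat \<Rightarrow> ('a ^ 'n) set \<times> nat \<Rightarrow> bool" where
  "pair_lt x y \<longleftrightarrow> pair_le x y \<and> x \<noteq> y"

text \<open>Removing the zero subspace lowers ranks by one, so the rank condition of the Rees
  product becomes a strict inequality of dimensions, which also keeps the zero subspace out.\<close>

definition rees_pairs :: "(('a::field ^ 'n) set \<times> nat) set" where
  "rees_pairs = {(U, i). vec.subspace U \<and> i < vec.dim U}"

definition proper_ideal :: "('a::field ^ 'n) set \<times> nat \<Rightarrow> (('a ^ 'n) set \<times> nat) set" where
  "proper_ideal t = {x \<in> rees_pairs. pair_lt x t}"

lemma pair_le_trans: "pair_le x y \<Longrightarrow> pair_le y z \<Longrightarrow> pair_le x z"
  by (auto simp: pair_le_def)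

lemma pair_le_antisym: "pair_le x y \<Longrightarrow> pair_le y x \<Longrightarrow> x = y"
  by (auto simp: pair_le_def prod_eq_iff)

lemma transp_pair_lt: "transp pair_lt"
  unfolding transp_def pair_lt_def using pair_le_trans pair_le_antisym by blast

lemma irreflp_pair_lt: "irreflp pair_lt"
  by (auto simp: irreflp_def pair_lt_def)

lemma pair_lt_dim:
  assumes "vec.subspace (fst x)" "vec.subspace (fst y)" "pair_lt x y"
  shows "vec.dim (fst x) < vec.dim (fst y)"
proof (rule ccontr)
  assume "\<not> ?thesis"
  then have "fst x = fst y"
    using subspace_dim_eq[of "fst x" "fst y"] assms by (auto simp: pair_lt_def pair_le_def)
  then show False
    using assms(3) by (auto simp: pair_lt_def pair_le_def prod_eq_iff)
qed

lemma finite_vspace_pairs: "finite {x :: ('a::{field,finite} ^ 'n) set \<times> nat. snd x \<le> N}"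
proof -
  have "{x :: ('a ^ 'n) set \<times> nat. snd x \<le> N} = UNIV \<times> {..N}" by auto
  then show ?thesis by simp
qed

lemma finite_proper_ideal: "finite (proper_ideal (t :: ('a::{field,finite} ^ 'n) set \<times> nat))"
  by (rule finite_subset[OF _ finite_vspace_pairs[of "snd t"]]) (auto simp: proper_ideal_def pair_lt_def pair_le_def)

text \<open>With a bottom \<open>b\<close> added, the closed ideal of \<open>t\<close> is totally
  semimodular, ranked by the dimension of the subspace, and \<open>proper_ideal t\<close> is the
  filter \<open>up S\<close> generated by its atoms.\<close>

theorem acyclic_proper_ideal:
  fixes t :: "('a::{field,finite} ^ 'n) set \<times> nat"
  assumes t: "t \<in> rees_pairs"
  shows "acyclic_below pair_lt (proper_ideal t) (vec.dim (fst t) - 1)"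
proof -
  \<comment> \<open>The order formula also makes sense for the zero subspace, which supplies a least element.\<close>
  define b :: "('a ^ 'n) set \<times> nat" where "b = ({0}, 0)"
  define Q where "Q = insert b {x \<in> rees_pairs. pair_le x t}"
  have b_le: "pair_le b x" if "x \<in> rees_pairs" for x
    using that by (auto simp: b_def rees_pairs_def pair_le_def vec.subspace_0)
  have sub: "vec.subspace (fst x)" if "x \<in> Q" for x
    using that by (auto simp: Q_def b_def rees_pairs_def vec.subspace_single_0)
  have le_t: "pair_le x t" if "x \<in> Q" for x
    using that b_le[OF t] by (auto simp: Q_def)
  have pos: "snd x < vec.dim (fst x)" if "x \<in> Q" "vec.dim (fst x) > 0" for x
    using that by (auto simp: Q_def b_def rees_pairs_def)
  have QI: "x \<in> Q" if "vec.subspace (fst x)" "snd x < vec.dim (fst x)" "pair_le x t" for x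
    using that by (auto simp: Q_def rees_pairs_def)
  interpret semimodular_poset pair_lt Q t "\<lambda>x. vec.dim (fst x)"
  proof
    show "finite Q"
      by (rule finite_subset[OF _ finite_vspace_pairs[of "snd t"]]) (auto simp: Q_def b_def pair_le_def)
    show "t \<in> Q"
      using t by (simp add: Q_def pair_le_def)
    show "x = t \<or> pair_lt x t" if "x \<in> Q" for x
      using le_t[OF that] by (auto simp: pair_lt_def)
    show "vec.dim (fst x) < vec.dim (fst y)" if "x \<in> Q" "y \<in> Q" "pair_lt x y" for x y
      using pair_lt_dim sub that by blast
  next
    fix x s y z
    assume xQ: "x \<in> Q" and sQ: "s \<in> Q" and yQ: "y \<in> Q" and zQ: "z \<in> Q"
      and xs: "pair_lt x s" and xy: "pair_lt x y"
      and ds: "vec.dim (fst s) = Suc (vec.dim (fst x))" and dy: "vec.dim (fst y) = Suc (vec.dim (fst x))"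
      and ne: "s \<noteq> y" and sz: "s = z \<or> pair_lt s z" and yz: "y = z \<or> pair_lt y z"
    have sz': "pair_le s z" and yz': "pair_le y z"
      using sz yz by (auto simp: pair_lt_def pair_le_def)
    have xs': "pair_le x s" and xy': "pair_le x y"
      using xs xy by (auto simp: pair_lt_def)
    note le = sz'[unfolded pair_le_def] yz'[unfolded pair_le_def] xs'[unfolded pair_le_def] xy'[unfolded pair_le_def]
    have i: "snd s < vec.dim (fst s)" "snd y < vec.dim (fst y)"
      using pos[OF sQ] pos[OF yQ] ds dy by auto
    have "\<exists>W e. vec.subspace W \<and> vec.dim W = Suc (Suc (vec.dim (fst x))) \<and> fst s \<subseteq> W \<and> fst y \<subseteq> W \<and> W \<subseteq> fst z \<and>
        snd s \<le> e \<and> snd y \<le> e \<and> e \<le> Suc (snd s) \<and> e \<le> Suc (snd y) \<and> e \<le> snd z \<and>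
        snd z + vec.dim W \<le> e + vec.dim (fst z) \<and> e < vec.dim W"
    proof (cases "fst s = fst y")
      case True
      then have "snd s \<noteq> snd y"
        using ne by (auto simp: prod_eq_iff)
      then have "vec.dim (fst z) > vec.dim (fst s)"
        using le True ds dy by auto
      then have "fst s \<subset> fst z"
        using le by auto
      then obtain W where W: "vec.subspace W" "fst s \<subseteq> W" "W \<subseteq> fst z" "vec.dim W = Suc (vec.dim (fst s))"
        using subspace_between[OF sub[OF sQ] sub[OF zQ]] by blast
      \<comment> \<open>The second components of \<open>s\<close> and \<open>y\<close> differ by
        one, so the larger one is reached from both; the bound towards \<open>z\<close> follows from
        the inequality for the smaller one.\<close>
      show ?thesis
        by (rule exI[of _ W], rule exI[of _ "max (snd s) (snd y)"])
           (use W True le ds dy i \<open>snd s \<noteq> snd y\<close> in auto)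
    next
      case False
      obtain W where W: "vec.subspace W" "fst s \<subseteq> W" "fst y \<subseteq> W" "vec.dim W = Suc (Suc (vec.dim (fst x)))"
          "W \<subseteq> fst z"
        using subspace_join[OF sub[OF xQ] sub[OF sQ] sub[OF yQ] _ _ ds dy False] le sub[OF zQ] by metis
      have "vec.dim W \<le> vec.dim (fst z)"
        using W by (intro vec.dim_subset)
      \<comment> \<open>If \<open>s\<close> and \<open>y\<close> have equal second components, the
        climb to \<open>z\<close> may need every remaining dimension, so \<open>e\<close> is raised
        whenever \<open>z\<close> permits. If they differ, the inequality for the smaller one
        already gives the bound for the maximum.\<close>
      show ?thesis
        by (rule exI[of _ W], rule exI[of _ "if snd s = snd y \<and> snd z > snd s then Suc (snd s) else max (snd s) (snd y)"])
           (use W le ds dy i \<open>vec.dim W \<le> vec.dim (fst z)\<close> in auto)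
    qed
    then obtain W e where W: "vec.subspace W" "vec.dim W = Suc (Suc (vec.dim (fst x)))" "fst s \<subseteq> W" "fst y \<subseteq> W" "W \<subseteq> fst z"
        and e: "snd s \<le> e" "snd y \<le> e" "e \<le> Suc (snd s)" "e \<le> Suc (snd y)" "e \<le> snd z"
        "snd z + vec.dim W \<le> e + vec.dim (fst z)" "e < vec.dim W"
      by blast
    have wz: "pair_le (W, e) z"
      using W e by (simp add: pair_le_def)
    have "(W, e) \<in> Q"
      using W e pair_le_trans[OF wz le_t[OF zQ]] by (intro QI) auto
    moreover have "pair_lt s (W, e)" "pair_lt y (W, e)"
      using W e ds dy by (auto simp: pair_lt_def pair_le_def)
    ultimately show "\<exists>w\<in>Q. pair_lt s w \<and> pair_lt y w \<and> vec.dim (fst w) = Suc (vec.dim (fst y)) \<and> (w = z \<or> pair_lt w z)"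
      using W dy wz by (intro bexI[of _ "(W, e)"]) (auto simp: pair_lt_def)
  qed (rule transp_pair_lt irreflp_pair_lt)+
  define S where "S = {s. cov b s}"
  have "finite S"
    by (rule finite_subset[OF _ finite_Q]) (auto simp: S_def cov_def)
  have atom: "\<exists>s\<in>S. s = z \<or> pair_lt s z" if z: "z \<in> Q" "z \<in> rees_pairs" for z
  proof -
    have "snd z < vec.dim (fst z)"
      using z(2) by (auto simp: rees_pairs_def)
    then have "fst z \<noteq> {0}"
      using dim_0_iff[OF sub[OF z(1)]] by (metis less_nat_zero_code)
    then have "{0} \<subset> fst z"
      using vec.subspace_0[OF sub[OF z(1)]] by blast
    from subspace_between[OF vec.subspace_single_0 sub[OF z(1)] this]
    obtain W where W: "vec.subspace W" "{0} \<subseteq> W" "W \<subseteq> fst z" "vec.dim W = Suc (vec.dim ({0} :: ('a ^ 'n) set))" .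
    then have W: "vec.subspace W" "W \<subseteq> fst z" "vec.dim W = Suc 0"
      by simp_all
    \<comment> \<open>The strict bound \<open>snd z < vec.dim (fst z)\<close> is exactly the room
      needed to climb from second component 0 in dimension 1.\<close>
    have le: "pair_le (W, 0) z"
      using W z by (auto simp: pair_le_def rees_pairs_def)
    then have "(W, 0) \<in> Q"
      using pair_le_trans[OF le le_t[OF z(1)]] W by (intro QI) simp_all
    moreover have "pair_lt b (W, 0)"
      using W vec.subspace_0[OF W(1)] by (auto simp: b_def pair_lt_def pair_le_def)
    ultimately have "(W, 0) \<in> S"
      using W(3) unfolding S_def cov_def by (simp add: b_def Q_def)
    then show ?thesis
      using le by (auto simp: pair_lt_def)
  qed
  have "S \<noteq> {}"
    using atom[OF top(1) t] by auto
  have "up S = proper_ideal t"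
  proof (intro Set.set_eqI iffI)
    fix z assume "z \<in> up S"
    then obtain s where s: "z \<in> Q" "z \<noteq> t" "cov b s" "s = z \<or> pair_lt s z"
      by (auto simp: up_def S_def)
    then have "z \<noteq> b"
      using transp_pair_lt irreflp_pair_lt by (auto simp: cov_def dest: transpD irreflpD)
    then show "z \<in> proper_ideal t"
      using s by (auto simp: Q_def proper_ideal_def pair_lt_def)
  next
    fix z assume "z \<in> proper_ideal t"
    then have "z \<in> Q" "z \<noteq> t" "z \<in> rees_pairs"
      by (auto simp: Q_def proper_ideal_def pair_lt_def)
    then show "z \<in> up S"
      using atom by (auto simp: up_def)
  qed
  then show ?thesis
    using acyclic_up[OF \<open>finite S\<close> \<open>S \<noteq> {}\<close>, of b] by (simp add: S_def b_def)
qed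

section \<open>Ranks, covers and the order of the Rees product\<close>

text \<open>A strictly increasing map into \<open>m\<close> consecutive numbers bounds the size of
  every chain, and \<open>xs\<close> attains the bound.\<close>

lemma poset_length_eqI:
  fixes r :: "'a \<Rightarrow> nat"
  assumes mono: "\<And>x y. x \<in> carrier P \<Longrightarrow> y \<in> carrier P \<Longrightarrow> x \<sqsubset>\<^bsub>P\<^esub> y \<Longrightarrow> r x < r y"
    and range: "\<And>x. x \<in> carrier P \<Longrightarrow> r x \<in> {a..<a + m}"
    and chain: "xs \<in> poset_chains P" "length xs = m"
  shows "poset_length P = m - 1"
proof -
  have le: "length ys \<le> m" if "ys \<in> poset_chains P" for ys
  proof -
    have "sorted_wrt (\<lambda>x y. r x < r y) ys"
      by (rule sorted_wrt_mono_rel[of _ "\<lambda>x y. x \<sqsubset>\<^bsub>P\<^esub> y"]) (use that mono in \<open>auto simp: poset_chains_def subset_iff\<close>)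
    then have "sorted_wrt (<) (map r ys)"
      by (simp add: sorted_wrt_map)
    then have "distinct (map r ys)"
      by (simp add: strict_sorted_iff)
    then have "length ys = card (set (map r ys))"
      using distinct_card[of "map r ys"] by simp
    also have "\<dots> \<le> card {a..<a + m}"
      using range that by (intro card_mono) (auto simp: poset_chains_def)
    finally show ?thesis by simp
  qed
  have "Max (length ` poset_chains P) = m"
  proof (rule Max_eqI)
    show "finite (length ` poset_chains P)"
      by (rule finite_subset[of _ "{..m}"]) (use le in auto)
  qed (use le chain in auto)
  then show ?thesis
    by (simp add: poset_length_def)
qed

text \<open>The bound \<open>U\<close> is what the induction extends; it also provides subspaces of
  every smaller dimension. The zero subspace is left out of the flag so that it fits
  \<open>remove_bottom\<close>.\<close>

lemma flag_exists:
  fixes V :: "('a::field ^ 'n) set"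
  assumes V: "vec.subspace V" and k: "k \<le> vec.dim V"
  shows "\<exists>xs U. sorted_wrt (\<subset>) xs \<and> length xs = k \<and> (\<forall>W\<in>set xs. vec.subspace W \<and> W \<noteq> {0} \<and> W \<subseteq> U) \<and>
    vec.subspace U \<and> U \<subseteq> V \<and> vec.dim U = k"
  using k
proof (induction k)
  case 0
  show ?case
    using V vec.subspace_0[OF V] by (intro exI[of _ "[]"] exI[of _ "{0}"]) (auto simp: vec.subspace_single_0)
next
  case (Suc k)
  then obtain xs U where xs: "sorted_wrt (\<subset>) xs" "length xs = k" "\<forall>W\<in>set xs. vec.subspace W \<and> W \<noteq> {0} \<and> W \<subseteq> U"
    and U: "vec.subspace U" "U \<subseteq> V" "vec.dim U = k"
    by auto
  have "U \<noteq> V"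
    using U Suc.prems by auto
  then have "U \<subset> V"
    using U by simp
  from subspace_between[OF U(1) V this]
  obtain W where W: "vec.subspace W" "U \<subseteq> W" "W \<subseteq> V" "vec.dim W = Suc (vec.dim U)" .
  have "U \<noteq> W"
    using W(4) by auto
  moreover have "W \<noteq> {0}"
    using W dim_0_iff[OF W(1)] by simp
  moreover have "X \<subset> W" if "X \<in> set xs" for X
    using xs(3) that W(2) \<open>U \<noteq> W\<close> by blast
  ultimately have "sorted_wrt (\<subset>) (xs @ [W])" "length (xs @ [W]) = Suc k"
      "\<forall>X\<in>set (xs @ [W]). vec.subspace X \<and> X \<noteq> {0} \<and> X \<subseteq> W" "vec.dim W = Suc k"
    using xs U(3) W(1,4) unfolding sorted_wrt_append by (simp_all add: psubset_eq)
  then show ?case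
    using W(1,3) by blast
qed

lemma flag_obtain:
  fixes V :: "('a::field ^ 'n) set"
  assumes V: "vec.subspace V"
  obtains xs where "sorted_wrt (\<subset>) xs" "length xs = vec.dim V" "\<forall>W\<in>set xs. vec.subspace W \<and> W \<noteq> {0} \<and> W \<subseteq> V"
proof -
  obtain xs U where xs: "sorted_wrt (\<subset>) xs" "length xs = vec.dim V"
      "\<forall>W\<in>set xs. vec.subspace W \<and> W \<noteq> {0} \<and> W \<subseteq> U" "U \<subseteq> V"
    using flag_exists[OF V order_refl] by auto
  show ?thesis
    by (rule that[OF xs(1,2)]) (use xs(3,4) in blast)
qed

lemma subspace_lattice_simps [simp]:
  "carrier subspace_lattice = {U. vec.subspace U}"
  "x \<sqsubseteq>\<^bsub>subspace_lattice\<^esub> y \<longleftrightarrow> x \<subseteq> y"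
  "x .=\<^bsub>subspace_lattice\<^esub> y \<longleftrightarrow> x = y"
  by (simp_all add: subspace_lattice_def)

lemma bottom_subspace_lattice: "\<bottom>\<^bsub>subspace_lattice\<^esub> = ({0} :: ('a::field ^ 'n) set)"
proof -
  have "least subspace_lattice x (carrier subspace_lattice) \<longleftrightarrow> x = ({0} :: ('a ^ 'n) set)" for x
  proof
    assume "least subspace_lattice x (carrier subspace_lattice)"
    then have "vec.subspace x" "x \<subseteq> {0}"
      unfolding least_def using vec.subspace_single_0 by auto
    then show "x = {0}"
      using vec.subspace_0[of x] by blast
  qed (auto simp: least_def vec.subspace_single_0 vec.subspace_0)
  then show ?thesis
    by (simp add: bottom_def)
qed

lemma top_subspace_lattice: "\<top>\<^bsub>subspace_lattice\<^esub> = (UNIV :: ('a::field ^ 'n) set)"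
proof -
  have "greatest subspace_lattice x (carrier subspace_lattice) \<longleftrightarrow> x = (UNIV :: ('a ^ 'n) set)" for x
    unfolding greatest_def using vec.subspace_UNIV by (auto dest!: spec[of _ UNIV])
  then show ?thesis
    by (simp add: top_def)
qed

lemma remove_bottom_simps [simp]:
  "carrier (remove_bottom subspace_lattice) = {U :: ('a::field ^ 'n) set. vec.subspace U \<and> U \<noteq> {0}}"
  "(x :: ('a::field ^ 'n) set) \<sqsubseteq>\<^bsub>remove_bottom subspace_lattice\<^esub> y \<longleftrightarrow> x \<subseteq> y"
  "(x :: ('a::field ^ 'n) set) .=\<^bsub>remove_bottom subspace_lattice\<^esub> y \<longleftrightarrow> x = y"
  by (auto simp: remove_bottom_def bottom_subspace_lattice)

lemma poset_rank_remove_bottom: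
  fixes U :: "('a::field ^ 'n) set"
  assumes "vec.subspace U" "U \<noteq> {0}"
  shows "poset_rank (remove_bottom subspace_lattice) U = vec.dim U - 1"
proof -
  obtain xs where xs: "sorted_wrt (\<subset>) xs" "length xs = vec.dim U"
      "\<forall>W\<in>set xs. vec.subspace W \<and> W \<noteq> {0} \<and> W \<subseteq> U"
    using flag_obtain[OF assms(1)] .
  let ?P = "(remove_bottom subspace_lattice)\<lparr>carrier := {y \<in> carrier (remove_bottom subspace_lattice).
     y \<sqsubseteq>\<^bsub>remove_bottom subspace_lattice\<^esub> U}\<rparr>"
  have less: "x \<sqsubset>\<^bsub>?P\<^esub> y \<longleftrightarrow> x \<subset> y" for x y
    by (auto simp: lless_def remove_bottom_def subspace_lattice_def)
  have car: "carrier ?P = {W. vec.subspace W \<and> W \<noteq> {0} \<and> W \<subseteq> U}"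
    by auto
  show ?thesis
    unfolding poset_rank_def
  proof (rule poset_length_eqI[where r = vec.dim and a = 1 and xs = xs])
    fix x assume "x \<in> carrier ?P"
    then have x: "vec.subspace x" "x \<noteq> {0}" "x \<subseteq> U"
      unfolding car by auto
    then have "vec.dim x > 0"
      using dim_0_iff[of x] by (metis gr0I)
    moreover have "vec.dim x \<le> vec.dim U"
      using x(3) by (rule vec.dim_subset)
    ultimately show "vec.dim x \<in> {1..<1 + vec.dim U}"
      by simp
  next
    fix x y assume "x \<in> carrier ?P" "y \<in> carrier ?P" "x \<sqsubset>\<^bsub>?P\<^esub> y"
    then show "vec.dim x < vec.dim y"
      unfolding less car by (intro subspace_psubset_dim) simp_all
  next
    show "xs \<in> poset_chains ?P"
      unfolding poset_chains_def less car using xs by blast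
  qed (rule xs(2))
qed

lemma poset_length_subspace_lattice: "poset_length (subspace_lattice :: ('a::field ^ 'n) set gorder) = CARD('n)"
proof -
  obtain xs :: "('a ^ 'n) set list" where xs: "sorted_wrt (\<subset>) xs" "length xs = vec.dim (UNIV :: ('a ^ 'n) set)"
      "\<forall>W\<in>set xs. vec.subspace W \<and> W \<noteq> {0} \<and> W \<subseteq> UNIV"
    using flag_obtain[OF vec.subspace_UNIV] .
  let ?P = "subspace_lattice :: ('a::field ^ 'n) set gorder"
  have less: "x \<sqsubset>\<^bsub>?P\<^esub> y \<longleftrightarrow> x \<subset> y" for x y
    by (auto simp: lless_def)
  have "poset_length ?P = Suc CARD('n) - 1"
  proof (rule poset_length_eqI[where r = vec.dim and a = 0 and xs = "{0} # xs"])
    fix x assume "x \<in> carrier ?P"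
    then show "vec.dim x \<in> {0..<0 + Suc CARD('n)}"
      using vec.dim_subset_UNIV[of x] vec_dim_card[where 'a='a and 'n='n] by (simp add: less_Suc_eq_le vec.dimension_def)
  next
    fix x y assume "x \<in> carrier ?P" "y \<in> carrier ?P" "x \<sqsubset>\<^bsub>?P\<^esub> y"
    then show "vec.dim x < vec.dim y"
      unfolding less by (intro subspace_psubset_dim) simp_all
  next
    have "{0} \<subset> W" if "W \<in> set xs" for W
      using xs(3) that vec.subspace_0[of W] by blast
    then show "{0} # xs \<in> poset_chains ?P"
      unfolding poset_chains_def less using xs by (auto simp: vec.subspace_single_0)
  next
    show "length ({0} # xs) = Suc CARD('n)"
      using xs(2) by (simp add: card_cart_basis)
  qed
  then show ?thesis by simp
qed

lemma poset_rank_chain_poset: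
  assumes "i < n"
  shows "poset_rank (chain_poset n) i = i"
proof -
  let ?P = "(chain_poset n)\<lparr>carrier := {y \<in> carrier (chain_poset n). y \<sqsubseteq>\<^bsub>chain_poset n\<^esub> i}\<rparr>"
  have less: "x \<sqsubset>\<^bsub>?P\<^esub> y \<longleftrightarrow> x < y" for x y
    by (auto simp: lless_def chain_poset_def)
  have car: "carrier ?P = {..i}"
    using assms by (auto simp: chain_poset_def)
  have "poset_rank (chain_poset n) i = Suc i - 1"
    unfolding poset_rank_def
  proof (rule poset_length_eqI[where r = id and a = 0 and xs = "[0..<Suc i]"])
    show "[0..<Suc i] \<in> poset_chains ?P"
      unfolding poset_chains_def less car using sorted_wrt_upt[of 0 "Suc i"] by (auto simp del: upt_Suc)
  qed (unfold less car, auto)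
  then show ?thesis by simp
qed

lemma covers_remove_bottom:
  fixes U V :: "('a::field ^ 'n) set"
  shows "covers (remove_bottom subspace_lattice) V U \<longleftrightarrow>
    vec.subspace U \<and> U \<noteq> {0} \<and> vec.subspace V \<and> U \<subset> V \<and> vec.dim V = Suc (vec.dim U)"
proof -
  let ?P = "remove_bottom subspace_lattice :: ('a ^ 'n) set gorder"
  have less: "x \<sqsubset>\<^bsub>?P\<^esub> y \<longleftrightarrow> x \<subset> y" for x y
    by (auto simp: lless_def)
  show ?thesis
  proof
    assume c: "covers ?P V U"
    then have UV: "vec.subspace U" "U \<noteq> {0}" "vec.subspace V" "U \<subset> V"
      unfolding covers_def less by auto
    from subspace_between[OF UV(1,3,4)]
    obtain W where W: "vec.subspace W" "U \<subseteq> W" "W \<subseteq> V" "vec.dim W = Suc (vec.dim U)" .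
    have "U \<noteq> W" "W \<noteq> {0}"
      using W dim_0_iff[OF W(1)] by auto
    then have "W = V"
      using c W unfolding covers_def less by auto
    then show "vec.subspace U \<and> U \<noteq> {0} \<and> vec.subspace V \<and> U \<subset> V \<and> vec.dim V = Suc (vec.dim U)"
      using UV W by simp
  next
    assume UV: "vec.subspace U \<and> U \<noteq> {0} \<and> vec.subspace V \<and> U \<subset> V \<and> vec.dim V = Suc (vec.dim U)"
    have between: "\<not> (U \<subset> z \<and> z \<subset> V)" if z: "vec.subspace z" for z
    proof
      assume "U \<subset> z \<and> z \<subset> V"
      then have "vec.dim U < vec.dim z" "vec.dim z < vec.dim V"
        using subspace_psubset_dim z UV by blast+
      then show False
        using UV by simp
    qed
    have "V \<noteq> {0}"
      using UV dim_0_iff[of V] by (metis nat.distinct(1))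
    then show "covers ?P V U"
      unfolding covers_def less remove_bottom_simps using UV between by blast
  qed
qed

lemma covers_chain_poset: "covers (chain_poset n) k i \<longleftrightarrow> k < n \<and> k = Suc i"
proof -
  have less: "x \<sqsubset>\<^bsub>chain_poset n\<^esub> y \<longleftrightarrow> x < y" for x y
    by (auto simp: lless_def chain_poset_def)
  have car: "carrier (chain_poset n) = {..<n}"
    by (auto simp: chain_poset_def)
  show ?thesis
  proof
    assume "covers (chain_poset n) k i"
    then have k: "k < n" "i < k" and no: "\<not> (\<exists>z\<in>{..<n}. i < z \<and> z < k)"
      unfolding covers_def less car by auto
    then have "\<not> Suc i < k"
      by (meson lessI lessThan_iff less_trans)
    then show "k < n \<and> k = Suc i"
      using k by simp
  next
    assume "k < n \<and> k = Suc i"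
    then show "covers (chain_poset n) k i"
      unfolding covers_def less car by simp
  qed
qed

lemma rees_carrier_subspace_lattice:
  "rees_carrier (remove_bottom subspace_lattice) (chain_poset CARD('n)) = (rees_pairs :: (('a::field ^ 'n) set \<times> nat) set)"
proof -
  have "vec.subspace U \<and> U \<noteq> {0} \<and> i < CARD('n) \<and> poset_rank (chain_poset CARD('n)) i \<le> poset_rank (remove_bottom subspace_lattice) U
      \<longleftrightarrow> vec.subspace U \<and> i < vec.dim U" for U :: "('a ^ 'n) set" and i
  proof (cases "vec.subspace U")
    case True
    have "vec.dim U \<le> CARD('n)"
      using vec.dim_subset_UNIV[of U] vec_dim_card[where 'a='a and 'n='n] by (simp add: vec.dimension_def)
    moreover have "poset_rank (remove_bottom subspace_lattice) U = vec.dim U - 1" "vec.dim U > 0" if "U \<noteq> {0}"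
      using poset_rank_remove_bottom[OF True that] dim_0_iff[OF True] that by (simp, metis gr0I)
    moreover have "poset_rank (chain_poset CARD('n)) i = i" if "i < CARD('n)"
      using that by (rule poset_rank_chain_poset)
    moreover have "vec.dim U = 0" if "U = {0}"
      using dim_0_iff[OF True] that by metis
    ultimately show ?thesis
      using True by (cases "U = {0}"; cases "i < CARD('n)") (simp_all; linarith)+
  qed simp
  then show ?thesis
    unfolding rees_carrier_def rees_pairs_def by (auto simp: chain_poset_def)
qed

lemma rees_covers_subspace_lattice:
  fixes x y :: "('a::field ^ 'n) set \<times> nat"
  shows "rees_covers (remove_bottom subspace_lattice) (chain_poset CARD('n)) y x \<longleftrightarrow>
    x \<in> rees_pairs \<and> y \<in> rees_pairs \<and> pair_le x y \<and> vec.dim (fst y) = Suc (vec.dim (fst x))"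
proof -
  let ?d = "vec.dim (fst x)"
  have less_n: "snd y < CARD('n)" if "y \<in> rees_pairs"
    using that by (auto simp: rees_carrier_subspace_lattice[symmetric] rees_carrier_def chain_poset_def)
  show ?thesis
  proof (cases "x \<in> rees_pairs \<and> y \<in> rees_pairs \<and> vec.dim (fst y) = Suc ?d")
    case True
    then have sub: "vec.subspace (fst x)" "vec.subspace (fst y)" and "snd x < ?d"
      by (auto simp: rees_pairs_def)
    then have "fst x \<noteq> {0}"
      using dim_0_iff[OF sub(1)] by (metis less_nat_zero_code)
    moreover have "fst x \<noteq> fst y"
      using True by (metis n_not_Suc_n)
    moreover have "snd x \<le> snd y \<and> snd y + ?d \<le> snd x + vec.dim (fst y) \<longleftrightarrow> snd y = snd x \<or> snd y = Suc (snd x)"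
      using True by auto
    ultimately show ?thesis
      using True sub less_n
      unfolding rees_covers_def rees_carrier_subspace_lattice covers_remove_bottom covers_chain_poset pair_le_def
      by (simp add: psubset_eq)
  next
    case False
    then show ?thesis
      unfolding rees_covers_def rees_carrier_subspace_lattice covers_remove_bottom by blast
  qed
qed

lemma le_rees_product:
  fixes x y :: "('a::field ^ 'n) set \<times> nat"
  assumes x: "x \<in> rees_pairs" and y: "y \<in> rees_pairs"
  shows "x \<sqsubseteq>\<^bsub>rees_product (remove_bottom subspace_lattice) (chain_poset CARD('n))\<^esub> y \<longleftrightarrow> pair_le x y"
proof -
  define C where "C x y \<longleftrightarrow> x \<in> rees_pairs \<and> y \<in> rees_pairs \<and> pair_le x y \<and> vec.dim (fst y) = Suc (vec.dim (fst x))"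
    for x y :: "('a ^ 'n) set \<times> nat"
  have "C\<^sup>*\<^sup>* x y \<longleftrightarrow> pair_le x y"
  proof
    assume "C\<^sup>*\<^sup>* x y"
    then show "pair_le x y"
    proof (induction rule: rtranclp_induct)
      case base
      show ?case by (simp add: pair_le_def)
    next
      case (step y z)
      then show ?case
        using pair_le_trans unfolding C_def by blast
    qed
  next
    assume "pair_le x y"
    then show "C\<^sup>*\<^sup>* x y"
      using x
    proof (induction "vec.dim (fst y) - vec.dim (fst x)" arbitrary: x rule: less_induct)
      case less
      have sub: "vec.subspace (fst x)" "vec.subspace (fst y)"
        using less.prems(2) y by (auto simp: rees_pairs_def)
      show ?case
      proof (cases "x = y")
        case False
        then have lt: "pair_lt x y"
          using less.prems by (simp add: pair_lt_def)
        have dims: "vec.dim (fst x) < vec.dim (fst y)"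
          using pair_lt_dim[OF sub lt] .
        then have "fst x \<subset> fst y"
          using less.prems(1) by (auto simp: pair_le_def)
        from subspace_between[OF sub this]
        obtain W where W: "vec.subspace W" "fst x \<subseteq> W" "W \<subseteq> fst y" "vec.dim W = Suc (vec.dim (fst x))" .
        \<comment> \<open>The second component is raised as early as possible; delaying it might
          leave too few dimensions to reach \<open>snd y\<close>.\<close>
        define w where "w = (W, if snd x = snd y then snd x else Suc (snd x))"
        have "C x w" "pair_le w y" "w \<in> rees_pairs"
          using W less.prems dims by (auto simp: C_def w_def pair_le_def rees_pairs_def)
        moreover have "vec.dim (fst y) - vec.dim (fst w) < vec.dim (fst y) - vec.dim (fst x)"
          using W dims by (simp add: w_def)
        ultimately show ?thesis
          using less.hyps[of w] by (meson converse_rtranclp_into_rtranclp)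
      qed simp
    qed
  qed
  then show ?thesis
    by (simp add: rees_product_def rees_covers_subspace_lattice C_def[abs_def])
qed

lemma rees_ideal_subspace_lattice:
  assumes "j < CARD('n)"
  defines "P \<equiv> rees_ideal (subspace_lattice :: ('a::field ^ 'n) set gorder) j"
  shows "carrier P = proper_ideal (UNIV, j)"
    and "\<And>x y. x \<in> carrier P \<Longrightarrow> y \<in> carrier P \<Longrightarrow> x \<sqsubset>\<^bsub>P\<^esub> y \<longleftrightarrow> pair_lt x y"
proof -
  let ?R = "rees_product (remove_bottom subspace_lattice) (chain_poset CARD('n)) :: (('a ^ 'n) set \<times> nat) gorder"
  have P: "P = ?R\<lparr>carrier := {y \<in> carrier ?R. y \<sqsubset>\<^bsub>?R\<^esub> (UNIV, j)}\<rparr>"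
    unfolding P_def rees_ideal_def open_principal_ideal_def poset_length_subspace_lattice top_subspace_lattice ..
  have car: "carrier ?R = rees_pairs"
    by (simp add: rees_product_def rees_carrier_subspace_lattice)
  have less: "x \<sqsubset>\<^bsub>?R\<^esub> y \<longleftrightarrow> pair_lt x y" if "x \<in> rees_pairs" "y \<in> rees_pairs" for x y :: "('a ^ 'n) set \<times> nat"
    using le_rees_product[OF that] by (simp add: lless_def pair_lt_def) (simp add: rees_product_def)
  have t: "(UNIV :: ('a ^ 'n) set, j) \<in> rees_pairs"
    using assms(1) by (simp add: rees_pairs_def vec.subspace_UNIV card_cart_basis)
  show carP: "carrier P = proper_ideal (UNIV, j)"
    unfolding P proper_ideal_def using less[OF _ t] by (auto simp: car)
  show "x \<sqsubset>\<^bsub>P\<^esub> y \<longleftrightarrow> pair_lt x y" if "x \<in> carrier P" "y \<in> carrier P" for x y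
  proof -
    have "x \<in> rees_pairs" "y \<in> rees_pairs"
      using that unfolding carP by (auto simp: proper_ideal_def)
    then show ?thesis
      using less[of x y] unfolding P by (simp add: lless_def)
  qed
qed

section \<open>Counting subspaces and chains\<close>

text \<open>For \<open>U\<close> of codimension one in \<open>V\<close> and \<open>v\<close> outside
  \<open>U\<close>, each vector of \<open>V\<close> is \<open>a *s v + u\<close> for exactly one
  scalar \<open>a\<close> and one \<open>u\<close> in \<open>U\<close>.\<close>

lemma card_subspace:
  fixes V :: "('a::{field,finite} ^ 'n) set"
  assumes "vec.subspace V"
  shows "card V = CARD('a) ^ vec.dim V"
  using assms
proof (induction "vec.dim V" arbitrary: V)
  case 0
  then show ?case
    using dim_0_iff[of V] by simp
next
  case (Suc m)
  obtain U where U: "vec.subspace U" "U \<subseteq> V" "vec.dim U = m"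
    using flag_exists[OF Suc.prems, of m] Suc.hyps(2) by auto
  then obtain v where v: "v \<in> V" "v \<notin> U"
    using Suc.hyps(2) by (metis n_not_Suc_n subsetI subset_antisym)
  define f where "f = (\<lambda>(a, u). a *s v + u)"
  have span: "vec.span (insert v U) = V"
  proof (rule subspace_dim_eq)
    show "vec.span (insert v U) \<subseteq> V"
      using U v Suc.prems by (intro vec.span_minimal) auto
    show "vec.dim V \<le> vec.dim (vec.span (insert v U))"
      using dim_insert_vec[OF U(1) v(2)] U(3) Suc.hyps(2) by simp
  qed (use Suc.prems in auto)
  have "f ` (UNIV \<times> U) = V"
  proof (intro Set.set_eqI iffI)
    fix x assume "x \<in> f ` (UNIV \<times> U)"
    then obtain a u where "x = a *s v + u" "u \<in> U"
      by (auto simp: f_def)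
    then show "x \<in> V"
      using U v Suc.prems by (auto intro: vec.subspace_add vec.subspace_scale)
  next
    fix x assume "x \<in> V"
    then have "x \<in> vec.span (insert v U)"
      using span by simp
    then obtain a where "x - a *s v \<in> vec.span U"
      unfolding vec.span_insert by blast
    then have "x - a *s v \<in> U"
      unfolding vec.span_eq_iff[THEN iffD2, OF U(1)] .
    then show "x \<in> f ` (UNIV \<times> U)"
      by (intro image_eqI[of _ _ "(a, x - a *s v)"]) (auto simp: f_def)
  qed
  moreover have "inj_on f (UNIV \<times> U)"
  proof (rule inj_onI)
    fix x y assume x: "x \<in> UNIV \<times> U" and y: "y \<in> UNIV \<times> U" and eq: "f x = f y"
    obtain a u b w where xy: "x = (a, u)" "y = (b, w)" "u \<in> U" "w \<in> U"
      using x y by auto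
    have *: "(a - b) *s v = w - u"
      using eq unfolding xy f_def by (simp add: vec.scale_left_diff_distrib algebra_simps)
    have "a = b"
    proof (rule ccontr)
      assume "a \<noteq> b"
      then have "v = inverse (a - b) *s (w - u)"
        unfolding *[symmetric] vec.scale_scale by (simp only: left_inverse right_minus_eq vec.scale_one not_False_eq_True)
      then have "v \<in> U"
        using U(1) xy by (metis vec.subspace_diff vec.subspace_scale)
      then show False using v by simp
    qed
    then show "x = y"
      using * xy by simp
  qed
  ultimately have "card V = CARD('a) * card U"
    using card_image[of f "UNIV \<times> U"] by (simp add: card_cartesian_product)
  then show ?case
    using Suc.hyps(1)[of U] U Suc.hyps(2)[symmetric] by simp
qed

text \<open>For a list of length \<open>k\<close>, dimension \<open>k\<close> expresses both
  distinctness and linear independence.\<close>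

definition indep_lists :: "('a::field ^ 'n) set \<Rightarrow> nat \<Rightarrow> ('a ^ 'n) list set" where
  "indep_lists V k = {vs. length vs = k \<and> set vs \<subseteq> V \<and> vec.dim (set vs) = k}"

definition subspaces_dim :: "('a::field ^ 'n) set \<Rightarrow> nat \<Rightarrow> ('a ^ 'n) set set" where
  "subspaces_dim V k = {U. vec.subspace U \<and> U \<subseteq> V \<and> vec.dim U = k}"

lemma dim_set_le: "vec.dim (set vs :: ('a::field ^ 'n) set) \<le> length vs"
proof (induction vs)
  case (Cons v vs)
  then show ?case
    by (simp add: vec.dim_insert)
qed simp

lemma card_indep_lists:
  fixes V :: "('a::{field,finite} ^ 'n) set"
  assumes V: "vec.subspace V"
  shows "card (indep_lists V k) = (\<Prod>i<k. CARD('a) ^ vec.dim V - CARD('a) ^ i)"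
proof (induction k)
  case 0
  have "indep_lists V 0 = {[]}"
    by (auto simp: indep_lists_def)
  then show ?case by simp
next
  case (Suc k)
  have eq: "indep_lists V (Suc k) = (\<lambda>(vs, v). v # vs) ` (SIGMA vs:indep_lists V k. V - vec.span (set vs))"
  proof (intro Set.set_eqI iffI)
    fix ws assume ws: "ws \<in> indep_lists V (Suc k)"
    then obtain v vs where vs: "ws = v # vs"
      by (cases ws) (auto simp: indep_lists_def)
    then have "v \<notin> vec.span (set vs) \<and> vec.dim (set vs) = k"
      using ws dim_set_le[of vs] by (auto simp: indep_lists_def vec.dim_insert split: if_splits)
    then show "ws \<in> (\<lambda>(vs, v). v # vs) ` (SIGMA vs:indep_lists V k. V - vec.span (set vs))"
      using ws unfolding vs by (intro image_eqI[of _ _ "(vs, v)"]) (auto simp: indep_lists_def)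
  next
    fix ws assume "ws \<in> (\<lambda>(vs, v). v # vs) ` (SIGMA vs:indep_lists V k. V - vec.span (set vs))"
    then show "ws \<in> indep_lists V (Suc k)"
      by (auto simp: indep_lists_def vec.dim_insert)
  qed
  have fin: "finite (indep_lists V k)"
    by (rule finite_subset[OF _ finite_lists_length_eq[of V k]]) (auto simp: indep_lists_def)
  have "card (V - vec.span (set vs)) = CARD('a) ^ vec.dim V - CARD('a) ^ k" if "vs \<in> indep_lists V k" for vs
  proof -
    have "vec.span (set vs) \<subseteq> V"
      using that V by (intro vec.span_minimal) (auto simp: indep_lists_def)
    then have "card (V - vec.span (set vs)) = card V - card (vec.span (set vs))"
      by (intro card_Diff_subset) auto
    moreover have "vec.dim (vec.span (set vs)) = k"
      using that by (simp add: indep_lists_def)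
    ultimately show ?thesis
      by (simp add: card_subspace[OF V] card_subspace[OF vec.subspace_span])
  qed
  moreover have "inj_on (\<lambda>(vs, v). v # vs) (SIGMA vs:indep_lists V k. V - vec.span (set vs))"
    by (auto simp: inj_on_def)
  ultimately show ?case
    unfolding eq using fin Suc.IH by (simp add: card_image card_SigmaI)
qed

text \<open>Ordered bases are counted twice: each independent list of length \<open>k\<close> in
  \<open>V\<close> is a basis of exactly one \<open>k\<close>-dimensional subspace, its
  span.\<close>

lemma card_subspaces_dim_prod:
  fixes V :: "('a::{field,finite} ^ 'n) set"
  assumes V: "vec.subspace V"
  shows "card (subspaces_dim V k) * (\<Prod>i<k. CARD('a) ^ k - CARD('a) ^ i) = (\<Prod>i<k. CARD('a) ^ vec.dim V - CARD('a) ^ i)"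
proof -
  have fin: "finite (indep_lists U k)" for U :: "('a ^ 'n) set"
    by (rule finite_subset[OF _ finite_lists_length_eq[of U k]]) (auto simp: indep_lists_def)
  have "indep_lists V k = (\<Union>U\<in>subspaces_dim V k. indep_lists U k)"
  proof (intro Set.set_eqI iffI)
    fix vs assume vs: "vs \<in> indep_lists V k"
    have "vec.span (set vs) \<subseteq> V"
      using vs V by (intro vec.span_minimal) (auto simp: indep_lists_def)
    then show "vs \<in> (\<Union>U\<in>subspaces_dim V k. indep_lists U k)"
      using vs vec.span_superset[of "set vs"]
      by (intro UN_I[of "vec.span (set vs)"]) (auto simp: indep_lists_def subspaces_dim_def)
  next
    fix vs assume "vs \<in> (\<Union>U\<in>subspaces_dim V k. indep_lists U k)"
    then show "vs \<in> indep_lists V k"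
      unfolding indep_lists_def subspaces_dim_def by blast
  qed
  moreover have "indep_lists U k \<inter> indep_lists W k = {}"
    if "U \<in> subspaces_dim V k" "W \<in> subspaces_dim V k" "U \<noteq> W" for U W
  proof -
    have "vec.span (set vs) = U" if "U \<in> subspaces_dim V k" "vs \<in> indep_lists U k" for U vs
    proof (rule subspace_dim_eq)
      show "vec.span (set vs) \<subseteq> U"
        using that by (intro vec.span_minimal) (auto simp: indep_lists_def subspaces_dim_def)
    qed (use that in \<open>auto simp: indep_lists_def subspaces_dim_def\<close>)
    then show ?thesis
      using that by blast
  qed
  ultimately have "card (indep_lists V k) = (\<Sum>U\<in>subspaces_dim V k. card (indep_lists U k))"
    using fin by (simp add: card_UN_disjoint)
  also have "\<dots> = (\<Sum>U\<in>subspaces_dim V k. \<Prod>i<k. CARD('a) ^ k - CARD('a) ^ i)"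
    by (intro sum.cong refl) (simp add: card_indep_lists subspaces_dim_def)
  finally show ?thesis
    by (simp add: card_indep_lists[OF V])
qed

lemma q_prod_ratio:
  "k \<le> m \<Longrightarrow> (\<Prod>i<k. q ^ m - q ^ i) * q_prod q (m - k) = q ^ (k choose 2) * q_prod q m"
proof (induction k)
  case (Suc k)
  have 1: "q ^ m = q ^ k * q ^ (m - k)"
    using Suc.prems by (simp flip: power_add)
  have 2: "m - k = Suc (m - Suc k)"
    using Suc.prems by simp
  have "(\<Prod>i<Suc k. q ^ m - q ^ i) * q_prod q (m - Suc k) =
      q ^ k * ((\<Prod>i<k. q ^ m - q ^ i) * (q_prod q (m - Suc k) * (q ^ (m - k) - 1)))"
    unfolding prod.lessThan_Suc using 1 by (simp add: algebra_simps)
  also have "q_prod q (m - Suc k) * (q ^ (m - k) - 1) = q_prod q (m - k)"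
    unfolding 2 by (simp add: q_prod_def)
  finally show ?case
    using Suc by (simp add: numeral_2_eq_2 power_add)
qed (simp add: binomial_eq_0)

lemma card_subspaces_dim:
  fixes V :: "('a::{field,finite} ^ 'n) set"
  assumes V: "vec.subspace V" and k: "k \<le> vec.dim V"
  shows "real (card (subspaces_dim V k)) =
    q_prod (real CARD('a)) (vec.dim V) / (q_prod (real CARD('a)) k * q_prod (real CARD('a)) (vec.dim V - k))"
proof -
  define q where "q = real CARD('a)"
  define m where "m = vec.dim V"
  have "card {0, 1 :: 'a} \<le> CARD('a)"
    by (intro card_mono) auto
  then have q: "q > 1"
    by (simp add: q_def)
  have real_prod: "real (\<Prod>i<k. CARD('a) ^ m' - CARD('a) ^ i) = (\<Prod>i<k. q ^ m' - q ^ i)" if "k \<le> m'" for m'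
    unfolding of_nat_prod
  proof (rule prod.cong)
    fix i assume "i \<in> {..<k}"
    then have "CARD('a) ^ i \<le> CARD('a) ^ m'"
      using that by (intro power_increasing) (auto simp: Suc_le_eq)
    then show "real (CARD('a) ^ m' - CARD('a) ^ i) = q ^ m' - q ^ i"
      by (simp add: of_nat_diff q_def)
  qed simp
  have "real (card (subspaces_dim V k)) * (\<Prod>i<k. q ^ k - q ^ i) = (\<Prod>i<k. q ^ m - q ^ i)"
    using arg_cong[OF card_subspaces_dim_prod[OF V, of k], of real]
    unfolding of_nat_mult m_def[symmetric] real_prod[OF order_refl] real_prod[OF k[folded m_def]] .
  then have "real (card (subspaces_dim V k)) * ((\<Prod>i<k. q ^ k - q ^ i) * q_prod q (k - k)) * q_prod q (m - k) =
      (\<Prod>i<k. q ^ m - q ^ i) * q_prod q (m - k)"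
    by (simp add: q_prod_def)
  then have "real (card (subspaces_dim V k)) * (q ^ (k choose 2) * q_prod q k) * q_prod q (m - k) = q ^ (k choose 2) * q_prod q m"
    unfolding q_prod_ratio[OF order_refl] q_prod_ratio[OF k[folded m_def]] .
  then have "real (card (subspaces_dim V k)) * (q_prod q k * q_prod q (m - k)) = q_prod q m"
    using q by simp
  then show ?thesis
    using q_prod_nonzero[OF q] unfolding q_def[symmetric] m_def[symmetric] by (simp add: eq_divide_eq)
qed

section \<open>Euler characteristics of the ideals\<close>

definition all_chains :: "('a \<Rightarrow> 'a \<Rightarrow> bool) \<Rightarrow> 'a set \<Rightarrow> 'a list set" where
  "all_chains lt A = {xs. sorted_wrt lt xs \<and> set xs \<subseteq> A}"

lemma sorted_wrt_irreflp_distinct: "sorted_wrt lt xs \<Longrightarrow> irreflp lt \<Longrightarrow> distinct xs"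
  by (induction xs) (auto dest: irreflpD)

lemma finite_all_chains:
  assumes "finite A" "irreflp lt"
  shows "finite (all_chains lt A)"
proof (rule finite_subset)
  show "all_chains lt A \<subseteq> {xs. set xs \<subseteq> A \<and> length xs \<le> card A}"
  proof
    fix xs assume "xs \<in> all_chains lt A"
    then have "set xs \<subseteq> A" "distinct xs"
      using sorted_wrt_irreflp_distinct assms(2) by (auto simp: all_chains_def)
    then show "xs \<in> {xs. set xs \<subseteq> A \<and> length xs \<le> card A}"
      using distinct_card[of xs] card_mono[OF assms(1), of "set xs"] by simp
  qed
qed (rule finite_lists_length_le[OF assms(1)])

text \<open>The negative of the reduced Euler characteristic of the order complex, since a chain of
  \<open>m\<close> elements has dimension \<open>m - 1\<close>.\<close>

definition chain_euler :: "('a \<Rightarrow> 'a \<Rightarrow> bool) \<Rightarrow> 'a set \<Rightarrow> real" where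
  "chain_euler lt A = (\<Sum>xs\<in>all_chains lt A. (-1) ^ length xs)"

lemma chain_euler_rec:
  assumes "finite A" "irreflp lt" "transp lt"
  shows "chain_euler lt A = 1 - (\<Sum>y\<in>A. chain_euler lt {z \<in> A. lt z y})"
proof -
  define B where "B y = all_chains lt {z \<in> A. lt z y}" for y
  have fin: "finite (B y)" for y
    unfolding B_def using assms by (intro finite_all_chains) auto
  have eq: "all_chains lt A = insert [] ((\<lambda>(y, ys). ys @ [y]) ` (SIGMA y:A. B y))"
  proof (intro Set.set_eqI iffI)
    fix xs assume xs: "xs \<in> all_chains lt A"
    show "xs \<in> insert [] ((\<lambda>(y, ys). ys @ [y]) ` (SIGMA y:A. B y))"
    proof (cases xs rule: rev_cases)
      case (snoc ys y)
      then have "y \<in> A" "ys \<in> B y"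
        using xs by (auto simp: all_chains_def B_def sorted_wrt_append)
      then show ?thesis
        unfolding snoc by (intro insertI2 image_eqI[of _ _ "(y, ys)"]) auto
    qed simp
  next
    fix xs assume "xs \<in> insert [] ((\<lambda>(y, ys). ys @ [y]) ` (SIGMA y:A. B y))"
    then show "xs \<in> all_chains lt A"
      by (auto simp: all_chains_def B_def sorted_wrt_append)
  qed
  have "chain_euler lt A = 1 + (\<Sum>xs\<in>(\<lambda>(y, ys). ys @ [y]) ` (SIGMA y:A. B y). (-1) ^ length xs)"
    unfolding chain_euler_def eq using assms(1) fin by (subst sum.insert) auto
  also have "(\<Sum>xs\<in>(\<lambda>(y, ys). ys @ [y]) ` (SIGMA y:A. B y). (-1 :: real) ^ length xs) =
      (\<Sum>(y, ys)\<in>(SIGMA y:A. B y). - ((-1) ^ length ys))"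
    by (subst sum.reindex) (auto simp: inj_on_def intro!: sum.cong)
  also have "\<dots> = (\<Sum>y\<in>A. \<Sum>ys\<in>B y. - ((-1) ^ length ys))"
    using assms(1) fin by (subst sum.Sigma) auto
  also have "\<dots> = - (\<Sum>y\<in>A. chain_euler lt {z \<in> A. lt z y})"
    by (simp add: chain_euler_def B_def sum_negf)
  finally show ?thesis by simp
qed

definition ideal_euler :: "('a::field ^ 'n) set \<times> nat \<Rightarrow> real" where
  "ideal_euler t = chain_euler pair_lt (proper_ideal t)"

lemma ideal_euler_rec:
  fixes t :: "('a::{field,finite} ^ 'n) set \<times> nat"
  shows "ideal_euler t = 1 - (\<Sum>y\<in>proper_ideal t. ideal_euler y)"
proof -
  have "{z \<in> proper_ideal t. pair_lt z y} = proper_ideal y" if "y \<in> proper_ideal t" for y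
    using that transp_pair_lt by (auto simp: proper_ideal_def dest: transpD)
  then show ?thesis
    unfolding ideal_euler_def
    using chain_euler_rec[OF finite_proper_ideal[of t] irreflp_pair_lt transp_pair_lt] by simp
qed

text \<open>For \<open>U\<close> of dimension \<open>k < m\<close>, the indices \<open>j\<close>
  with \<open>(U, i)\<close> below \<open>(V, j)\<close> run from \<open>i\<close> to
  \<open>i + (m - k)\<close> and are automatically below \<open>m\<close>. Summing
  \<open>t ^ j\<close> over them gives \<open>t ^ i\<close> times a geometric sum that does not
  depend on \<open>i\<close>.\<close>

lemma ideal_euler_poly_rec:
  fixes V :: "('a::{field,finite} ^ 'n) set" and t :: real
  assumes V: "vec.subspace V"
  defines "m \<equiv> vec.dim V" and "F \<equiv> \<lambda>U :: ('a ^ 'n) set. \<Sum>j<vec.dim U. t ^ j * ideal_euler (U, j)"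
  shows "F V = (\<Sum>j<m. t ^ j) - (\<Sum>k\<in>{1..<m}. \<Sum>U\<in>subspaces_dim V k. F U * (\<Sum>i<Suc (m - k). t ^ i))"
proof -
  define S where "S = {U. vec.subspace U \<and> U \<subseteq> V \<and> vec.dim U \<in> {1..<m}}"
  have finS: "finite S" by simp
  have ideal: "(U, i) \<in> proper_ideal (V, j) \<and> j < m \<longleftrightarrow> U \<in> S \<and> i < vec.dim U \<and> i \<le> j \<and> j \<le> i + (m - vec.dim U)" for U i j
  proof
    assume h: "(U, i) \<in> proper_ideal (V, j) \<and> j < m"
    then have U: "vec.subspace U" "i < vec.dim U" "pair_lt (U, i) (V, j)"
      by (auto simp: proper_ideal_def rees_pairs_def)
    moreover have "vec.dim U < m"
      using pair_lt_dim[of "(U, i)" "(V, j)"] U V by (simp add: m_def)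
    ultimately show "U \<in> S \<and> i < vec.dim U \<and> i \<le> j \<and> j \<le> i + (m - vec.dim U)"
      by (auto simp: S_def pair_lt_def pair_le_def m_def)
  next
    assume h: "U \<in> S \<and> i < vec.dim U \<and> i \<le> j \<and> j \<le> i + (m - vec.dim U)"
    then have "U \<noteq> V"
      by (auto simp: S_def m_def)
    then show "(U, i) \<in> proper_ideal (V, j) \<and> j < m"
      using h by (auto simp: S_def proper_ideal_def rees_pairs_def pair_lt_def pair_le_def m_def)
  qed
  have "(\<Sum>j<m. t ^ j * (\<Sum>y\<in>proper_ideal (V, j). ideal_euler y)) =
      (\<Sum>(j, y)\<in>(SIGMA j:{..<m}. proper_ideal (V, j)). t ^ j * ideal_euler y)"
    by (simp add: sum.Sigma finite_proper_ideal sum_distrib_left)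
  also have "\<dots> = (\<Sum>(U, i, l)\<in>(SIGMA U:S. {..<vec.dim U} \<times> {..<Suc (m - vec.dim U)}). t ^ (i + l) * ideal_euler (U, i))"
  proof (rule sum.reindex_bij_witness[of _ "\<lambda>(U, i, l). (i + l, (U, i))" "\<lambda>(j, (U, i)). (U, i, j - i)"])
    fix a assume "a \<in> (SIGMA j:{..<m}. proper_ideal (V, j))"
    then obtain j U i where a: "a = (j, (U, i))" "(U, i) \<in> proper_ideal (V, j) \<and> j < m"
      by auto
    then have h: "U \<in> S \<and> i < vec.dim U \<and> i \<le> j \<and> j \<le> i + (m - vec.dim U)"
      using ideal by blast
    then show "(case case a of (j, (U, i)) \<Rightarrow> (U, i, j - i) of (U, i, l) \<Rightarrow> (i + l, (U, i))) = a"
      and "(case a of (j, (U, i)) \<Rightarrow> (U, i, j - i)) \<in> (SIGMA U:S. {..<vec.dim U} \<times> {..<Suc (m - vec.dim U)})"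
      and "(case case a of (j, (U, i)) \<Rightarrow> (U, i, j - i) of (U, i, l) \<Rightarrow> t ^ (i + l) * ideal_euler (U, i)) =
        (case a of (j, y) \<Rightarrow> t ^ j * ideal_euler y)"
      by (auto simp: a(1))
  next
    fix b assume "b \<in> (SIGMA U:S. {..<vec.dim U} \<times> {..<Suc (m - vec.dim U)})"
    then obtain U i l where b: "b = (U, i, l)" "U \<in> S" "i < vec.dim U" "l < Suc (m - vec.dim U)"
      by auto
    then have "(U, i) \<in> proper_ideal (V, i + l) \<and> i + l < m"
      by (subst ideal) auto
    then show "(case b of (U, i, l) \<Rightarrow> (i + l, (U, i))) \<in> (SIGMA j:{..<m}. proper_ideal (V, j))"
      and "(case case b of (U, i, l) \<Rightarrow> (i + l, (U, i)) of (j, (U, i)) \<Rightarrow> (U, i, j - i)) = b"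
      by (auto simp: b(1))
  qed
  also have "\<dots> = (\<Sum>U\<in>S. \<Sum>(i, l)\<in>{..<vec.dim U} \<times> {..<Suc (m - vec.dim U)}. t ^ (i + l) * ideal_euler (U, i))"
    by (subst sum.Sigma[OF finS]) auto
  also have "\<dots> = (\<Sum>U\<in>S. F U * (\<Sum>i<Suc (m - vec.dim U). t ^ i))"
    unfolding F_def sum_product sum.cartesian_product
    by (intro sum.cong refl) (auto simp: power_add mult_ac)
  also have "\<dots> = (\<Sum>k\<in>{1..<m}. \<Sum>U\<in>{U \<in> S. vec.dim U = k}. F U * (\<Sum>i<Suc (m - vec.dim U). t ^ i))"
    by (rule sum.group[symmetric]) (auto simp: S_def)
  also have "\<dots> = (\<Sum>k\<in>{1..<m}. \<Sum>U\<in>subspaces_dim V k. F U * (\<Sum>i<Suc (m - k). t ^ i))"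
    by (intro sum.cong) (auto simp: S_def subspaces_dim_def)
  finally show ?thesis
    unfolding F_def m_def[symmetric] by (subst ideal_euler_rec) (simp add: right_diff_distrib sum_subtractf)
qed

theorem ideal_euler_poly:
  fixes V :: "('a::{field,finite} ^ 'n) set" and t :: real
  assumes "vec.subspace V" "vec.dim V > 0" "t \<noteq> 1"
  defines "q \<equiv> real CARD('a)"
  shows "(\<Sum>j<vec.dim V. t ^ j * ideal_euler (V, j)) =
    (-1) ^ (vec.dim V - 1) * (q ^ (vec.dim V choose 2) * exc_weight (1 / q) (q * t) (vec.dim V))"
  using assms(1,2)
proof (induction "vec.dim V" arbitrary: V rule: less_induct)
  case less
  define m where "m = vec.dim V"
  define D where "D k = q ^ (k choose 2) * exc_weight (1 / q) (q * t) k" for k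
  define br where "br k = (\<Sum>i<k. t ^ i)" for k
  have "card {0, 1 :: 'a} \<le> CARD('a)"
    by (intro card_mono) auto
  then have q: "q > 1"
    by (simp add: q_def)
  have m: "m > 0"
    using less.prems by (simp add: m_def)
  have sign: "(-1 :: real) ^ (k - 1) = - ((-1) ^ k)" if "k > 0" for k
    using that by (cases k) auto
  have D0: "D 0 = 1"
    by (simp add: D_def exc_weight_def label_limit.major_def label_limit_def label_limit.desc_def binomial_eq_0 permutes_empty)
  define N where "N k = q_prod q m / (q_prod q k * q_prod q (m - k))" for k
  have "(\<Sum>j<m. t ^ j * ideal_euler (V, j)) = br m - (\<Sum>k\<in>{1..<m}. \<Sum>U\<in>subspaces_dim V k.
      (\<Sum>j<vec.dim U. t ^ j * ideal_euler (U, j)) * br (Suc (m - k)))"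
    using ideal_euler_poly_rec[OF less.prems(1), of t] unfolding m_def br_def .
  also have "(\<Sum>k\<in>{1..<m}. \<Sum>U\<in>subspaces_dim V k. (\<Sum>j<vec.dim U. t ^ j * ideal_euler (U, j)) * br (Suc (m - k))) =
      (\<Sum>k\<in>{1..<m}. - ((-1) ^ k * D k * br (Suc (m - k)) * N k))"
  proof (rule sum.cong)
    fix k assume k: "k \<in> {1..<m}"
    have "(\<Sum>U\<in>subspaces_dim V k. (\<Sum>j<vec.dim U. t ^ j * ideal_euler (U, j)) * br (Suc (m - k))) =
        (\<Sum>U\<in>subspaces_dim V k. (-1) ^ (k - 1) * D k * br (Suc (m - k)))"
    proof (rule sum.cong)
      fix U assume U: "U \<in> subspaces_dim V k"
      then have "(\<Sum>j<vec.dim U. t ^ j * ideal_euler (U, j)) = (-1) ^ (k - 1) * D k"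
        using less.hyps[of U] k by (simp add: subspaces_dim_def m_def D_def)
      then show "(\<Sum>j<vec.dim U. t ^ j * ideal_euler (U, j)) * br (Suc (m - k)) = (-1) ^ (k - 1) * D k * br (Suc (m - k))"
        by simp
    qed simp
    also have "\<dots> = real (card (subspaces_dim V k)) * ((-1) ^ (k - 1) * D k * br (Suc (m - k)))"
      by simp
    also have "real (card (subspaces_dim V k)) = N k"
      using card_subspaces_dim[OF less.prems(1), of k] k by (simp add: N_def q_def m_def)
    finally show "(\<Sum>U\<in>subspaces_dim V k. (\<Sum>j<vec.dim U. t ^ j * ideal_euler (U, j)) * br (Suc (m - k))) =
        - ((-1) ^ k * D k * br (Suc (m - k)) * N k)"
      using sign[of k] k by (simp add: mult_ac)
  qed simp
  also have "br m - (\<Sum>k\<in>{1..<m}. - ((-1) ^ k * D k * br (Suc (m - k)) * N k)) =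
      br m + (\<Sum>k\<in>{1..<m}. (-1) ^ k * D k * br (Suc (m - k)) * N k)"
    by (simp add: sum_negf)
  \<comment> \<open>The recurrence evaluates the sum over \<open>{..m}\<close>. Its outer terms are
    \<open>br (Suc m)\<close> at \<open>k = 0\<close>, for the zero subspace missing from the
    ideals, and the wanted \<open>(-1) ^ m * D m\<close> at \<open>k = m\<close>.\<close>
  also have "(\<Sum>k\<in>{1..<m}. (-1) ^ k * D k * br (Suc (m - k)) * N k) =
      t ^ m - br (Suc m) - (-1) ^ m * D m"
  proof -
    have "{..m} = insert 0 (insert m {1..<m})"
      using m by auto
    then have "(\<Sum>k\<le>m. (-1) ^ k * D k * br (Suc (m - k)) * N k) =
        D 0 * br (Suc m) * N 0 + ((-1) ^ m * D m * br 1 * N m + (\<Sum>k\<in>{1..<m}. (-1) ^ k * D k * br (Suc (m - k)) * N k))"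
      using m by simp
    moreover have "N 0 = 1" "N m = 1"
      using q_prod_nonzero[OF q, of m] by (simp_all add: N_def q_prod_def)
    moreover have "br 1 = 1"
      by (simp add: br_def)
    moreover have "(\<Sum>k\<le>m. (-1) ^ k * D k * br (Suc (m - k)) * N k) = t ^ m"
      using exc_weight_recurrence[OF q assms(3), of m] unfolding D_def br_def N_def .
    ultimately show ?thesis
      by (simp add: D0)
  qed
  \<comment> \<open>Since \<open>br (Suc m) = br m + t ^ m\<close>, only the term with
    \<open>D m\<close> survives.\<close>
  also have "br m + (t ^ m - br (Suc m) - (-1) ^ m * D m) = (-1) ^ (m - 1) * D m"
    using sign[OF m] by (simp add: br_def)
  finally show ?case
    by (simp add: m_def D_def)
qed

lemma list_chains_cong:
  assumes "\<And>x y. x \<in> A \<Longrightarrow> y \<in> A \<Longrightarrow> lt x y \<longleftrightarrow> lt' x y"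
  shows "list_chains lt A m = list_chains lt' A m"
proof -
  have "sorted_wrt lt xs \<longleftrightarrow> sorted_wrt lt' xs" if "set xs \<subseteq> A" for xs
    using that
  proof (induction xs)
    case (Cons x xs)
    then show ?case
      using assms by (auto simp: subset_iff)
  qed simp
  then show ?thesis
    unfolding list_chains_def by blast
qed

text \<open>Chain length \<open>e = CARD('n) - 1\<close> is degree \<open>CARD('n) - 2\<close>. For
  \<open>CARD('n) = 1\<close> this is degree -1 of an empty ideal, covered by the same
  argument.\<close>

lemma dim_rees_ideal_homology:
  fixes q j :: nat
  assumes j: "j < CARD('n)"
  shows "real (vectorspace.dim complex_field (reduced_homology
      (rees_ideal (subspace_lattice :: ('a::{field,finite} ^ 'n) set gorder) j) (int CARD('n) - 2))) =
    (-1) ^ (CARD('n) - 1) * ideal_euler ((UNIV :: ('a ^ 'n) set), j)"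
proof -
  define P where "P = rees_ideal (subspace_lattice :: ('a ^ 'n) set gorder) j"
  define e where "e = CARD('n) - 1"
  define A where "A = proper_ideal ((UNIV :: ('a ^ 'n) set), j)"
  have n: "CARD('n) = Suc e"
    using j by (simp add: e_def)
  have car: "carrier P = A"
    unfolding P_def A_def by (rule rees_ideal_subspace_lattice[OF j])
  have F: "list_chains (\<lambda>x y. x \<sqsubset>\<^bsub>P\<^esub> y) (carrier P) m = list_chains pair_lt A m" for m
    unfolding car[symmetric] by (rule list_chains_cong) (simp add: P_def rees_ideal_subspace_lattice[OF j])
  have t: "(UNIV :: ('a ^ 'n) set, j) \<in> rees_pairs"
    using j by (simp add: rees_pairs_def vec.subspace_UNIV card_cart_basis)
  have finA: "finite A"
    unfolding A_def by (rule finite_proper_ideal)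
  have "acyclic_below pair_lt A e"
    unfolding A_def e_def using acyclic_proper_ideal[OF t] by (simp add: card_cart_basis)
  then have acyc: "acyclic_below (\<lambda>x y. x \<sqsubset>\<^bsub>P\<^esub> y) (carrier P) e"
    unfolding acyclic_below_def chain_group_def F .
  have len: "length xs \<le> e" if xs: "sorted_wrt pair_lt xs" "set xs \<subseteq> A" for xs
  proof -
    have sub: "vec.subspace (fst x) \<and> 0 < vec.dim (fst x) \<and> vec.dim (fst x) < CARD('n)" if "x \<in> A" for x
    proof -
      have "vec.subspace (fst x)" "0 < vec.dim (fst x)" "pair_lt x (UNIV, j)"
        using that by (auto simp: A_def proper_ideal_def rees_pairs_def)
      then show ?thesis
        using pair_lt_dim[of x "(UNIV, j)"] by (simp add: vec.subspace_UNIV card_cart_basis)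
    qed
    have "sorted_wrt (\<lambda>x y. vec.dim (fst x) < vec.dim (fst y)) xs"
      by (rule sorted_wrt_mono_rel[OF _ xs(1)]) (use xs(2) sub pair_lt_dim in blast)
    then have "sorted_wrt (<) (map (\<lambda>x. vec.dim (fst x)) xs)"
      by (simp add: sorted_wrt_map)
    then have "distinct (map (\<lambda>x. vec.dim (fst x)) xs)"
      by (simp add: strict_sorted_iff)
    then have "length xs = card ((\<lambda>x. vec.dim (fst x)) ` set xs)"
      using distinct_card[of "map (\<lambda>x. vec.dim (fst x)) xs"] by simp
    also have "\<dots> \<le> card {1..<CARD('n)}"
      using sub xs(2) by (intro card_mono) (auto simp: Suc_le_eq)
    finally show ?thesis
      by (simp add: e_def)
  qed
  then have "list_chains pair_lt A (Suc e) = {}"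
    by (fastforce simp: list_chains_def)
  then have "(-1) ^ e * real (vectorspace.dim complex_field (reduced_homology P (int e - 1))) =
      (\<Sum>m\<le>e. (-1) ^ m * real (card (list_chains pair_lt A m)))"
    using dim_reduced_homology[OF _ acyc] finA[folded car] unfolding F by simp
  also have "\<dots> = (\<Sum>m\<le>e. \<Sum>xs\<in>{xs \<in> all_chains pair_lt A. length xs = m}. (-1) ^ length xs)"
    by (intro sum.cong refl) (simp add: list_chains_def all_chains_def conj_assoc)
  also have "\<dots> = ideal_euler ((UNIV :: ('a ^ 'n) set), j)"
    unfolding ideal_euler_def chain_euler_def A_def[symmetric] using len
    by (intro sum.group) (auto simp: finite_all_chains[OF finA irreflp_pair_lt], auto simp: all_chains_def)
  finally have "(-1) ^ e * ((-1) ^ e * real (vectorspace.dim complex_field (reduced_homology P (int e - 1)))) =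
      (-1) ^ e * ideal_euler ((UNIV :: ('a ^ 'n) set), j)"
    by simp
  then have "real (vectorspace.dim complex_field (reduced_homology P (int e - 1))) =
      (-1) ^ e * ideal_euler ((UNIV :: ('a ^ 'n) set), j)"
    by (simp add: mult.assoc[symmetric] flip: power_mult_distrib)
  moreover have "int e - 1 = int CARD('n) - 2"
    using n by simp
  ultimately show ?thesis
    by (simp add: P_def e_def)
qed

theorem theorem1p3:
  fixes n q j :: nat
  assumes "CARD('n::finite) = n" and "CARD('a::{field,finite}) = q"
    and "j \<in> {0..n - 1}"
  shows "real (vectorspace.dim complex_field
           (reduced_homology (rees_ideal (subspace_lattice :: ('a ^ 'n) set gorder) j) (int n - 2))) =
         real q ^ ((n choose 2) + j) * poly (maj_exc_coeff n j) (inverse (real q))"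
proof -
  define d where "d i = real (vectorspace.dim complex_field
      (reduced_homology (rees_ideal (subspace_lattice :: ('a ^ 'n) set gorder) i) (int n - 2)))" for i
  define b where "b i = real q ^ ((n choose 2) + i) * poly (maj_exc_coeff n i) (inverse (real q))" for i
  \<comment> \<open>As \<open>exc_weight_coeff\<close> sums up to \<open>n\<close>, the homology
    side is padded with 0 at index \<open>n\<close>.\<close>
  define c where "c i = (if i < n then d i else 0) - b i" for i
  have n: "n > 0"
    using assms(1) by auto
  have zero: "(\<Sum>i\<le>n. c i * t ^ i) = 0" if "t \<noteq> 1" for t :: real
  proof -
    have "(\<Sum>i<n. t ^ i * d i) = (-1) ^ (n - 1) * (\<Sum>i<n. t ^ i * ideal_euler ((UNIV :: ('a ^ 'n) set), i))"
      unfolding sum_distrib_left d_def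
      using dim_rees_ideal_homology[where 'a='a and 'n='n] assms(1) by (intro sum.cong) (auto simp: mult_ac)
    also have "\<dots> = (-1) ^ (n - 1) * ((-1) ^ (n - 1) * (real q ^ (n choose 2) * exc_weight (1 / real q) (real q * t) n))"
      using ideal_euler_poly[of "UNIV :: ('a ^ 'n) set" t] that n assms(1,2)
      by (simp add: vec.subspace_UNIV card_cart_basis)
    also have "\<dots> = real q ^ (n choose 2) * exc_weight (1 / real q) (real q * t) n"
      by (simp add: mult.assoc[symmetric] flip: power_mult_distrib)
    also have "\<dots> = (\<Sum>i\<le>n. b i * t ^ i)"
      unfolding exc_weight_coeff b_def sum_distrib_left
      by (intro sum.cong refl) (simp add: power_add power_mult_distrib inverse_eq_divide mult_ac)
    finally have "(\<Sum>i<n. t ^ i * d i) = (\<Sum>i\<le>n. b i * t ^ i)" .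
    moreover have "(\<Sum>i\<le>n. (if i < n then d i else 0) * t ^ i) = (\<Sum>i<n. t ^ i * d i)"
      by (simp add: lessThan_Suc_atMost[symmetric] mult.commute)
    ultimately show ?thesis
      by (simp add: c_def left_diff_distrib sum_subtractf)
  qed
  \<comment> \<open>Vanishing at all \<open>t \<noteq> 1\<close> is enough, since a nonzero
    polynomial has only finitely many roots.\<close>
  have c: "c i = 0" if "i \<le> n" for i
  proof (rule ccontr)
    assume "c i \<noteq> 0"
    then have "finite {z. (\<Sum>i\<le>n. c i * z ^ i) = 0}"
      using Transcendental.polyfun_rootbound[of c i n] that by blast
    moreover have "- {1} \<subseteq> {z. (\<Sum>i\<le>n. c i * z ^ i) = 0}"
      using zero by auto
    ultimately have "finite (- {1 :: real})"
      by (rule finite_subset[rotated])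
    then show False
      using infinite_UNIV_char_0[where 'a = real] finite_compl[of "{1 :: real}"] by simp
  qed
  have "j < n"
    using assms(3) n by auto
  then have "d j = b j"
    using c[of j] by (simp add: c_def)
  then show ?thesis
    by (simp add: d_def b_def)
qed

end
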